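(* Let $G$ be an amenable group that satisfies the Ornstein-Weiss lemma, let $\phi$ be an action of $G$ on a compact metric space $(X,d)$, and let $\psi$ be a factor of $\phi$ via a factor map $p\colon X\to Y$. Let $\Lambda$ be a relatively dense subset of $G$, let $(A_i)_{i\in I}$ be a Van Hove net in $G$, and set $F_i:=A_i\cap\Lambda$. (i) If $\Lambda$ has a well defined uniform density $\operatorname{dens}(\Lambda)$, then $$\operatorname{E}(\phi\overset{p}{\to}\psi)=\operatorname{dens}(\Lambda)\sup_{\epsilon>0}\lim_{i\in I}\frac{\log\left(\sup_{y\in Y}\operatorname{cov}_{p^{-1}(y)}[d_{F_i}<\epsilon]\right)}{|F_i|}.$$ (ii) If $\Lambda$ is a uniform lattice, then $$\operatorname{E}(\phi\overset{p}{\to}\psi)=\operatorname{dens}(\Lambda)\operatorname{E}\left(\phi\big|_{\Lambda\times X}\overset{p}{\to}\psi\big|_{\Lambda\times Y}\right).$$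
   Context: Topological groups are assumed $T_1$ (hence Hausdorff). A locally compact group $G$ is unimodular if it admits a Haar measure, meaning a non-zero regular Borel measure $\mu$ with $\mu(gA)=\mu(A)=\mu(Ag)$ for all $g\in G$ and all Borel sets $A\subseteq G$; it is unique up to scaling and $\mu$ denotes a fixed one (counting measure if the group is discrete). For $A,B\subseteq G$ write $AB=\{ab: a\in A, b\in B\}$ and $A^c=G\setminus A$. For $K,A\subseteq G$ the $K$-boundary of $A$ is $\partial_K A:=K\overline{A}\cap K\overline{A^c}$. A directed set is a non-empty partially ordered set in which every finite subset has an upper bound; a net is a family indexed by a directed set. A net $(A_i)_{i\in I}$ of compact subsets of a unimodular group $G$ is a Van Hove net if there is $j\in I$ such that $A_i$ has non-empty interior for all $i\ge j$, and $\lim_{i\in I}\mu(\partial_K A_i)/\mu(A_i)=0$ for every compact $K\subseteq G$. An amenable group is a unimodular (locally compact) group that contains a Van Hove net. $\mathcal{K}(G)$ is the set of all compact subsets of $G$. A function $f\colon\mathcal{K}(G)\to\mathbb{R}$ is subadditive if $f(A\cup B)\le f(A)+f(B)$ for all disjoint $A,B\in\mathcal{K}(G)$; right invariant if $f(Ag)=f(A)$ for all $A\in\mathcal{K}(G)$, $g\in G$; monotone if $f(A)\le f(B)$ whenever $A,B\in\mathcal{K}(G)$ and $A\subseteq B$. An amenable group $G$ satisfies the Ornstein-Weiss lemma if for every subadditive, right invariant and monotone $f\colon\mathcal{K}(G)\to\mathbb{R}$ the limit $\lim_{i\in I} f(A_i)/\mu(A_i)$ exists, is finite, and does not depend on the choice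 of the Van Hove net $(A_i)_{i\in I}$ in $G$. Every discrete amenable group satisfies the Ornstein-Weiss lemma. A subset $\Lambda\subseteq G$ is relatively dense if $K\Lambda=G$ for some compact $K\subseteq G$. $|F|$ denotes the cardinality of a set $F$. A discrete subset $\Lambda\subseteq G$ has a well defined uniform density if $\operatorname{dens}(\Lambda):=\lim_{i\in I}|\Lambda\cap A_i|/\mu(A_i)$ exists, is finite and is independent of the choice of the Van Hove net $(A_i)_{i\in I}$ in $G$. A uniform lattice in $G$ is a discrete subgroup $\Lambda$ with $G/\Lambda$ compact; every uniform lattice has a well defined uniform density, equal to $\mu(C)^{-1}$ for a pre-compact Borel fundamental domain $C$ (a set such that every $g\in G$ is uniquely $g=cz$ with $c\in C$, $z\in\Lambda$). An action of $G$ on a topological space $X$ is a continuous map $\phi\colon G\times X\to X$ with $\phi(e_G,\cdot)=\mathrm{id}_X$ ($e_G$ the neutral element) and $\phi(g,\phi(g',\cdot))=\phi(gg',\cdot)$; write $\phi^g=\phi(g,\cdot)$. If $\psi$ is an action of $G$ on a topological space $Y$, a factor map is a surjective continuous $p\colon X\to Y$ with $p\circ\phi^g=\psi^g\circ p$ for all $g\in G$; then $\psi$ is called a factor of $\phi$ (via $p$). The restrictions $\phi|_{\Lambda\times X}$, $\psi|_{\Lambda\times Y}$ are actions of the discrete group $\Lambda$ if $\Lambda$ is a uniform lattice. For compact $A\subseteq G$ let $d_A(x,y):=\max_{g\in A}d(\phi^g(x),\phi^g(y))$. For $M\subseteq X$ and $\epsilon>0$, $\operatorname{cov}_M[d_A<\epsilon]$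 is the minimum cardinality of an open cover of $M$ consisting of sets of $d_A$-diameter (supremum of $d_A$ over pairs of points) strictly less than $\epsilon$. The relative topological entropy is $$\operatorname{E}(\phi\overset{p}{\to}\psi):=\sup_{\epsilon>0}\lim_{i\in I}\frac{\log\left(\sup_{y\in Y}\operatorname{cov}_{p^{-1}(y)}[d_{A_i}<\epsilon]\right)}{\mu(A_i)}$$ for any Van Hove net $(A_i)_{i\in I}$ in the acting group (the limit exists and is independent of the net by the Ornstein-Weiss lemma); for actions of $\Lambda$ it is defined in the same way with the counting measure and Van Hove nets in $\Lambda$.
   Formalization: In (i) the limit over i at a fixed ε need not exist for a general relatively dense Λ with uniform density, so the formula is stated and proved with lim replaced by liminf and also by limsup; both hold, which gives the displayed formula whenever the limits exist. *)

theory Defs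
  imports "HOL-Analysis.Analysis" "HOL-Algebra.Coset"
begin

section \<open>Nets\<close>

definition directed_set :: "'i set \<Rightarrow> ('i \<times> 'i) set \<Rightarrow> bool" where
  "directed_set I r \<longleftrightarrow>
     partial_order_on I r \<and> I \<noteq> {} \<and> (\<forall>F. finite F \<and> F \<subseteq> I \<longrightarrow> (\<exists>u\<in>I. \<forall>i\<in>F. (i, u) \<in> r))"

definition net_filter :: "'i set \<Rightarrow> ('i \<times> 'i) set \<Rightarrow> 'i filter" where
  "net_filter I r = (INF j\<in>I. principal {i\<in>I. (j, i) \<in> r})"

text \<open>HOL cannot quantify over all index types inside a formula. Where a definition ranges
  over all nets with values in the type 'a, the nets are indexed by directed sets in the type
  \<open>'a net_index\<close>. The lemmas \<open>net_reindex\<close> and \<open>van_hove_net_reindex\<close> below show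
  that this loses nothing: every net, over any index type, has the same limits as such a net.\<close>

type_synonym 'a net_index = "'a set \<times> 'a \<times> nat"

lemma eventually_net_filter:
  assumes "directed_set I r"
  shows "eventually P (net_filter I r) \<longleftrightarrow> (\<exists>j\<in>I. \<forall>i\<in>I. (j, i) \<in> r \<longrightarrow> P i)"
proof -
  have ub: "\<exists>u\<in>I. {i\<in>I. (u, i) \<in> r} \<subseteq> {i\<in>I. (a, i) \<in> r} \<inter> {i\<in>I. (b, i) \<in> r}"
    if "a \<in> I" "b \<in> I" for a b
  proof -
    have tr: "trans r"
      using assms by (simp add: directed_set_def partial_order_on_def preorder_on_def)
    have "finite {a, b}" "{a, b} \<subseteq> I"
      using that by auto
    then obtain u where "u \<in> I" "\<forall>i\<in>{a, b}. (i, u) \<in> r"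
      using assms unfolding directed_set_def by blast
    then show ?thesis
      using tr by (intro bexI[of _ u]) (auto dest: transD)
  qed
  have "eventually P (net_filter I r) \<longleftrightarrow>
      (\<exists>j\<in>I. eventually P (principal {i\<in>I. (j, i) \<in> r}))"
    unfolding net_filter_def
  proof (rule eventually_INF_base)
    show "I \<noteq> {}"
      using assms by (simp add: directed_set_def)
    show "\<exists>x\<in>I. principal {i\<in>I. (x, i) \<in> r} \<le>
        inf (principal {i\<in>I. (a, i) \<in> r}) (principal {i\<in>I. (b, i) \<in> r})"
      if "a \<in> I" "b \<in> I" for a b
      using ub[OF that] by simp
  qed
  then show ?thesis
    by (auto simp: eventually_principal)
qed

lemma filterlim_reindex:
  assumes "filtermap B N = filtermap A M"
  shows "filterlim (\<lambda>j. f (B j)) F N \<longleftrightarrow> filterlim (\<lambda>i. f (A i)) F M"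
proof -
  have "filtermap (\<lambda>j. f (B j)) N = filtermap f (filtermap B N)"
    "filtermap (\<lambda>i. f (A i)) M = filtermap f (filtermap A M)"
    by (simp_all add: filtermap_filtermap)
  then show ?thesis
    using assms by (simp add: filterlim_def)
qed

lemma net_reindex:
  fixes A :: "'i \<Rightarrow> 'a"
  assumes dir: "directed_set I r"
  obtains J :: "'a net_index set" and s and B :: "'a net_index \<Rightarrow> 'a"
  where "directed_set J s" "B ` J \<subseteq> A ` I"
    "filtermap B (net_filter J s) = filtermap A (net_filter I r)"
proof -
  define P where "P j = A ` {i\<in>I. (j, i) \<in> r}" for j
  define J :: "'a net_index set" where "J = {(Q, x, n). (\<exists>j\<in>I. Q = P j) \<and> x \<in> Q}"
  define s where "s = {(a, b). a \<in> J \<and> b \<in> J \<and>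
    (a = b \<or> (fst b \<subseteq> fst a \<and> snd (snd a) < snd (snd b)))}"
  define B :: "'a net_index \<Rightarrow> 'a" where "B = (\<lambda>a. fst (snd a))"
  have po: "refl_on I r" "trans r" "I \<noteq> {}"
    using dir by (auto simp: directed_set_def partial_order_on_def preorder_on_def)
  have P_self: "A j \<in> P j" if "j \<in> I" for j
    using that po(1) by (auto simp: P_def refl_on_def)
  have P_mono: "P u \<subseteq> P j" if "(j, u) \<in> r" for j u
    using that po(2) by (auto simp: P_def dest: transD)
  have "directed_set J s"
    unfolding directed_set_def
  proof (intro conjI allI impI)
    show "partial_order_on J s"
      unfolding partial_order_on_def preorder_on_def
    proof (intro conjI)
      show "refl_on J s" "s \<subseteq> J \<times> J"
        by (auto simp: s_def refl_on_def)
      show "trans s"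
        unfolding s_def by (rule transI) force
      show "antisym s"
        unfolding s_def by (rule antisymI) force
    qed
    from po(3) obtain j where "j \<in> I"
      by blast
    then have "(P j, A j, 0) \<in> J"
      using P_self by (auto simp: J_def)
    then show "J \<noteq> {}"
      by blast
    fix F assume F: "finite F \<and> F \<subseteq> J"
    have "\<forall>a\<in>F. \<exists>j\<in>I. fst a = P j"
      using F by (auto simp: J_def)
    then obtain k where k: "\<And>a. a \<in> F \<Longrightarrow> k a \<in> I \<and> fst a = P (k a)"
      by metis
    then have "finite (k ` F)" "k ` F \<subseteq> I"
      using F by auto
    then obtain u where u: "u \<in> I" "\<forall>i\<in>k ` F. (i, u) \<in> r"
      using dir unfolding directed_set_def by blast
    define n where "n = Suc (Max (insert 0 ((\<lambda>a. snd (snd a)) ` F)))"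
    have n: "snd (snd a) < n" if "a \<in> F" for a
      using that F by (auto simp: n_def less_Suc_eq_le intro!: Max_ge)
    have "(P u, A u, n) \<in> J"
      using u P_self by (auto simp: J_def)
    moreover have "(a, (P u, A u, n)) \<in> s" if "a \<in> F" for a
    proof -
      have "P u \<subseteq> fst a"
        using k[OF that] u P_mono that by auto
      then show ?thesis
        using that F n \<open>(P u, A u, n) \<in> J\<close> by (auto simp: s_def)
    qed
    ultimately show "\<exists>u\<in>J. \<forall>i\<in>F. (i, u) \<in> s"
      by blast
  qed
  moreover have "B ` J \<subseteq> A ` I"
    by (auto simp: B_def J_def P_def)
  moreover have "filtermap B (net_filter J s) = filtermap A (net_filter I r)"
  proof (rule filter_eq_iff[THEN iffD2], intro allI)
    fix Q
    have "(\<exists>a\<in>J. \<forall>b\<in>J. (a, b) \<in> s \<longrightarrow> Q (B b)) \<longleftrightarrow>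
        (\<exists>j\<in>I. \<forall>i\<in>I. (j, i) \<in> r \<longrightarrow> Q (A i))"
    proof
      assume "\<exists>a\<in>J. \<forall>b\<in>J. (a, b) \<in> s \<longrightarrow> Q (B b)"
      then obtain a where a: "a \<in> J" "\<And>b. b \<in> J \<Longrightarrow> (a, b) \<in> s \<Longrightarrow> Q (B b)"
        by blast
      then obtain j x n where j: "j \<in> I" "a = (P j, x, n)"
        by (auto simp: J_def)
      have "Q (A i)" if "i \<in> I" "(j, i) \<in> r" for i
      proof -
        have "(P j, A i, Suc n) \<in> J"
          using that j by (auto simp: J_def P_def)
        then have "Q (B (P j, A i, Suc n))"
          using a j by (intro a(2)) (auto simp: s_def)
        then show ?thesis
          by (simp add: B_def)
      qed
      then show "\<exists>j\<in>I. \<forall>i\<in>I. (j, i) \<in> r \<longrightarrow> Q (A i)"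
        using j by blast
    next
      assume "\<exists>j\<in>I. \<forall>i\<in>I. (j, i) \<in> r \<longrightarrow> Q (A i)"
      then obtain j where j: "j \<in> I" "\<And>i. i \<in> I \<Longrightarrow> (j, i) \<in> r \<Longrightarrow> Q (A i)"
        by blast
      have "(P j, A j, 0) \<in> J"
        using j P_self by (auto simp: J_def)
      moreover have "Q (B b)" if "b \<in> J" "((P j, A j, 0), b) \<in> s" for b
      proof -
        have "B b \<in> fst b" "fst b \<subseteq> P j"
          using that by (auto simp: B_def J_def s_def)
        then have "B b \<in> P j"
          by blast
        then show ?thesis
          using j(2) by (auto simp: P_def)
      qed
      ultimately show "\<exists>a\<in>J. \<forall>b\<in>J. (a, b) \<in> s \<longrightarrow> Q (B b)"
        by blast
    qed
    then show "eventually Q (filtermap B (net_filter J s)) =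
        eventually Q (filtermap A (net_filter I r))"
      by (simp add: eventually_filtermap eventually_net_filter[OF \<open>directed_set J s\<close>]
          eventually_net_filter[OF dir])
  qed
  ultimately show thesis
    using that by blast
qed


section \<open>Topological groups, Haar measures and Van Hove nets\<close>

text \<open>Groups are carried by sets, so that a lattice \<open>\<Lambda>\<close> is again a group of the
  same kind: its structure is \<open>G\<lparr>carrier := \<Lambda>\<rparr>\<close> with the topology \<open>subtopology T \<Lambda>\<close>.\<close>

definition topological_group :: "('g, 'm) monoid_scheme \<Rightarrow> 'g topology \<Rightarrow> bool" where
  "topological_group G T \<longleftrightarrow>
     group G \<and> topspace T = carrier G \<and> t1_space T \<and>
     continuous_map (prod_topology T T) T (\<lambda>(g, h). g \<otimes>\<^bsub>G\<^esub> h) \<and>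
     continuous_map T T (\<lambda>g. inv\<^bsub>G\<^esub> g)"

definition regular_borel_measure :: "'g topology \<Rightarrow> 'g measure \<Rightarrow> bool" where
  "regular_borel_measure T m \<longleftrightarrow>
     space m = topspace T \<and> sets m = sigma_sets (topspace T) {U. openin T U} \<and>
     (\<forall>K. compactin T K \<longrightarrow> emeasure m K < \<infinity>) \<and>
     (\<forall>B\<in>sets m. emeasure m B = (INF U\<in>{U. openin T U \<and> B \<subseteq> U}. emeasure m U)) \<and>
     (\<forall>U. openin T U \<longrightarrow> emeasure m U = (SUP K\<in>{K. compactin T K \<and> K \<subseteq> U}. emeasure m K))"

definition haar_measure ::
    "('g, 'm) monoid_scheme \<Rightarrow> 'g topology \<Rightarrow> 'g measure \<Rightarrow> bool" where
  "haar_measure G T m \<longleftrightarrow>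
     regular_borel_measure T m \<and> emeasure m (space m) \<noteq> 0 \<and>
     (\<forall>g\<in>carrier G. \<forall>A\<in>sets m.
        emeasure m (g <#\<^bsub>G\<^esub> A) = emeasure m A \<and> emeasure m (A #>\<^bsub>G\<^esub> g) = emeasure m A)"

definition K_boundary ::
    "('g, 'm) monoid_scheme \<Rightarrow> 'g topology \<Rightarrow> 'g set \<Rightarrow> 'g set \<Rightarrow> 'g set" where
  "K_boundary G T K A =
     (K <#>\<^bsub>G\<^esub> (T closure_of A)) \<inter> (K <#>\<^bsub>G\<^esub> (T closure_of (carrier G - A)))"

definition van_hove_net ::
    "('g, 'm) monoid_scheme \<Rightarrow> 'g topology \<Rightarrow> 'g measure \<Rightarrow>
     'i set \<Rightarrow> ('i \<times> 'i) set \<Rightarrow> ('i \<Rightarrow> 'g set) \<Rightarrow> bool" where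
  "van_hove_net G T m I r A \<longleftrightarrow>
     directed_set I r \<and> (\<forall>i\<in>I. compactin T (A i)) \<and>
     (\<exists>j\<in>I. \<forall>i\<in>I. (j, i) \<in> r \<longrightarrow> T interior_of (A i) \<noteq> {}) \<and>
     (\<forall>K. compactin T K \<longrightarrow>
        ((\<lambda>i. emeasure m (K_boundary G T K (A i)) / emeasure m (A i)) \<longlongrightarrow> 0) (net_filter I r))"

lemma van_hove_net_reindex:
  fixes A :: "'i \<Rightarrow> 'g set"
  assumes A: "van_hove_net G T m I r A"
  obtains J :: "'g set net_index set" and s and B :: "'g set net_index \<Rightarrow> 'g set"
  where "van_hove_net G T m J s B"
    "\<And>f F. filterlim (\<lambda>j. f (B j)) F (net_filter J s) \<longleftrightarrow>
            filterlim (\<lambda>i. f (A i)) F (net_filter I r)"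
proof -
  have dir: "directed_set I r"
    using A by (simp add: van_hove_net_def)
  obtain J :: "'g set net_index set" and s and B :: "'g set net_index \<Rightarrow> 'g set"
    where J: "directed_set J s" "B ` J \<subseteq> A ` I"
      "filtermap B (net_filter J s) = filtermap A (net_filter I r)"
    using net_reindex[OF dir] by blast
  have lim: "filterlim (\<lambda>j. f (B j)) F (net_filter J s) \<longleftrightarrow>
      filterlim (\<lambda>i. f (A i)) F (net_filter I r)" for f :: "'g set \<Rightarrow> ennreal" and F
    using filterlim_reindex[OF J(3)] .
  have ev: "eventually (\<lambda>j. Q (B j)) (net_filter J s) \<longleftrightarrow>
      eventually (\<lambda>i. Q (A i)) (net_filter I r)" for Q
    using J(3) by (metis eventually_filtermap)
  have "van_hove_net G T m J s B"
    unfolding van_hove_net_def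
  proof (intro conjI allI impI ballI)
    show "compactin T (B j)" if "j \<in> J" for j
      using that A J(2) by (auto simp: van_hove_net_def)
    show "\<exists>j\<in>J. \<forall>i\<in>J. (j, i) \<in> s \<longrightarrow> T interior_of B i \<noteq> {}"
      using A ev[of "\<lambda>S. T interior_of S \<noteq> {}"]
      unfolding van_hove_net_def eventually_net_filter[OF J(1)] eventually_net_filter[OF dir]
      by blast
    show "((\<lambda>i. emeasure m (K_boundary G T K (B i)) / emeasure m (B i)) \<longlongrightarrow> 0) (net_filter J s)"
      if "compactin T K" for K
      using that A lim[of "\<lambda>S. emeasure m (K_boundary G T K S) / emeasure m S"]
      by (simp add: van_hove_net_def)
  qed (rule J(1))
  then show thesis
    using filterlim_reindex[OF J(3)] by (rule that)
qed

definition amenable_group ::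
    "('g, 'm) monoid_scheme \<Rightarrow> 'g topology \<Rightarrow> 'g measure \<Rightarrow> bool" where
  "amenable_group G T m \<longleftrightarrow>
     topological_group G T \<and> locally_compact_space T \<and> haar_measure G T m \<and>
     (\<exists>I r (A :: 'g set net_index \<Rightarrow> 'g set). van_hove_net G T m I r A)"

definition subadditive_on_compacts :: "'g topology \<Rightarrow> ('g set \<Rightarrow> real) \<Rightarrow> bool" where
  "subadditive_on_compacts T f \<longleftrightarrow>
     (\<forall>A B. compactin T A \<and> compactin T B \<and> A \<inter> B = {} \<longrightarrow> f (A \<union> B) \<le> f A + f B)"

definition right_invariant_on_compacts ::
    "('g, 'm) monoid_scheme \<Rightarrow> 'g topology \<Rightarrow> ('g set \<Rightarrow> real) \<Rightarrow> bool" where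
  "right_invariant_on_compacts G T f \<longleftrightarrow>
     (\<forall>A g. compactin T A \<and> g \<in> carrier G \<longrightarrow> f (A #>\<^bsub>G\<^esub> g) = f A)"

definition monotone_on_compacts :: "'g topology \<Rightarrow> ('g set \<Rightarrow> real) \<Rightarrow> bool" where
  "monotone_on_compacts T f \<longleftrightarrow>
     (\<forall>A B. compactin T A \<and> compactin T B \<and> A \<subseteq> B \<longrightarrow> f A \<le> f B)"

definition ornstein_weiss ::
    "('g, 'm) monoid_scheme \<Rightarrow> 'g topology \<Rightarrow> 'g measure \<Rightarrow> bool" where
  "ornstein_weiss G T m \<longleftrightarrow>
     (\<forall>f. subadditive_on_compacts T f \<and> right_invariant_on_compacts G T f \<and> monotone_on_compacts T f \<longrightarrow>
        (\<exists>L::real. \<forall>I r (A :: 'g set net_index \<Rightarrow> 'g set). van_hove_net G T m I r A \<longrightarrow>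
           ((\<lambda>i. f (A i) / measure m (A i)) \<longlongrightarrow> L) (net_filter I r)))"


section \<open>Relatively dense sets, uniform density and uniform lattices\<close>

definition relatively_dense ::
    "('g, 'm) monoid_scheme \<Rightarrow> 'g topology \<Rightarrow> 'g set \<Rightarrow> bool" where
  "relatively_dense G T \<Lambda> \<longleftrightarrow>
     \<Lambda> \<subseteq> carrier G \<and> (\<exists>K. compactin T K \<and> K <#>\<^bsub>G\<^esub> \<Lambda> = carrier G)"

definition discrete_subset :: "'g topology \<Rightarrow> 'g set \<Rightarrow> bool" where
  "discrete_subset T \<Lambda> \<longleftrightarrow>
     \<Lambda> \<subseteq> topspace T \<and> subtopology T \<Lambda> = discrete_topology \<Lambda>"

text \<open>Unlike \<open>card\<close>, this is \<open>\<infinity>\<close> on infinite sets; a discrete set may accumulate, so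
  its intersection with a compact set need not be finite.\<close>

definition ecard :: "'a set \<Rightarrow> ennreal" where
  "ecard F = emeasure (count_space UNIV) F"

definition has_uniform_density ::
    "('g, 'm) monoid_scheme \<Rightarrow> 'g topology \<Rightarrow> 'g measure \<Rightarrow> 'g set \<Rightarrow> ennreal \<Rightarrow> bool" where
  "has_uniform_density G T m \<Lambda> \<delta> \<longleftrightarrow>
     discrete_subset T \<Lambda> \<and> \<delta> < \<infinity> \<and>
     (\<forall>I r (A :: 'g set net_index \<Rightarrow> 'g set). van_hove_net G T m I r A \<longrightarrow>
        ((\<lambda>i. ecard (\<Lambda> \<inter> A i) / emeasure m (A i)) \<longlongrightarrow> \<delta>) (net_filter I r))"

definition well_defined_density ::
    "('g, 'm) monoid_scheme \<Rightarrow> 'g topology \<Rightarrow> 'g measure \<Rightarrow> 'g set \<Rightarrow> bool" where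
  "well_defined_density G T m \<Lambda> \<longleftrightarrow> (\<exists>\<delta>. has_uniform_density G T m \<Lambda> \<delta>)"

definition dens ::
    "('g, 'm) monoid_scheme \<Rightarrow> 'g topology \<Rightarrow> 'g measure \<Rightarrow> 'g set \<Rightarrow> ennreal" where
  "dens G T m \<Lambda> = (THE \<delta>. has_uniform_density G T m \<Lambda> \<delta>)"

text \<open>\<open>G/\<Lambda>\<close> is the space of left cosets \<open>g\<Lambda>\<close>; a quotient map out of \<open>T\<close>
  determines the topology of its target.\<close>

definition uniform_lattice ::
    "('g, 'm) monoid_scheme \<Rightarrow> 'g topology \<Rightarrow> 'g set \<Rightarrow> bool" where
  "uniform_lattice G T \<Lambda> \<longleftrightarrow>
     subgroup \<Lambda> G \<and> discrete_subset T \<Lambda> \<and>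
     (\<exists>Q. quotient_map T Q (\<lambda>g. g <#\<^bsub>G\<^esub> \<Lambda>) \<and> compact_space Q)"


section \<open>Actions, factors and relative topological entropy\<close>

definition group_action_on ::
    "('g, 'm) monoid_scheme \<Rightarrow> 'g topology \<Rightarrow> 'x topology \<Rightarrow> ('g \<Rightarrow> 'x \<Rightarrow> 'x) \<Rightarrow> bool" where
  "group_action_on G T X \<phi> \<longleftrightarrow>
     continuous_map (prod_topology T X) X (\<lambda>(g, x). \<phi> g x) \<and>
     (\<forall>x\<in>topspace X. \<phi> \<one>\<^bsub>G\<^esub> x = x) \<and>
     (\<forall>g\<in>carrier G. \<forall>h\<in>carrier G. \<forall>x\<in>topspace X. \<phi> g (\<phi> h x) = \<phi> (g \<otimes>\<^bsub>G\<^esub> h) x)"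

definition factor_map ::
    "('g, 'm) monoid_scheme \<Rightarrow> 'x topology \<Rightarrow> ('g \<Rightarrow> 'x \<Rightarrow> 'x) \<Rightarrow>
     'y topology \<Rightarrow> ('g \<Rightarrow> 'y \<Rightarrow> 'y) \<Rightarrow> ('x \<Rightarrow> 'y) \<Rightarrow> bool" where
  "factor_map G X \<phi> Y \<psi> p \<longleftrightarrow>
     continuous_map X Y p \<and> p ` topspace X = topspace Y \<and>
     (\<forall>g\<in>carrier G. \<forall>x\<in>topspace X. p (\<phi> g x) = \<psi> g (p x))"

text \<open>Distances are taken in \<open>[0, \<infinity>]\<close>, so that suprema over empty sets are 0. For non-empty
  compact \<open>A\<close> the supremum is a maximum.\<close>

definition dyn_dist ::
    "('x \<Rightarrow> 'x \<Rightarrow> real) \<Rightarrow> ('g \<Rightarrow> 'x \<Rightarrow> 'x) \<Rightarrow> 'g set \<Rightarrow> 'x \<Rightarrow> 'x \<Rightarrow> ennreal" where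
  "dyn_dist d \<phi> A x y = (SUP g\<in>A. ennreal (d (\<phi> g x) (\<phi> g y)))"

definition dyn_diameter ::
    "('x \<Rightarrow> 'x \<Rightarrow> real) \<Rightarrow> ('g \<Rightarrow> 'x \<Rightarrow> 'x) \<Rightarrow> 'g set \<Rightarrow> 'x set \<Rightarrow> ennreal" where
  "dyn_diameter d \<phi> A U = (SUP x\<in>U. SUP y\<in>U. dyn_dist d \<phi> A x y)"

definition cov ::
    "'x set \<Rightarrow> ('x \<Rightarrow> 'x \<Rightarrow> real) \<Rightarrow> ('g \<Rightarrow> 'x \<Rightarrow> 'x) \<Rightarrow> 'x set \<Rightarrow> 'g set \<Rightarrow> real \<Rightarrow> ennreal" where
  "cov X d \<phi> M A \<epsilon> =
     (INF \<U>\<in>{\<U>. (\<forall>U\<in>\<U>. openin (Metric_space.mtopology X d) U \<and>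
                         dyn_diameter d \<phi> A U < ennreal \<epsilon>) \<and> M \<subseteq> \<Union>\<U>}. ecard \<U>)"

text \<open>Only evaluated on numbers \<open>\<ge> 1\<close>, except when \<open>X\<close> is empty.\<close>

definition elog :: "ennreal \<Rightarrow> ennreal" where
  "elog c = (if c = \<infinity> then \<infinity> else ennreal (ln (enn2real c)))"

text \<open>For a compact set \<open>A\<close> and the group, the ratios of this quantity to the measure of \<open>A\<close>
  converge along Van Hove nets, for each fixed \<open>\<epsilon>\<close>. When \<open>A\<close> is intersected with a
  relatively dense set that is not a lattice, the limit at a fixed \<open>\<epsilon>\<close> can fail to exist,
  although the lower and the upper limit have the same supremum over \<open>\<epsilon>\<close>.\<close>

definition log_fibre_cov ::
    "'x set \<Rightarrow> ('x \<Rightarrow> 'x \<Rightarrow> real) \<Rightarrow> ('g \<Rightarrow> 'x \<Rightarrow> 'x) \<Rightarrow> 'y topology \<Rightarrow> ('x \<Rightarrow> 'y) \<Rightarrow>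
     'g set \<Rightarrow> real \<Rightarrow> ennreal" where
  "log_fibre_cov X d \<phi> Y p A \<epsilon> =
     elog (SUP y\<in>topspace Y. cov X d \<phi> {x\<in>X. p x = y} A \<epsilon>)"

text \<open>The limit is the common limit along all Van Hove nets. The action on the factor enters
  only through its space \<open>Y\<close> and the map \<open>p\<close>.\<close>

definition rel_entropy ::
    "('g, 'm) monoid_scheme \<Rightarrow> 'g topology \<Rightarrow> 'g measure \<Rightarrow>
     'x set \<Rightarrow> ('x \<Rightarrow> 'x \<Rightarrow> real) \<Rightarrow> ('g \<Rightarrow> 'x \<Rightarrow> 'x) \<Rightarrow> 'y topology \<Rightarrow> ('x \<Rightarrow> 'y) \<Rightarrow> ennreal" where
  "rel_entropy G T m X d \<phi> Y p =
     (SUP \<epsilon>\<in>{0<..}. THE L. \<forall>I r (A :: 'g set net_index \<Rightarrow> 'g set). van_hove_net G T m I r A \<longrightarrow>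
        ((\<lambda>i. log_fibre_cov X d \<phi> Y p (A i) \<epsilon> / emeasure m (A i)) \<longlongrightarrow> L) (net_filter I r))"

end

theory Submission
  imports Defs
begin

text \<open>For a compact set \<open>A\<close> let \<open>h\<^sub>\<epsilon>(A)\<close> be the logarithm of the supremum, over all fibres, of the
  covering numbers at scale \<open>\<epsilon>\<close> (\<open>log_fibre_cov\<close>). As a function of \<open>A\<close> it is monotone,
  subadditive and right invariant. By the Ornstein-Weiss lemma for \<open>G\<close>, the averages
  \<open>h\<^sub>\<epsilon>(A\<^sub>i) / \<mu>(A\<^sub>i)\<close> converge to one number \<open>E(\<epsilon>)\<close> along all Van Hove nets, and the relative
  entropy is the supremum of \<open>E(\<epsilon>)\<close> over \<open>\<epsilon>\<close>.

  Let \<open>F\<^sub>i = A\<^sub>i \<inter> \<Lambda>\<close>. Then \<open>h\<^sub>\<epsilon>(F\<^sub>i) \<le> h\<^sub>\<epsilon>(A\<^sub>i)\<close> by monotonicity. For the reverse comparison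
  choose a compact \<open>K\<close> with \<open>K \<Lambda> = G\<close>. The set \<open>K F\<^sub>i\<close> differs from \<open>A\<^sub>i\<close> only inside a
  boundary of \<open>A\<^sub>i\<close>; so \<open>(K F\<^sub>i)\<close> is again a Van Hove net, of asymptotically the same measure,
  and \<open>E(\<epsilon>)\<close> can be computed along it (\<open>van_hove_thickening\<close>). The maps \<open>\<phi>\<^sup>g\<close> with \<open>g \<in> K\<close> are
  uniformly equicontinuous, hence \<open>h\<^sub>\<epsilon>(K F\<^sub>i) \<le> h\<^sub>\<epsilon>\<^sub>'(F\<^sub>i)\<close> for an \<open>\<epsilon>'\<close> that depends on \<open>K\<close> and
  \<open>\<epsilon>\<close> alone (\<open>log_fibre_cov_thickening\<close>). After division by \<open>|F\<^sub>i|\<close>, which is asymptotic to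
  \<open>dens(\<Lambda>) \<mu>(A\<^sub>i)\<close>, the upper limit at scale \<open>\<epsilon>\<close> is at most \<open>E(\<epsilon>) / dens(\<Lambda>)\<close>, and this is at
  most the lower limit at scale \<open>\<epsilon>'\<close> (\<open>entropy_at_bounds\<close>). The suprema over all scales
  therefore agree.

  Now let \<open>\<Lambda>\<close> be a uniform lattice. It has a Borel fundamental domain \<open>C\<close> inside a compact set
  (\<open>lattice_fundamental_domain\<close>). The set \<open>C F\<^sub>i\<close> has measure \<open>|F\<^sub>i| \<mu>(C)\<close> and again differs from
  \<open>A\<^sub>i\<close> only inside a boundary, so that \<open>\<Lambda>\<close> has density \<open>1 / \<mu>(C)\<close> and the formula above
  applies. Moreover \<open>(F\<^sub>i)\<close> is a Van Hove net in \<open>\<Lambda>\<close> (\<open>lattice_van_hove_net\<close>). The entropy of the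
  restricted action involves, at each fixed \<open>\<epsilon>\<close>, the common limit along all Van Hove nets in
  \<open>\<Lambda>\<close>. That there is such a limit does not follow from the comparison with \<open>G\<close>, which changes
  the scale; it is the Ornstein-Weiss lemma for the discrete group \<open>\<Lambda>\<close>.

  The discrete lemma is proved by quasi-tilings (\<open>discrete_ornstein_weiss\<close>). Suppose that
  \<open>f(F) \<le> t |F|\<close> for arbitrarily invariant finite sets \<open>F\<close>. Inside a far more invariant set \<open>B\<close>
  pick a maximal family of almost disjoint translates of \<open>F\<close>. By maximality they cover a fixed
  proportion of \<open>B\<close>, they have average at most about \<open>t\<close>, and what is left of \<open>B\<close> is either small or still
  invariant. Repeating this with less and less invariant \<open>F\<close> on what is left exhausts \<open>B\<close> up to a
  small remainder, which shows that \<open>f(B) / |B|\<close> is at most about \<open>t\<close>.\<close>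

text \<open>The multiset relation makes left cosets \<open>g <# A\<close> ambiguous.\<close>

no_notation (ASCII) subset_mset (infix \<open><#\<close> 50)

section \<open>Quasi-tilings and the discrete Ornstein-Weiss lemma\<close>

context group
begin

text \<open>Invariance is measured one group element at a time. For finite \<open>K\<close> that contains \<open>\<one>\<close>, the
  \<open>K\<close>-boundary of \<open>F\<close> and these differences control each other.\<close>

definition almost_invariant :: "'a set \<Rightarrow> real \<Rightarrow> 'a set \<Rightarrow> bool" where
  "almost_invariant K \<eta> F \<longleftrightarrow> (\<forall>k\<in>K. real (card ((k <# F) - F)) \<le> \<eta> * real (card F))"

lemma card_l_coset:
  assumes "k \<in> carrier G" "F \<subseteq> carrier G"
  shows "card (k <# F) = card F"
proof -
  have "inj_on (\<lambda>x. k \<otimes> x) F"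
    using inj_on_cmult[OF assms(1)] assms(2) by (rule inj_on_subset)
  moreover have "k <# F = (\<lambda>x. k \<otimes> x) ` F"
    by (auto simp: l_coset_def)
  ultimately show ?thesis
    by (simp add: card_image)
qed

lemma card_r_coset:
  assumes "z \<in> carrier G" "F \<subseteq> carrier G"
  shows "card (F #> z) = card F"
proof -
  have "inj_on (\<lambda>x. x \<otimes> z) F"
    using inj_on_multc[OF assms(1)] assms(2) by (rule inj_on_subset)
  moreover have "F #> z = (\<lambda>x. x \<otimes> z) ` F"
    by (auto simp: r_coset_def)
  ultimately show ?thesis
    by (simp add: card_image)
qed

lemma finite_r_coset: "finite F \<Longrightarrow> finite (F #> z)"
  by (simp add: r_coset_def)

lemma finite_l_coset: "finite F \<Longrightarrow> finite (z <# F)"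
  by (simp add: l_coset_def)

lemma finite_set_mult: "finite F \<Longrightarrow> finite Z \<Longrightarrow> finite (F <#> Z)"
  by (simp add: set_mult_def)

lemma set_mult_Un_r_coset: "F <#> Z = (\<Union>z\<in>Z. F #> z)"
  by (auto simp: set_mult_def r_coset_def)

lemma mem_set_multI: "h \<in> H \<Longrightarrow> k \<in> K \<Longrightarrow> h \<otimes> k \<in> H <#> K"
  by (auto simp: set_mult_def)

lemma mem_set_multE:
  assumes "x \<in> H <#> K"
  obtains h k where "h \<in> H" "k \<in> K" "x = h \<otimes> k"
  using assms by (auto simp: set_mult_def)

lemma set_mult_mono_both: "H \<subseteq> H' \<Longrightarrow> K \<subseteq> K' \<Longrightarrow> H <#> K \<subseteq> H' <#> K'"
  by (auto simp: set_mult_def)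

lemma subset_set_mult_one: "\<one> \<in> M \<Longrightarrow> A \<subseteq> carrier G \<Longrightarrow> A \<subseteq> M <#> A"
  using mem_set_multI[of \<one> M] by fastforce

text \<open>Both differences have the cardinality of \<open>F\<close> minus that of the intersection, because
  translation is injective. So it does not matter whether one counts the points that leave \<open>F\<close>
  or the points that enter it.\<close>

lemma card_diff_l_coset:
  assumes "finite F" "F \<subseteq> carrier G" "k \<in> carrier G"
  shows "card (F - (k <# F)) = card ((k <# F) - F)"
proof -
  have fin: "finite (k <# F)"
    using assms(1) by (rule finite_l_coset)
  have "card (F - (k <# F)) = card F - card (F \<inter> (k <# F))"
    using assms fin by (simp add: card_Diff_subset_Int)
  moreover have "card ((k <# F) - F) = card (k <# F) - card ((k <# F) \<inter> F)"
    using assms fin by (simp add: card_Diff_subset_Int)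
  ultimately show ?thesis
    using assms by (simp add: card_l_coset Int_commute)
qed

text \<open>The family \<open>Z\<close> is taken maximal among those whose translates lie in \<open>B\<close> and overlap so
  little that their union keeps a proportion \<open>1 - e\<close> of the total cardinality. A translate of
  \<open>F\<close> inside \<open>B\<close> of which less than a proportion \<open>e\<close> is already covered could be added to
  \<open>Z\<close>; by maximality there is none.\<close>

lemma maximal_almost_disjoint_translates:
  fixes e :: real
  assumes F: "finite F" "F \<noteq> {}" "F \<subseteq> carrier G" and B: "finite B" "B \<subseteq> carrier G"
    and e: "0 < e" "e < 1"
  obtains Z where "finite Z" "Z \<subseteq> carrier G" "F <#> Z \<subseteq> B"
    "(1 - e) * real (card F) * real (card Z) \<le> real (card (F <#> Z))"
    "\<And>z. z \<in> carrier G \<Longrightarrow> F #> z \<subseteq> B \<Longrightarrow>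
       e * real (card F) \<le> real (card ((F #> z) \<inter> (F <#> Z)))"
proof -
  define D where "D = {z\<in>carrier G. F #> z \<subseteq> B}"
  obtain a where a: "a \<in> F" "a \<in> carrier G"
    using F by auto
  have "(\<lambda>z. a \<otimes> z) ` D \<subseteq> B"
    using a by (auto simp: D_def r_coset_def)
  moreover have "inj_on (\<lambda>z. a \<otimes> z) D"
    using inj_on_cmult[OF a(2)] by (rule inj_on_subset) (auto simp: D_def)
  ultimately have finD: "finite D"
    using B(1) by (meson finite_imageD finite_subset)
  define S where
    "S = {Z. Z \<subseteq> D \<and> (1 - e) * real (card F) * real (card Z) \<le> real (card (F <#> Z))}"
  have "S \<subseteq> Pow D"
    by (auto simp: S_def)
  then have "finite S"
    using finD by (meson finite_Pow_iff finite_subset)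
  moreover have "{} \<in> S"
    by (auto simp: S_def)
  ultimately obtain Z where Z: "Z \<in> S" and max: "\<And>Z'. Z' \<in> S \<Longrightarrow> Z \<subseteq> Z' \<Longrightarrow> Z' = Z"
    using finite_has_maximal[of S] by (metis empty_iff)
  have ZD: "Z \<subseteq> D" "finite Z"
    using Z finD by (auto simp: S_def intro: finite_subset)
  have "e * real (card F) \<le> real (card ((F #> z) \<inter> (F <#> Z)))"
    if z: "z \<in> carrier G" "F #> z \<subseteq> B" for z
  proof (cases "z \<in> Z")
    case True
    then have "(F #> z) \<inter> (F <#> Z) = F #> z"
      by (auto simp: set_mult_Un_r_coset)
    then show ?thesis
      using e by (simp add: card_r_coset z(1) F(3) mult_left_le_one_le)
  next
    case False
    have "insert z Z \<notin> S"
      using max[of "insert z Z"] False by blast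
    moreover have "insert z Z \<subseteq> D"
      using ZD z by (auto simp: D_def)
    ultimately have less: "real (card (F <#> insert z Z)) < (1 - e) * real (card F) * real (card (insert z Z))"
      by (auto simp: S_def)
    have fins: "finite (F #> z)" "finite (F <#> Z)"
      using F(1) ZD(2) by (auto intro: finite_r_coset finite_set_mult)
    have "F <#> insert z Z = (F <#> Z) \<union> ((F #> z) - (F <#> Z))"
      by (auto simp: set_mult_Un_r_coset)
    moreover have "card ((F <#> Z) \<union> ((F #> z) - (F <#> Z))) =
        card (F <#> Z) + card ((F #> z) - (F <#> Z))"
      using fins by (intro card_Un_disjoint) auto
    ultimately have "card (F <#> insert z Z) = card (F <#> Z) + card ((F #> z) - (F <#> Z))"
      by simp
    moreover have "card ((F #> z) - (F <#> Z)) + card ((F #> z) \<inter> (F <#> Z)) = card F"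
      using fins card_r_coset[OF z(1) F(3)] by (metis add.commute card_Int_Diff)
    moreover have "(1 - e) * real (card F) * real (card Z) \<le> real (card (F <#> Z))"
      using Z by (simp add: S_def)
    moreover have "card (insert z Z) = Suc (card Z)"
      using ZD(2) False by simp
    ultimately show ?thesis
      using less by (simp add: algebra_simps flip: of_nat_add)
  qed
  moreover have "F <#> Z \<subseteq> B" "Z \<subseteq> carrier G"
    using ZD by (auto simp: set_mult_Un_r_coset D_def)
  ultimately show thesis
    using that[of Z] ZD(2) Z by (auto simp: S_def)
qed

text \<open>If every translate of \<open>F\<close> inside \<open>B\<close> meets \<open>U\<close> in a proportion \<open>e\<close> of its points, then
  \<open>U\<close> fills a definite part of \<open>B\<close>: invariance of \<open>B\<close> makes at least half of its points
  \<open>z\<close> satisfy \<open>Fz \<subseteq> B\<close>, and counting the pairs \<open>(k, z)\<close> with \<open>kz \<in> U\<close> in both orders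
  compares the number of those \<open>z\<close> with \<open>|U|\<close>.\<close>

lemma card_union_almost_disjoint_translates:
  fixes e :: real
  assumes F: "finite F" "F \<noteq> {}" "F \<subseteq> carrier G" and B: "finite B" "B \<subseteq> carrier G"
    and U: "finite U" "U \<subseteq> carrier G"
    and inv: "almost_invariant F (1 / (2 * real (card F))) B"
    and e: "0 < e"
    and hits: "\<And>z. z \<in> carrier G \<Longrightarrow> F #> z \<subseteq> B \<Longrightarrow>
       e * real (card F) \<le> real (card ((F #> z) \<inter> U))"
  shows "e / 2 * real (card B) \<le> real (card U)"
proof -
  have cF: "0 < card F"
    using F by (simp add: card_gt_0_iff)
  define D where "D = {z\<in>B. F #> z \<subseteq> B}"
  have D: "finite D" "D \<subseteq> carrier G"
    using B by (auto simp: D_def)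
  have "B - D \<subseteq> (\<Union>k\<in>F. {b\<in>B. k \<otimes> b \<notin> B})"
    by (auto simp: D_def r_coset_def)
  then have "card (B - D) \<le> card (\<Union>k\<in>F. {b\<in>B. k \<otimes> b \<notin> B})"
    using F(1) B(1) by (intro card_mono) auto
  also have "\<dots> \<le> (\<Sum>k\<in>F. card {b\<in>B. k \<otimes> b \<notin> B})"
    using F(1) by (rule card_UN_le)
  finally have "real (card (B - D)) \<le> real (\<Sum>k\<in>F. card {b\<in>B. k \<otimes> b \<notin> B})"
    by (rule of_nat_mono)
  also have "\<dots> \<le> (\<Sum>k\<in>F. 1 / (2 * real (card F)) * real (card B))"
    unfolding of_nat_sum
  proof (rule sum_mono)
    fix k assume k: "k \<in> F"
    have "(k <# B) - B = (\<lambda>b. k \<otimes> b) ` {b\<in>B. k \<otimes> b \<notin> B}"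
      by (auto simp: l_coset_def)
    moreover have "inj_on (\<lambda>b. k \<otimes> b) {b\<in>B. k \<otimes> b \<notin> B}"
      by (rule inj_on_subset[OF inj_on_cmult]) (use k F(3) B(2) in auto)
    ultimately have "card ((k <# B) - B) = card {b\<in>B. k \<otimes> b \<notin> B}"
      by (simp add: card_image)
    then show "real (card {b\<in>B. k \<otimes> b \<notin> B}) \<le> 1 / (2 * real (card F)) * real (card B)"
      using inv k unfolding almost_invariant_def by metis
  qed
  also have "\<dots> = real (card B) / 2"
    using cF by simp
  finally have "real (card (B - D)) \<le> real (card B) / 2" .
  moreover have "card (B - D) = card B - card D" "card D \<le> card B"
    using B(1) D(1) by (auto simp: D_def intro!: card_Diff_subset card_mono)
  ultimately have half: "real (card B) / 2 \<le> real (card D)"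
    by (simp add: of_nat_diff)
  have "real (card D) * (e * real (card F)) = (\<Sum>z\<in>D. e * real (card F))"
    by simp
  also have "\<dots> \<le> (\<Sum>z\<in>D. real (card ((F #> z) \<inter> U)))"
    using D by (intro sum_mono hits) (auto simp: D_def)
  also have "\<dots> \<le> (\<Sum>z\<in>D. real (card {k\<in>F. k \<otimes> z \<in> U}))"
  proof (intro sum_mono of_nat_mono)
    fix z assume "z \<in> D"
    have "(F #> z) \<inter> U = (\<lambda>k. k \<otimes> z) ` {k\<in>F. k \<otimes> z \<in> U}"
      by (auto simp: r_coset_def)
    then show "card ((F #> z) \<inter> U) \<le> card {k\<in>F. k \<otimes> z \<in> U}"
      using F(1) by (simp add: card_image_le)
  qed
  also have "\<dots> = (\<Sum>z\<in>D. \<Sum>k\<in>F. if k \<otimes> z \<in> U then 1 else 0)"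
    using F(1) by (simp add: sum.If_cases Int_def)
  also have "\<dots> = (\<Sum>k\<in>F. \<Sum>z\<in>D. if k \<otimes> z \<in> U then 1 else 0)"
    by (rule sum.swap)
  also have "\<dots> = (\<Sum>k\<in>F. real (card {z\<in>D. k \<otimes> z \<in> U}))"
    using D(1) by (simp add: sum.If_cases Int_def)
  also have "\<dots> \<le> (\<Sum>k\<in>F. real (card U))"
  proof (intro sum_mono of_nat_mono)
    fix k assume k: "k \<in> F"
    have "inj_on (\<lambda>z. k \<otimes> z) {z\<in>D. k \<otimes> z \<in> U}"
      by (rule inj_on_subset[OF inj_on_cmult]) (use k F(3) D(2) in auto)
    moreover have "(\<lambda>z. k \<otimes> z) ` {z\<in>D. k \<otimes> z \<in> U} \<subseteq> U"
      by auto
    ultimately show "card {z\<in>D. k \<otimes> z \<in> U} \<le> card U"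
      using U(1) by (meson card_inj_on_le)
  qed
  finally have "real (card F) * (real (card D) * e) \<le> real (card F) * real (card U)"
    by (simp add: ac_simps)
  then have "real (card D) * e \<le> real (card U)"
    using cF by (simp add: mult_le_cancel_left)
  moreover have "real (card B) / 2 * e \<le> real (card D) * e"
    using half e by (intro mult_right_mono) auto
  ultimately show ?thesis
    by (simp add: mult.commute)
qed

text \<open>The boundary of what remains of \<open>B\<close> consists of boundary of \<open>B\<close> and of boundaries of the
  removed translates. The latter are small compared with the translates, whose total cardinality
  is at most \<open>2|B|\<close> since they are almost disjoint. As long as the remainder is not a negligible
  part \<open>\<theta>\<close> of \<open>B\<close>, it is therefore still almost invariant.\<close>

lemma almost_invariant_remove_translates:
  fixes e \<theta> \<eta> :: real
  assumes F: "finite F" "F \<subseteq> carrier G" and B: "finite B" "B \<subseteq> carrier G"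
    and Z: "finite Z" "Z \<subseteq> carrier G" "F <#> Z \<subseteq> B"
    and disj: "(1 - e) * real (card F) * real (card Z) \<le> real (card (F <#> Z))"
    and e: "e \<le> 1 / 2" and K: "K \<subseteq> carrier G"
    and invF: "almost_invariant K \<eta> F" and invB: "almost_invariant K \<eta> B"
    and \<theta>: "0 < \<theta>" "\<theta> * real (card B) \<le> real (card (B - (F <#> Z)))" and \<eta>: "0 \<le> \<eta>"
  shows "almost_invariant K (3 * \<eta> / \<theta>) (B - (F <#> Z))"
  unfolding almost_invariant_def
proof
  fix k assume k: "k \<in> K"
  then have kc: "k \<in> carrier G"
    using K by blast
  define B' where "B' = B - (F <#> Z)"
  have B'c: "B' \<subseteq> carrier G" "finite B'"
    using B by (auto simp: B'_def)
  have sub: "(k <# B') - B' \<subseteq> ((k <# B) - B) \<union> (\<Union>z\<in>Z. (F - (k <# F)) #> z)"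
  proof
    fix x assume x: "x \<in> (k <# B') - B'"
    then obtain b where b: "b \<in> B'" "x = k \<otimes> b"
      by (auto simp: l_coset_def)
    show "x \<in> ((k <# B) - B) \<union> (\<Union>z\<in>Z. (F - (k <# F)) #> z)"
    proof (cases "x \<in> B")
      case False
      then show ?thesis
        using b by (auto simp: l_coset_def B'_def)
    next
      case True
      then have "x \<in> F <#> Z"
        using x by (auto simp: B'_def)
      then obtain a z where az: "a \<in> F" "z \<in> Z" "x = a \<otimes> z"
        by (auto simp: set_mult_def)
      have "a \<notin> k <# F"
      proof
        assume "a \<in> k <# F"
        then obtain a' where a': "a' \<in> F" "a = k \<otimes> a'"
          by (auto simp: l_coset_def)
        have cs: "a' \<in> carrier G" "z \<in> carrier G" "b \<in> carrier G"
          using a' az Z F b B'c by auto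
        have "k \<otimes> b = k \<otimes> (a' \<otimes> z)"
          using az b a' cs kc by (simp add: m_assoc)
        then have "b = a' \<otimes> z"
          using cs kc by simp
        then have "b \<in> F <#> Z"
          using a' az by (auto simp: set_mult_def)
        then show False
          using b by (auto simp: B'_def)
      qed
      then show ?thesis
        using az by (auto simp: r_coset_def)
    qed
  qed
  have "card ((k <# B') - B') \<le> card (((k <# B) - B) \<union> (\<Union>z\<in>Z. (F - (k <# F)) #> z))"
    using sub by (intro card_mono) (auto simp: Z(1) F(1) B(1) finite_l_coset finite_r_coset)
  also have "\<dots> \<le> card ((k <# B) - B) + card (\<Union>z\<in>Z. (F - (k <# F)) #> z)"
    by (rule card_Un_le)
  also have "\<dots> \<le> card ((k <# B) - B) + (\<Sum>z\<in>Z. card ((F - (k <# F)) #> z))"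
    using card_UN_le[OF Z(1)] by simp
  also have "(\<Sum>z\<in>Z. card ((F - (k <# F)) #> z)) = (\<Sum>z\<in>Z. card ((k <# F) - F))"
  proof (rule sum.cong[OF refl])
    fix z assume "z \<in> Z"
    then have "card ((F - (k <# F)) #> z) = card (F - (k <# F))"
      using Z(2) F(2) by (intro card_r_coset) auto
    then show "card ((F - (k <# F)) #> z) = card ((k <# F) - F)"
      using card_diff_l_coset[OF F kc] by simp
  qed
  finally have "real (card ((k <# B') - B')) \<le>
      real (card ((k <# B) - B)) + real (card Z) * real (card ((k <# F) - F))"
    by (simp flip: of_nat_add of_nat_mult)
  also have "\<dots> \<le> \<eta> * real (card B) + real (card Z) * (\<eta> * real (card F))"
    using invB invF k unfolding almost_invariant_def by (intro add_mono mult_left_mono) auto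
  also have "\<dots> \<le> \<eta> * real (card B) + \<eta> * (2 * real (card B))"
  proof -
    have "1 / 2 * (real (card F) * real (card Z)) \<le> (1 - e) * (real (card F) * real (card Z))"
      using e by (intro mult_right_mono) auto
    moreover have "card (F <#> Z) \<le> card B"
      using Z(3) B(1) by (rule card_mono[rotated])
    ultimately have "real (card F) * real (card Z) \<le> 2 * real (card B)"
      using disj by simp
    then have "\<eta> * (real (card F) * real (card Z)) \<le> \<eta> * (2 * real (card B))"
      using \<eta> by (rule mult_left_mono)
    then show ?thesis
      by (simp add: ac_simps)
  qed
  also have "\<dots> = 3 * \<eta> / \<theta> * (\<theta> * real (card B))"
    using \<theta>(1) by simp
  also have "\<dots> \<le> 3 * \<eta> / \<theta> * real (card B')"
    using \<theta> \<eta> by (intro mult_left_mono) (auto simp: B'_def)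
  finally show "real (card ((k <# (B - (F <#> Z))) - (B - (F <#> Z))))
      \<le> 3 * \<eta> / \<theta> * real (card (B - (F <#> Z)))"
    by (simp add: B'_def)
qed

lemma almost_invariant_mono:
  assumes "almost_invariant K \<eta> F" "K' \<subseteq> K" "\<eta> \<le> \<eta>'"
  shows "almost_invariant K' \<eta>' F"
  using assms unfolding almost_invariant_def
  by (meson mult_right_mono of_nat_0_le_iff order_trans subsetD)

end

text \<open>Averages over non-empty sets do not see the value at the empty set. It is normalised to \<open>0\<close>,
  which makes \<open>f\<close> at most proportional to the cardinality on all finite sets.\<close>

locale subadditive_set_function = group G for G (structure) +
  fixes f :: "'a set \<Rightarrow> real"
  assumes f_empty: "f {} = 0"
    and f_mono: "\<And>A B. finite B \<Longrightarrow> B \<subseteq> carrier G \<Longrightarrow> A \<subseteq> B \<Longrightarrow> f A \<le> f B"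
    and f_subadd: "\<And>A B. finite A \<Longrightarrow> A \<subseteq> carrier G \<Longrightarrow> finite B \<Longrightarrow> B \<subseteq> carrier G \<Longrightarrow>
      A \<inter> B = {} \<Longrightarrow> f (A \<union> B) \<le> f A + f B"
    and f_invariant: "\<And>A g. finite A \<Longrightarrow> A \<subseteq> carrier G \<Longrightarrow> g \<in> carrier G \<Longrightarrow> f (A #> g) = f A"
begin

lemma f_nonneg: "finite A \<Longrightarrow> A \<subseteq> carrier G \<Longrightarrow> 0 \<le> f A"
  using f_mono[of A "{}"] f_empty by simp

lemma f_Un_le:
  assumes "finite A" "A \<subseteq> carrier G" "finite B" "B \<subseteq> carrier G"
  shows "f (A \<union> B) \<le> f A + f B"
proof -
  have "f (A \<union> (B - A)) \<le> f A + f (B - A)"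
    using assms by (intro f_subadd) auto
  moreover have "f (B - A) \<le> f B"
    using assms by (intro f_mono) auto
  ultimately show ?thesis
    by simp
qed

lemma f_translates_le:
  assumes "finite F" "F \<subseteq> carrier G" "finite Z" "Z \<subseteq> carrier G"
  shows "f (F <#> Z) \<le> real (card Z) * f F"
  using assms(3,4)
proof (induction Z)
  case empty
  then show ?case
    by (simp add: set_mult_def f_empty)
next
  case (insert z Z)
  have "F <#> insert z Z = (F #> z) \<union> (F <#> Z)"
    by (auto simp: set_mult_Un_r_coset)
  moreover have "f ((F #> z) \<union> (F <#> Z)) \<le> f (F #> z) + f (F <#> Z)"
    using assms insert
    by (intro f_Un_le finite_r_coset finite_set_mult set_mult_closed r_coset_subset_G) auto
  moreover have "f (F #> z) = f F"
    using assms insert by (intro f_invariant) auto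
  ultimately show ?case
    using insert by (simp add: algebra_simps)
qed

lemma f_le_card:
  assumes "finite A" "A \<subseteq> carrier G"
  shows "f A \<le> f {\<one>} * real (card A)"
proof -
  have "{\<one>} <#> A = A"
    using assms(2) by (simp add: set_mult_def subset_iff)
  then show ?thesis
    using f_translates_le[of "{\<one>}" A] assms by (simp add: mult.commute)
qed

text \<open>The slope \<open>t\<close> is achieved by arbitrarily invariant sets, whereas \<open>eventually_bounded t\<close> says
  that it bounds \<open>f\<close> on all sufficiently invariant sets. These are the two sides of the
  convergence: the upper limit of the averages is at most \<open>t\<close> if and only if every larger slope is
  an eventual bound, and the lower limit is at most \<open>t\<close> if every larger slope is nearly
  attained.\<close>

definition nearly_attained :: "real \<Rightarrow> bool" where
  "nearly_attained t \<longleftrightarrow> (\<forall>K \<eta>. finite K \<and> K \<subseteq> carrier G \<and> 0 < \<eta> \<longrightarrow>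
     (\<exists>F. finite F \<and> F \<noteq> {} \<and> F \<subseteq> carrier G \<and> almost_invariant K \<eta> F \<and> f F \<le> t * real (card F)))"

definition eventually_bounded :: "real \<Rightarrow> bool" where
  "eventually_bounded t \<longleftrightarrow> (\<exists>K \<eta>. finite K \<and> K \<subseteq> carrier G \<and> 0 < \<eta> \<and>
     (\<forall>F. finite F \<and> F \<noteq> {} \<and> F \<subseteq> carrier G \<and> almost_invariant K \<eta> F \<longrightarrow> f F \<le> t * real (card F)))"

lemma nearly_attainedE:
  assumes "nearly_attained t" "finite K" "K \<subseteq> carrier G" "0 < \<eta>"
  obtains F where "finite F" "F \<noteq> {}" "F \<subseteq> carrier G" "almost_invariant K \<eta> F"
    "f F \<le> t * real (card F)"
proof -
  have "\<exists>F. finite F \<and> F \<noteq> {} \<and> F \<subseteq> carrier G \<and> almost_invariant K \<eta> F \<and>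
      f F \<le> t * real (card F)"
    using assms(1)[unfolded nearly_attained_def, rule_format, of K \<eta>] assms(2-4) by simp
  then show thesis
    using that by (elim exE conjE)
qed

lemma nearly_attained_nonneg:
  assumes "nearly_attained t"
  shows "0 \<le> t"
proof -
  obtain F where F: "finite F" "F \<noteq> {}" "F \<subseteq> carrier G" "almost_invariant {} 1 F"
      "f F \<le> t * real (card F)"
    by (rule nearly_attainedE[OF assms finite.emptyI empty_subsetI zero_less_one])
  have "0 \<le> t * real (card F)" "0 < real (card F)"
    using F f_nonneg[of F] by (auto simp: card_gt_0_iff)
  then show ?thesis
    by (simp add: zero_le_mult_iff)
qed

lemma eventually_boundedE:
  assumes "eventually_bounded t"
  obtains K \<eta> where "finite K" "K \<subseteq> carrier G" "0 < \<eta>"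
    "\<forall>F. finite F \<and> F \<noteq> {} \<and> F \<subseteq> carrier G \<and> almost_invariant K \<eta> F \<longrightarrow>
      f F \<le> t * real (card F)"
  using assms unfolding eventually_bounded_def by (elim exE conjE)

text \<open>One round of quasi-tiling. Take a very invariant \<open>F\<close> of slope at most \<open>t\<close> and cover a
  proportion \<open>e / 2\<close> of a still more invariant \<open>B\<close> by almost disjoint translates of \<open>F\<close>. On
  the covered part the slope is at most \<open>t / (1 - e)\<close>. The rest is either so small that the
  trivial bound \<open>f {\<one>}\<close> per point suffices, or it is itself invariant enough for the bound
  assumed. In both cases the excess \<open>\<theta> * f {\<one>}\<close> shrinks by the factor \<open>1 - e / 2\<close>, while the
  main term stays the same, so that the step can be iterated.\<close>

lemma eventually_bounded_improve:
  fixes e \<theta> t :: real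
  assumes t: "nearly_attained t" and e: "0 < e" "e \<le> 1 / 2" and \<theta>: "0 < \<theta>"
    and bd: "eventually_bounded (t / (1 - e) + \<theta> * f {\<one>})"
  shows "eventually_bounded (t / (1 - e) + (1 - e / 2) * \<theta> * f {\<one>})"
proof -
  define s where "s = t / (1 - e)"
  define c where "c = f {\<one>}"
  have c: "0 \<le> c"
    by (simp add: c_def f_nonneg)
  obtain K \<eta> where K: "finite K" "K \<subseteq> carrier G" "0 < \<eta>"
    and bdK: "\<forall>F. finite F \<and> F \<noteq> {} \<and> F \<subseteq> carrier G \<and> almost_invariant K \<eta> F \<longrightarrow>
      f F \<le> (s + \<theta> * c) * real (card F)"
    unfolding s_def c_def by (rule eventually_boundedE[OF bd])
  define \<theta>' where "\<theta>' = (1 - e / 2) * \<theta>"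
  have \<theta>': "0 < \<theta>'"
    using e \<theta> by (simp add: \<theta>'_def)
  \<comment> \<open>Chosen such that removing the translates worsens the invariance exactly to \<open>\<eta>\<close>.\<close>
  define \<eta>' where "\<eta>' = \<eta> * \<theta>' / 3"
  have \<eta>': "0 < \<eta>'" "3 * \<eta>' / \<theta>' = \<eta>"
    using K(3) \<theta>' by (auto simp: \<eta>'_def)
  have e_less_1: "e < 1"
    using e by simp
  obtain F where F: "finite F" "F \<noteq> {}" "F \<subseteq> carrier G" "almost_invariant K \<eta>' F"
      "f F \<le> t * real (card F)"
    using nearly_attainedE[OF t K(1,2) \<eta>'(1)] by blast
  have cF: "0 < real (card F)"
    using F by (simp add: card_gt_0_iff)
  have s0: "0 \<le> s"
    using e nearly_attained_nonneg[OF t] by (simp add: s_def)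
  have ts: "t = s * (1 - e)"
    using e by (simp add: s_def)
  define \<eta>'' where "\<eta>'' = min \<eta>' (1 / (2 * real (card F)))"
  have \<eta>'': "0 < \<eta>''"
    using \<eta>' cF by (simp add: \<eta>''_def)
  have "f B \<le> (s + \<theta>' * c) * real (card B)"
    if B: "finite B" "B \<noteq> {}" "B \<subseteq> carrier G" "almost_invariant (K \<union> F) \<eta>'' B" for B
  proof -
    have invK: "almost_invariant K \<eta>' B" and invF: "almost_invariant F (1 / (2 * real (card F))) B"
      by (rule almost_invariant_mono[OF B(4)]; simp add: \<eta>''_def)+
    obtain Z where Z: "finite Z" "Z \<subseteq> carrier G" "F <#> Z \<subseteq> B"
      and disj: "(1 - e) * real (card F) * real (card Z) \<le> real (card (F <#> Z))"
      and hits: "\<And>z. z \<in> carrier G \<Longrightarrow> F #> z \<subseteq> B \<Longrightarrow>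
         e * real (card F) \<le> real (card ((F #> z) \<inter> (F <#> Z)))"
      using maximal_almost_disjoint_translates[OF F(1-3) B(1,3) e(1) e_less_1] by blast
    define U where "U = F <#> Z"
    define B' where "B' = B - U"
    have U: "finite U" "U \<subseteq> carrier G" "U \<subseteq> B"
      using Z B finite_set_mult[OF F(1) Z(1)] by (auto simp: U_def)
    have B': "finite B'" "B' \<subseteq> carrier G"
      using B by (auto simp: B'_def)
    have cU: "e / 2 * real (card B) \<le> real (card U)"
      using card_union_almost_disjoint_translates[OF F(1-3) B(1,3) U(1,2) invF e(1)] hits
      by (simp add: U_def)
    have split: "real (card B) = real (card U) + real (card B')"
      using U B by (simp add: B'_def card_Diff_subset card_mono of_nat_diff)
    have "f U \<le> real (card Z) * f F"
      unfolding U_def using F Z by (intro f_translates_le) auto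
    also have "\<dots> \<le> real (card Z) * (t * real (card F))"
      using F by (intro mult_left_mono) auto
    also have "\<dots> = s * ((1 - e) * real (card F) * real (card Z))"
      by (simp add: ts)
    also have "\<dots> \<le> s * real (card U)"
      using disj s0 by (intro mult_left_mono) (auto simp: U_def)
    finally have fU: "f U \<le> s * real (card U)" .
    have "B = U \<union> B'"
      using U by (auto simp: B'_def)
    then have fB: "f B \<le> f U + f B'"
      using f_Un_le U B' by metis
    show ?thesis
    proof (cases "\<theta>' * real (card B) \<le> real (card B')")
      case True
      have "almost_invariant K \<eta> B'"
        using almost_invariant_remove_translates[OF F(1,3) B(1,3) Z disj e(2) K(2) F(4) invK \<theta>']
          True \<eta>' by (simp add: B'_def U_def)
      moreover have "0 < real (card B')"
        using True \<theta>' B by (smt (verit) card_gt_0_iff mult_pos_pos of_nat_0_less_iff)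
      ultimately have "f B' \<le> (s + \<theta> * c) * real (card B')"
        using B' bdK by auto
      then have "f B \<le> s * real (card B) + \<theta> * c * real (card B')"
        using fB fU split by (simp add: algebra_simps)
      also have "\<dots> \<le> s * real (card B) + \<theta> * c * ((1 - e / 2) * real (card B))"
        using split cU \<theta> c by (intro add_left_mono mult_left_mono) (auto simp: algebra_simps)
      finally show ?thesis
        by (simp add: \<theta>'_def algebra_simps)
    next
      case False
      have "f B' \<le> c * real (card B')"
        using B' by (simp add: c_def f_le_card)
      also have "\<dots> \<le> c * (\<theta>' * real (card B))"
        using False c by (intro mult_left_mono) auto
      finally have "f B \<le> s * real (card U) + c * (\<theta>' * real (card B))"
        using fB fU by simp
      also have "s * real (card U) \<le> s * real (card B)"
        using s0 split by (intro mult_left_mono) auto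
      finally show ?thesis
        by (simp add: algebra_simps)
    qed
  qed
  then show ?thesis
    unfolding eventually_bounded_def using K F \<eta>''
    by (intro exI[of _ "K \<union> F"] exI[of _ \<eta>'']) (auto simp: s_def c_def \<theta>'_def)
qed

text \<open>Iterating the improvement from the trivial bound \<open>f {\<one>}\<close> per point makes the excess
  arbitrarily small; \<open>e\<close> is chosen in advance so that \<open>t / (1 - e)\<close> is close to \<open>t\<close>.\<close>

lemma eventually_bounded_of_nearly_attained:
  fixes t \<epsilon> :: real
  assumes t: "nearly_attained t" and \<epsilon>: "0 < \<epsilon>"
  shows "eventually_bounded (t + \<epsilon>)"
proof -
  define c where "c = f {\<one>}"
  have c: "0 \<le> c"
    by (simp add: c_def f_nonneg)
  have t0: "0 \<le> t"
    by (rule nearly_attained_nonneg[OF t])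
  define e where "e = min (1 / 2) (\<epsilon> / (4 * (t + 1)))"
  have e: "0 < e" "e \<le> 1 / 2" "e \<le> \<epsilon> / (4 * (t + 1))"
    using \<epsilon> t0 unfolding e_def by (simp_all del: min_less_iff_conj add: min_def)
  have "e * (4 * (t + 1)) \<le> \<epsilon>"
    using e(3) t0 by (simp add: pos_le_divide_eq)
  moreover have "e * \<epsilon> \<le> 1 / 2 * \<epsilon>"
    using e \<epsilon> by (intro mult_right_mono) auto
  moreover have "e * (4 * (t + 1)) = 4 * (e * t) + 4 * e"
    "(t + \<epsilon> / 2) * (1 - e) = t + \<epsilon> / 2 - e * t - e * \<epsilon> / 2"
    by (simp_all add: field_simps)
  ultimately have "t \<le> (t + \<epsilon> / 2) * (1 - e)"
    using e(1) by linarith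
  then have te: "t / (1 - e) \<le> t + \<epsilon> / 2"
    using e by (simp add: pos_divide_le_eq)
  have bd: "eventually_bounded (t / (1 - e) + (1 - e / 2) ^ n * c)" for n
  proof (induction n)
    case 0
    have "f A \<le> (t / (1 - e) + c) * real (card A)" if "finite A" "A \<subseteq> carrier G" for A
    proof -
      have "f A \<le> c * real (card A)"
        using f_le_card that by (simp add: c_def)
      also have "\<dots> \<le> (t / (1 - e) + c) * real (card A)"
        using t0 e by (intro mult_right_mono) auto
      finally show ?thesis .
    qed
    then show ?case
      unfolding eventually_bounded_def by (intro exI[of _ "{}"] exI[of _ 1]) simp
  next
    case (Suc n)
    have "0 < (1 - e / 2) ^ n"
      using e by simp
    then show ?case
      using eventually_bounded_improve[OF t e(1,2), of "(1 - e / 2) ^ n"] Suc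
      by (simp add: c_def)
  qed
  have "(\<lambda>n. (1 - e / 2) ^ n * c) \<longlonglongrightarrow> 0 * c"
    using e by (intro tendsto_mult LIMSEQ_power_zero tendsto_const) auto
  then have "eventually (\<lambda>n. (1 - e / 2) ^ n * c < \<epsilon> / 2) sequentially"
    using \<epsilon> by (intro order_tendstoD) auto
  then obtain n where n: "(1 - e / 2) ^ n * c < \<epsilon> / 2"
    by (auto dest: eventually_happens)
  obtain K \<eta> where K: "finite K" "K \<subseteq> carrier G" "0 < \<eta>"
    "\<forall>F. finite F \<and> F \<noteq> {} \<and> F \<subseteq> carrier G \<and> almost_invariant K \<eta> F \<longrightarrow>
      f F \<le> (t / (1 - e) + (1 - e / 2) ^ n * c) * real (card F)"
    by (rule eventually_boundedE[OF bd[of n]])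
  have "f F \<le> (t + \<epsilon>) * real (card F)"
    if "finite F" "F \<noteq> {}" "F \<subseteq> carrier G" "almost_invariant K \<eta> F" for F
  proof -
    have "(t / (1 - e) + (1 - e / 2) ^ n * c) * real (card F) \<le> (t + \<epsilon>) * real (card F)"
      using te n by (intro mult_right_mono) auto
    then show ?thesis
      using K(4)[rule_format, of F] that by simp
  qed
  then show ?thesis
    unfolding eventually_bounded_def using K(1-3) by (intro exI[of _ K] exI[of _ \<eta>]) simp
qed

text \<open>The Ornstein-Weiss lemma for discrete groups. The limit is the infimum \<open>L\<close> of the nearly
  attained slopes: slopes below \<open>L\<close> are not attained by sufficiently invariant sets, and slopes
  above \<open>L\<close> are eventual upper bounds.\<close>

theorem discrete_ornstein_weiss:
  assumes ex: "\<And>K \<eta>. finite K \<Longrightarrow> K \<subseteq> carrier G \<Longrightarrow> 0 < \<eta> \<Longrightarrow>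
    \<exists>F. finite F \<and> F \<noteq> {} \<and> F \<subseteq> carrier G \<and> almost_invariant K \<eta> F"
  obtains L where "\<And>\<epsilon>. 0 < \<epsilon> \<Longrightarrow> \<exists>K \<eta>. finite K \<and> K \<subseteq> carrier G \<and> 0 < \<eta> \<and>
    (\<forall>F. finite F \<and> F \<noteq> {} \<and> F \<subseteq> carrier G \<and> almost_invariant K \<eta> F \<longrightarrow>
      \<bar>f F / real (card F) - L\<bar> \<le> \<epsilon>)"
proof -
  define S where "S = {t. nearly_attained t}"
  have "f {\<one>} \<in> S"
    unfolding S_def nearly_attained_def using ex f_le_card by (smt (verit) mem_Collect_eq)
  then have S_ne: "S \<noteq> {}"
    by blast
  have bdd: "bdd_below S"
    by (rule bdd_belowI[of S 0]) (simp add: S_def nearly_attained_nonneg)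
  define L where "L = Inf S"
  show thesis
  proof (rule that[of L])
    fix \<epsilon> :: real assume \<epsilon>: "0 < \<epsilon>"
    obtain t where t: "t \<in> S" "t < L + \<epsilon> / 2"
      using cInf_lessD[OF S_ne, of "L + \<epsilon> / 2"] \<epsilon> by (auto simp: L_def)
    have "eventually_bounded (t + \<epsilon> / 2)"
      using t \<epsilon> by (intro eventually_bounded_of_nearly_attained) (auto simp: S_def)
    then obtain K1 \<eta>1 where K1: "finite K1" "K1 \<subseteq> carrier G" "0 < \<eta>1"
      "\<forall>F. finite F \<and> F \<noteq> {} \<and> F \<subseteq> carrier G \<and> almost_invariant K1 \<eta>1 F \<longrightarrow>
        f F \<le> (t + \<epsilon> / 2) * real (card F)"
      by (rule eventually_boundedE)
    have "L - \<epsilon> \<notin> S"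
      using cInf_lower[OF _ bdd, of "L - \<epsilon>"] \<epsilon> by (auto simp: L_def)
    then have "\<not> nearly_attained (L - \<epsilon>)"
      by (simp add: S_def)
    then obtain K2 \<eta>2 where K2: "finite K2" "K2 \<subseteq> carrier G" "0 < \<eta>2"
      "\<forall>F. finite F \<and> F \<noteq> {} \<and> F \<subseteq> carrier G \<and> almost_invariant K2 \<eta>2 F \<longrightarrow>
        \<not> f F \<le> (L - \<epsilon>) * real (card F)"
      unfolding nearly_attained_def not_all not_imp not_ex de_Morgan_conj
      by (smt (verit))
    have "\<bar>f F / real (card F) - L\<bar> \<le> \<epsilon>"
      if F: "finite F" "F \<noteq> {}" "F \<subseteq> carrier G" "almost_invariant (K1 \<union> K2) (min \<eta>1 \<eta>2) F" for F
    proof -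
      have cF: "0 < real (card F)"
        using F by (simp add: card_gt_0_iff)
      have "f F \<le> (t + \<epsilon> / 2) * real (card F)" "(L - \<epsilon>) * real (card F) < f F"
        using K1(4)[rule_format, of F] K2(4)[rule_format, of F] F(1-3)
          almost_invariant_mono[OF F(4), of K1 \<eta>1] almost_invariant_mono[OF F(4), of K2 \<eta>2]
        by auto
      then have "f F / real (card F) \<le> t + \<epsilon> / 2" "L - \<epsilon> < f F / real (card F)"
        using cF by (simp_all add: divide_le_eq less_divide_eq)
      then show ?thesis
        using t by linarith
    qed
    then show "\<exists>K \<eta>. finite K \<and> K \<subseteq> carrier G \<and> 0 < \<eta> \<and>
      (\<forall>F. finite F \<and> F \<noteq> {} \<and> F \<subseteq> carrier G \<and> almost_invariant K \<eta> F \<longrightarrow>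
        \<bar>f F / real (card F) - L\<bar> \<le> \<epsilon>)"
      using K1 K2 by (intro exI[of _ "K1 \<union> K2"] exI[of _ "min \<eta>1 \<eta>2"]) auto
  qed
qed

end

section \<open>Boundaries and thickenings in topological groups\<close>

locale topological_group_on = group G for G (structure) +
  fixes T :: "'a topology"
  assumes topological_group: "topological_group G T"
begin

lemma topspace_T: "topspace T = carrier G"
  using topological_group by (simp add: topological_group_def)

lemma continuous_mult:
  assumes "continuous_map X T f" "continuous_map X T h"
  shows "continuous_map X T (\<lambda>x. f x \<otimes> h x)"
proof -
  have "continuous_map X T ((\<lambda>(a, b). a \<otimes> b) \<circ> (\<lambda>x. (f x, h x)))"
    by (rule continuous_map_compose[OF continuous_map_pairedI[OF assms]])
      (use topological_group in \<open>simp add: topological_group_def\<close>)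
  then show ?thesis
    by (simp add: o_def)
qed

lemma continuous_inv:
  assumes "continuous_map X T f"
  shows "continuous_map X T (\<lambda>x. inv (f x))"
proof -
  have "continuous_map X T ((\<lambda>a. inv a) \<circ> f)"
    by (rule continuous_map_compose[OF assms])
      (use topological_group in \<open>simp add: topological_group_def\<close>)
  then show ?thesis
    by (simp add: o_def)
qed

lemma continuous_l_translation: "g \<in> carrier G \<Longrightarrow> continuous_map T T (\<lambda>x. g \<otimes> x)"
  by (intro continuous_mult) (simp_all add: topspace_T)

lemma continuous_r_translation: "g \<in> carrier G \<Longrightarrow> continuous_map T T (\<lambda>x. x \<otimes> g)"
  by (intro continuous_mult) (simp_all add: topspace_T)

lemma openin_subset_carrier: "openin T U \<Longrightarrow> U \<subseteq> carrier G"
  using openin_subset topspace_T by blast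

lemma compactin_subset_carrier: "compactin T K \<Longrightarrow> K \<subseteq> carrier G"
  using compactin_subset_topspace topspace_T by blast

lemma r_coset_eq_preimage:
  assumes "g \<in> carrier G" "A \<subseteq> carrier G"
  shows "A #> g = {x \<in> carrier G. x \<otimes> inv g \<in> A}"
proof (intro Set.set_eqI iffI)
  fix x assume "x \<in> A #> g"
  then obtain a where "a \<in> A" "x = a \<otimes> g"
    by (auto simp: r_coset_def)
  then show "x \<in> {x \<in> carrier G. x \<otimes> inv g \<in> A}"
    using assms by (auto simp: m_assoc subset_iff)
next
  fix x assume x: "x \<in> {x \<in> carrier G. x \<otimes> inv g \<in> A}"
  then have "x = (x \<otimes> inv g) \<otimes> g"
    using assms by (simp add: m_assoc)
  then show "x \<in> A #> g"
    using x by (auto simp: r_coset_def)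
qed

lemma l_coset_eq_preimage:
  assumes "g \<in> carrier G" "A \<subseteq> carrier G"
  shows "g <# A = {x \<in> carrier G. inv g \<otimes> x \<in> A}"
proof (intro Set.set_eqI iffI)
  fix x assume "x \<in> g <# A"
  then obtain a where "a \<in> A" "x = g \<otimes> a"
    by (auto simp: l_coset_def)
  then show "x \<in> {x \<in> carrier G. inv g \<otimes> x \<in> A}"
    using assms by (auto simp: subset_iff simp flip: m_assoc)
next
  fix x assume x: "x \<in> {x \<in> carrier G. inv g \<otimes> x \<in> A}"
  then have "x = g \<otimes> (inv g \<otimes> x)"
    using assms by (simp flip: m_assoc)
  then show "x \<in> g <# A"
    using x by (auto simp: l_coset_def)
qed

lemma openin_r_coset:
  assumes "g \<in> carrier G" "openin T U"
  shows "openin T (U #> g)"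
  using openin_continuous_map_preimage[OF continuous_r_translation[of "inv g"] assms(2)]
    r_coset_eq_preimage[OF assms(1) openin_subset_carrier[OF assms(2)]] assms(1)
  by (simp add: topspace_T)

lemma openin_l_coset:
  assumes "g \<in> carrier G" "openin T U"
  shows "openin T (g <# U)"
  using openin_continuous_map_preimage[OF continuous_l_translation[of "inv g"] assms(2)]
    l_coset_eq_preimage[OF assms(1) openin_subset_carrier[OF assms(2)]] assms(1)
  by (simp add: topspace_T)

text \<open>The diagonal is the preimage of the closed set \<open>{\<one>}\<close> under \<open>(a, b) \<mapsto> a\<^sup>-\<^sup>1b\<close>.\<close>

lemma Hausdorff: "Hausdorff_space T"
proof -
  have "closedin T {\<one>}"
    using topological_group by (simp add: topological_group_def t1_space_closedin_singleton)
  moreover have "continuous_map (prod_topology T T) T (\<lambda>x. inv (fst x) \<otimes> snd x)"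
    by (intro continuous_mult continuous_inv continuous_map_fst continuous_map_snd)
  ultimately have "closedin (prod_topology T T)
      {x \<in> topspace (prod_topology T T). inv (fst x) \<otimes> snd x \<in> {\<one>}}"
    by (rule closedin_continuous_map_preimage[rotated])
  moreover have "{x \<in> topspace (prod_topology T T). inv (fst x) \<otimes> snd x \<in> {\<one>}} =
      (\<lambda>x. (x, x)) ` topspace T"
  proof -
    have "inv a \<otimes> b = \<one> \<longleftrightarrow> b = a" if "a \<in> carrier G" "b \<in> carrier G" for a b
    proof
      assume eq: "inv a \<otimes> b = \<one>"
      have "b = a \<otimes> (inv a \<otimes> b)"
        using that by (simp flip: m_assoc)
      then show "b = a"
        unfolding eq using that by simp
    qed (use that in simp)
    then show ?thesis
      by (fastforce simp: topspace_T)
  qed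
  ultimately show ?thesis
    by (simp add: Hausdorff_space_closedin_diagonal)
qed

lemma compactin_closedin: "compactin T K \<Longrightarrow> closedin T K"
  by (rule compactin_imp_closedin[OF Hausdorff])

lemma compactin_set_mult:
  assumes "compactin T K" "compactin T L"
  shows "compactin T (K <#> L)"
proof -
  have "compactin (prod_topology T T) (K \<times> L)"
    using assms by (simp add: compactin_Times)
  moreover have "continuous_map (prod_topology T T) T (\<lambda>x. fst x \<otimes> snd x)"
    by (intro continuous_mult continuous_map_fst continuous_map_snd)
  ultimately have "compactin T ((\<lambda>x. fst x \<otimes> snd x) ` (K \<times> L))"
    by (rule image_compactin)
  moreover have "(\<lambda>x. fst x \<otimes> snd x) ` (K \<times> L) = K <#> L"
    by (force simp: set_mult_def image_iff)
  ultimately show ?thesis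
    by simp
qed

lemma compactin_inverse:
  assumes "compactin T K"
  shows "compactin T ((\<lambda>x. inv x) ` K)"
  by (rule image_compactin[OF assms continuous_inv]) simp

abbreviation boundary :: "'a set \<Rightarrow> 'a set \<Rightarrow> 'a set" where
  "boundary K A \<equiv> K_boundary G T K A"

abbreviation co_closure :: "'a set \<Rightarrow> 'a set" where
  "co_closure A \<equiv> T closure_of (carrier G - A)"

lemma co_closure_subset: "co_closure A \<subseteq> carrier G"
  using closure_of_subset_topspace topspace_T by metis

lemma compl_subset_co_closure: "carrier G - A \<subseteq> co_closure A"
  by (rule closure_of_subset) (auto simp: topspace_T)

lemma K_boundary_compactin:
  assumes "compactin T A"
  shows "boundary K A = (K <#> A) \<inter> (K <#> co_closure A)"
  using compactin_closedin[OF assms] by (simp add: K_boundary_def closure_of_closedin)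

text \<open>Compactness makes boundaries measurable, without which estimates of their measure would be
  void. A product \<open>k b\<close> can lie in \<open>K A\<close> only for \<open>b\<close> in the compact set \<open>N = K\<^sup>-\<^sup>1 K A\<close>, so
  that the closed second factor may be cut down to a compact one.\<close>

lemma compactin_K_boundary:
  assumes K: "compactin T K" and A: "compactin T A"
  shows "compactin T (boundary K A)"
proof -
  define N where "N = (\<lambda>x. inv x) ` K <#> (K <#> A)"
  define R where "R = co_closure A"
  have Kc: "K \<subseteq> carrier G" and Ac: "A \<subseteq> carrier G" and Rc: "R \<subseteq> carrier G"
    using K A by (auto dest: compactin_subset_carrier simp: R_def co_closure_subset)
  have N: "compactin T N"
    unfolding N_def by (intro compactin_set_mult compactin_inverse K A)
  have "boundary K A = (K <#> A) \<inter> (K <#> (N \<inter> R))"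
    unfolding K_boundary_compactin[OF A] R_def[symmetric]
  proof (intro equalityI subsetI)
    fix x assume x: "x \<in> (K <#> A) \<inter> (K <#> R)"
    then obtain k b where kb: "k \<in> K" "b \<in> R" "x = k \<otimes> b"
      by (auto elim: mem_set_multE)
    then have "b = inv k \<otimes> x"
      using Kc Rc by (simp add: subset_iff flip: m_assoc)
    moreover have "inv k \<otimes> x \<in> N"
      unfolding N_def using x kb(1) by (intro mem_set_multI imageI) auto
    ultimately have "b \<in> N"
      by simp
    then show "x \<in> (K <#> A) \<inter> (K <#> (N \<inter> R))"
      using x kb by (auto intro: mem_set_multI)
  qed (auto simp: set_mult_def)
  moreover have "compactin T (N \<inter> R)"
    unfolding R_def using N by (simp add: compact_Int_closedin)
  ultimately show ?thesis
    using K A by (auto intro!: compactin_set_mult compact_Int_closedin compactin_closedin)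
qed

lemma set_mult_K_boundary_subset:
  assumes A: "compactin T A" and V: "V \<subseteq> carrier G" and K: "K \<subseteq> carrier G"
  shows "V <#> boundary K A \<subseteq> boundary (V <#> K) A"
proof -
  have "V <#> boundary K A \<subseteq> (V <#> (K <#> A)) \<inter> (V <#> (K <#> co_closure A))"
    unfolding K_boundary_compactin[OF A] by (intro Int_greatest set_mult_mono_both) auto
  also have "\<dots> = boundary (V <#> K) A"
    unfolding K_boundary_compactin[OF A]
    using V K compactin_subset_carrier[OF A] co_closure_subset[of A]
    by (simp add: set_mult_assoc)
  finally show ?thesis .
qed

text \<open>Changing a set inside its \<open>M\<close>-boundary does not create new boundary: a point of the closure of
  the complement of \<open>B\<close> lies in \<open>M\<close> times the closure of the complement of \<open>A\<close>, and
  \<open>B \<subseteq> M A\<close>. This turns Van Hove nets into Van Hove nets.\<close>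

lemma K_boundary_perturbation:
  assumes A: "compactin T A" and B: "compactin T B" and L: "L \<subseteq> carrier G"
    and M: "compactin T M" "\<one> \<in> M"
    and BA: "B \<subseteq> M <#> A" and AB: "A \<subseteq> B \<union> boundary M A"
  shows "boundary L B \<subseteq> boundary (L <#> M) A"
proof
  note carr = compactin_subset_carrier[OF A] compactin_subset_carrier[OF B] L
    compactin_subset_carrier[OF M(1)] co_closure_subset[of A]
  define R where "R = co_closure A"
  fix x assume x: "x \<in> boundary L B"
  have "x \<in> L <#> (M <#> A)"
    using x set_mult_mono_both[OF subset_refl BA, of L]
    unfolding K_boundary_compactin[OF B] by blast
  then have x1: "x \<in> (L <#> M) <#> A"
    using carr by (simp add: set_mult_assoc)
  have clo: "closedin T (boundary M A)"
    using compactin_closedin compactin_K_boundary M A by blast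
  have "carrier G - B \<subseteq> (carrier G - A) \<union> boundary M A"
    using AB by blast
  then have "co_closure B \<subseteq> R \<union> boundary M A"
    using closure_of_mono[of "carrier G - B" "(carrier G - A) \<union> boundary M A" T] clo
    by (simp add: R_def closure_of_closedin)
  also have "\<dots> \<subseteq> M <#> R"
    using subset_set_mult_one[OF M(2)] carr by (auto simp: K_boundary_compactin[OF A] R_def)
  finally have "L <#> co_closure B \<subseteq> L <#> (M <#> R)"
    by (intro set_mult_mono_both subset_refl)
  then have "x \<in> L <#> (M <#> R)"
    using x unfolding K_boundary_compactin[OF B] by blast
  then have "x \<in> (L <#> M) <#> R"
    using carr by (simp add: set_mult_assoc R_def)
  then show "x \<in> boundary (L <#> M) A"
    using x1 by (simp add: K_boundary_compactin[OF A] R_def)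
qed

text \<open>A point of \<open>A\<close> is \<open>c l\<close> with \<open>c \<in> C\<close> and \<open>l \<in> \<Lambda>\<close>; if \<open>l \<notin> A\<close>, the point is near the
  complement of \<open>A\<close>. So sampling \<open>A\<close> on \<open>\<Lambda>\<close> and thickening the sample by \<open>C\<close> recovers
  \<open>A\<close> up to its boundary. This is used for a compact \<open>C\<close>, to relate the entropy of the sample to
  the entropy of \<open>A\<close>, and for a Borel fundamental domain \<open>C\<close>, to count the sample.\<close>

lemma thickening_close:
  assumes A: "compactin T A" and \<Lambda>: "\<Lambda> \<subseteq> carrier G" and C: "C <#> \<Lambda> = carrier G"
    and M: "compactin T M" "\<one> \<in> M" "C \<subseteq> M"
  shows "C <#> (A \<inter> \<Lambda>) \<subseteq> M <#> A"
    and "A \<subseteq> (C <#> (A \<inter> \<Lambda>)) \<union> boundary M A"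
    and "C <#> (A \<inter> \<Lambda>) \<subseteq> A \<union> boundary M A"
proof -
  have Ac: "A \<subseteq> carrier G" and Mc: "M \<subseteq> carrier G"
    using A M by (auto dest: compactin_subset_carrier)
  show 1: "C <#> (A \<inter> \<Lambda>) \<subseteq> M <#> A"
    using M(3) by (intro set_mult_mono_both) auto
  show "A \<subseteq> (C <#> (A \<inter> \<Lambda>)) \<union> boundary M A"
  proof
    fix x assume x: "x \<in> A"
    then have "x \<in> C <#> \<Lambda>"
      using Ac C by blast
    then obtain c l where cl: "c \<in> C" "l \<in> \<Lambda>" "x = c \<otimes> l"
      by (rule mem_set_multE)
    show "x \<in> (C <#> (A \<inter> \<Lambda>)) \<union> boundary M A"
    proof (cases "l \<in> A")
      case True
      then show ?thesis
        using cl by (auto intro: mem_set_multI)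
    next
      case False
      then have "l \<in> co_closure A"
        using compl_subset_co_closure cl \<Lambda> by blast
      moreover have "x \<in> M <#> A"
        using subset_set_mult_one[OF M(2) Ac] x by blast
      ultimately show ?thesis
        using cl M(3) by (auto simp: K_boundary_compactin[OF A] intro: mem_set_multI)
    qed
  qed
  show "C <#> (A \<inter> \<Lambda>) \<subseteq> A \<union> boundary M A"
  proof
    fix x assume x: "x \<in> C <#> (A \<inter> \<Lambda>)"
    then have xM: "x \<in> M <#> A"
      using 1 by blast
    then have xc: "x \<in> carrier G"
      using set_mult_closed[OF Mc Ac] by blast
    show "x \<in> A \<union> boundary M A"
    proof (cases "x \<in> A")
      case False
      then have "x \<in> co_closure A"
        using compl_subset_co_closure xc by blast
      then have "x \<in> M <#> co_closure A"
        using subset_set_mult_one[OF M(2) co_closure_subset] by blast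
      then show ?thesis
        using xM by (auto simp: K_boundary_compactin[OF A])
    qed simp
  qed
qed

text \<open>The translates \<open>C l\<close> with \<open>l \<in> \<Lambda>\<close> are pairwise disjoint.\<close>

definition separated :: "'a set \<Rightarrow> 'a set \<Rightarrow> bool" where
  "separated C \<Lambda> \<longleftrightarrow>
     (\<forall>c\<in>C. \<forall>c'\<in>C. \<forall>l\<in>\<Lambda>. \<forall>l'\<in>\<Lambda>. c \<otimes> l = c' \<otimes> l' \<longrightarrow> l = l')"

lemma separatedD:
  "separated C \<Lambda> \<Longrightarrow> c \<in> C \<Longrightarrow> c' \<in> C \<Longrightarrow> l \<in> \<Lambda> \<Longrightarrow> l' \<in> \<Lambda> \<Longrightarrow> c \<otimes> l = c' \<otimes> l' \<Longrightarrow> l = l'"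
  unfolding separated_def by simp

lemma separated_subset:
  assumes "separated V \<Lambda>" "V' \<subseteq> V" "F \<subseteq> \<Lambda>"
  shows "separated V' F"
  unfolding separated_def
proof (intro ballI impI)
  fix c c' l l' assume c: "c \<in> V'" "c' \<in> V'" "l \<in> F" "l' \<in> F" "c \<otimes> l = c' \<otimes> l'"
  show "l = l'"
    using assms(1) subsetD[OF assms(2) c(1)] subsetD[OF assms(2) c(2)]
      subsetD[OF assms(3) c(3)] subsetD[OF assms(3) c(4)] c(5) by (rule separatedD)
qed

text \<open>Take \<open>V\<close> with \<open>V\<^sup>-\<^sup>1 V\<close> inside an open set that meets \<open>\<Lambda>\<close> only in \<open>\<one>\<close>:
  if \<open>v l = v' l'\<close>, then \<open>v\<^sup>-\<^sup>1 v' = l l'\<^sup>-\<^sup>1\<close> lies in that intersection.\<close>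

lemma discrete_subgroup_separating_nbhd:
  assumes \<Lambda>: "subgroup \<Lambda> G" "discrete_subset T \<Lambda>"
  obtains V where "openin T V" "\<one> \<in> V" "separated V \<Lambda>"
proof -
  have one: "\<one> \<in> \<Lambda>"
    using \<Lambda>(1) by (rule subgroup.one_closed)
  then have "openin (subtopology T \<Lambda>) {\<one>}"
    using \<Lambda>(2) by (simp add: discrete_subset_def)
  then obtain W where W: "openin T W" "{\<one>} = W \<inter> \<Lambda>"
    by (auto simp: openin_subtopology)
  have cont: "continuous_map (prod_topology T T) T (\<lambda>x. inv (fst x) \<otimes> snd x)"
    by (intro continuous_mult continuous_inv continuous_map_fst continuous_map_snd)
  define P where "P = {x \<in> topspace (prod_topology T T). inv (fst x) \<otimes> snd x \<in> W}"
  have "openin (prod_topology T T) P"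
    unfolding P_def by (rule openin_continuous_map_preimage[OF cont W(1)])
  moreover have "(\<one>, \<one>) \<in> P"
    using W(2) by (auto simp: P_def topspace_T)
  ultimately have "\<exists>V1 V2. openin T V1 \<and> openin T V2 \<and> \<one> \<in> V1 \<and> \<one> \<in> V2 \<and> V1 \<times> V2 \<subseteq> P"
    unfolding openin_prod_topology_alt by simp
  then obtain V1 V2 where V: "openin T V1" "openin T V2" "\<one> \<in> V1" "\<one> \<in> V2" "V1 \<times> V2 \<subseteq> P"
    by (elim exE conjE)
  show thesis
  proof (rule that[of "V1 \<inter> V2"])
    show "openin T (V1 \<inter> V2)" "\<one> \<in> V1 \<inter> V2"
      using V by auto
    show "separated (V1 \<inter> V2) \<Lambda>"
      unfolding separated_def
    proof (intro ballI impI)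
      fix v v' l l'
      assume vl: "v \<in> V1 \<inter> V2" "v' \<in> V1 \<inter> V2" "l \<in> \<Lambda>" "l' \<in> \<Lambda>" "v \<otimes> l = v' \<otimes> l'"
      have c: "v \<in> carrier G" "v' \<in> carrier G" "l \<in> carrier G" "l' \<in> carrier G"
        using vl V(1) openin_subset_carrier subgroup.subset[OF \<Lambda>(1)] by auto
      have "inv v \<otimes> v' = l \<otimes> inv l'"
      proof -
        have "l = inv v \<otimes> (v' \<otimes> l')"
          using inv_solve_left[of l v "v' \<otimes> l'"] vl(5) c by simp
        then show ?thesis
          using c by (simp add: m_assoc)
      qed
      moreover have "inv v \<otimes> v' \<in> W"
        using V(5) vl by (auto simp: P_def)
      moreover have "l \<otimes> inv l' \<in> \<Lambda>"
        using vl \<Lambda>(1) by (simp add: subgroup.m_closed subgroup.m_inv_closed)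
      ultimately have "inv v \<otimes> v' = \<one>"  "l \<otimes> inv l' = \<one>"
        using W(2) by auto
      then show "l = l'"
        using inv_equality[of l "inv l'"] c by simp
    qed
  qed
qed

end

section \<open>Haar measure\<close>

locale haar_group = topological_group_on +
  fixes m :: "'a measure"
  assumes locally_compact: "locally_compact_space T" and haar: "haar_measure G T m"
begin

lemma space_m: "space m = carrier G"
  using haar by (simp add: haar_measure_def regular_borel_measure_def topspace_T)

lemma sets_m: "sets m = sigma_sets (carrier G) {U. openin T U}"
  using haar by (simp add: haar_measure_def regular_borel_measure_def topspace_T)

lemma openin_sets: "openin T U \<Longrightarrow> U \<in> sets m"
  by (auto simp: sets_m)

lemma closedin_sets:
  assumes "closedin T K" shows "K \<in> sets m"
proof -
  have "space m - (topspace T - K) \<in> sets m"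
    using assms by (intro sets.compl_sets openin_sets) (simp add: closedin_def)
  moreover have "space m - (topspace T - K) = K"
    using closedin_subset[OF assms] by (auto simp: space_m topspace_T)
  ultimately show ?thesis
    by simp
qed

lemma compactin_sets: "compactin T K \<Longrightarrow> K \<in> sets m"
  by (intro closedin_sets compactin_closedin)

lemma emeasure_compactin_finite: "compactin T K \<Longrightarrow> emeasure m K < \<infinity>"
  using haar by (simp add: haar_measure_def regular_borel_measure_def)

lemma compactin_fmeasurable: "compactin T K \<Longrightarrow> K \<in> fmeasurable m"
  by (intro fmeasurableI compactin_sets emeasure_compactin_finite) 

lemma emeasure_r_coset: "g \<in> carrier G \<Longrightarrow> A \<in> sets m \<Longrightarrow> emeasure m (A #> g) = emeasure m A"
  using haar by (simp add: haar_measure_def)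

text \<open>In HOL non-measurable sets have measure \<open>0\<close>, so invariance of the values of the measure does
  not show that translates of null sets are measurable. Continuity does.\<close>

lemma sets_r_coset:
  assumes g: "g \<in> carrier G" and A: "A \<in> sets m"
  shows "A #> g \<in> sets m"
proof -
  have "(\<lambda>x. x \<otimes> inv g) \<in> measurable m m"
  proof (rule measurable_sigma_sets[OF sets_m])
    show "{U. openin T U} \<subseteq> Pow (carrier G)"
      using openin_subset_carrier by blast
    show "(\<lambda>x. x \<otimes> inv g) \<in> space m \<rightarrow> carrier G"
      using g by (auto simp: space_m)
    fix U assume "U \<in> {U. openin T U}"
    then have "openin T {x \<in> topspace T. x \<otimes> inv g \<in> U}"
      using g by (intro openin_continuous_map_preimage[OF continuous_r_translation]) auto
    moreover have "{x \<in> topspace T. x \<otimes> inv g \<in> U} = (\<lambda>x. x \<otimes> inv g) -` U \<inter> space m"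
      by (auto simp: space_m topspace_T)
    ultimately show "(\<lambda>x. x \<otimes> inv g) -` U \<inter> space m \<in> sets m"
      using openin_sets by simp
  qed
  then have "(\<lambda>x. x \<otimes> inv g) -` A \<inter> space m \<in> sets m"
    using A by (rule measurable_sets)
  moreover have "A \<subseteq> carrier G"
    using sets.sets_into_space[OF A] by (simp add: space_m)
  then have "(\<lambda>x. x \<otimes> inv g) -` A \<inter> space m = A #> g"
    unfolding r_coset_eq_preimage[OF g \<open>A \<subseteq> carrier G\<close>] by (auto simp: space_m)
  ultimately show ?thesis
    by simp
qed

text \<open>Finitely many translates of \<open>U\<close> cover a given compact set. If \<open>U\<close> were a null set, so would be
  every compact set and, by inner regularity, the whole group.\<close>

lemma emeasure_openin_pos:
  assumes U: "openin T U" "U \<noteq> {}"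
  shows "0 < emeasure m U"
proof (rule ccontr)
  assume "\<not> 0 < emeasure m U"
  then have U0: "emeasure m U = 0"
    by simp
  obtain u where u: "u \<in> U" "u \<in> carrier G"
    using U openin_subset_carrier by blast
  have "emeasure m K = 0" if K: "compactin T K" for K
  proof -
    define \<U> where "\<U> = (\<lambda>g. U #> g) ` carrier G"
    have "K \<subseteq> \<Union>\<U>"
    proof
      fix x assume "x \<in> K"
      then have x: "x \<in> carrier G"
        using compactin_subset_carrier[OF K] by blast
      have "x = u \<otimes> (inv u \<otimes> x)"
        using x u by (simp flip: m_assoc)
      then have "x \<in> U #> (inv u \<otimes> x)"
        using u(1) unfolding r_coset_def by blast
      moreover have "inv u \<otimes> x \<in> carrier G"
        using x u by simp
      ultimately show "x \<in> \<Union>\<U>"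
        unfolding \<U>_def by blast
    qed
    moreover have "\<forall>W\<in>\<U>. openin T W"
      unfolding \<U>_def using openin_r_coset U(1) by auto
    ultimately obtain \<F> where F: "finite \<F>" "\<F> \<subseteq> \<U>" "K \<subseteq> \<Union>\<F>"
      using K unfolding compactin_def by blast
    have null: "W \<in> null_sets m" if W: "W \<in> \<F>" for W
    proof -
      obtain g where g: "g \<in> carrier G" "W = U #> g"
        using subsetD[OF F(2) W] unfolding \<U>_def by (rule imageE)
      then show ?thesis
        using U0 openin_sets[OF U(1)] sets_r_coset emeasure_r_coset by (auto simp: null_sets_def)
    qed
    have "\<Union>\<F> \<in> null_sets m"
      using null_sets.finite_UN[of \<F> "\<lambda>W. W"] F(1) null by (cases "\<F> = {}") auto
    then show ?thesis
      using F(3) compactin_sets[OF K] null_sets_subset null_setsD1 by blast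
  qed
  then have "(SUP K\<in>{K. compactin T K \<and> K \<subseteq> carrier G}. emeasure m K) = 0"
    by (simp add: SUP_constant bot_ennreal)
  moreover have "emeasure m (carrier G) = (SUP K\<in>{K. compactin T K \<and> K \<subseteq> carrier G}. emeasure m K)"
    using haar openin_topspace[of T] topspace_T
    unfolding haar_measure_def regular_borel_measure_def by metis
  ultimately show False
    using haar by (simp add: haar_measure_def space_m)
qed

lemma measure_interior_pos:
  assumes "compactin T K" "T interior_of K \<noteq> {}"
  shows "0 < measure m K"
proof -
  have "0 < emeasure m (T interior_of K)"
    using assms(2) by (intro emeasure_openin_pos) auto
  also have "\<dots> \<le> emeasure m K"
    using compactin_sets[OF assms(1)] by (intro emeasure_mono interior_of_subset)
  finally show ?thesis
    using emeasure_compactin_finite[OF assms(1)] by (simp add: measure_def enn2real_positive_iff)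
qed

lemma compact_nbhd:
  obtains U K where "openin T U" "compactin T K" "\<one> \<in> U" "U \<subseteq> K"
  using locally_compact unfolding locally_compact_space_def topspace_T by blast

lemma emeasure_compactin: "compactin T K \<Longrightarrow> emeasure m K = ennreal (measure m K)"
  using emeasure_compactin_finite by (simp add: emeasure_eq_ennreal_measure less_top)

lemma emeasure_disjoint_translates:
  assumes V: "V \<in> sets m" and F: "finite F" "F \<subseteq> carrier G"
    and disj: "separated V F"
  shows "V <#> F \<in> sets m" "emeasure m (V <#> F) = of_nat (card F) * emeasure m V"
proof -
  have eq: "V <#> F = (\<Union>z\<in>F. V #> z)"
    by (auto simp: set_mult_def r_coset_def)
  have sets: "V #> z \<in> sets m" if "z \<in> F" for z
    using that V F by (intro sets_r_coset) auto
  then show "V <#> F \<in> sets m"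
    unfolding eq using F(1) by (intro sets.finite_UN) auto
  have "disjoint_family_on (\<lambda>z. V #> z) F"
    unfolding disjoint_family_on_def r_coset_def using separatedD[OF disj] by fastforce
  then have "emeasure m (\<Union>z\<in>F. V #> z) = (\<Sum>z\<in>F. emeasure m (V #> z))"
    using sets F(1) by (intro sum_emeasure[symmetric]) auto
  also have "\<dots> = (\<Sum>z\<in>F. emeasure m V)"
    using V F by (intro sum.cong) (auto intro: emeasure_r_coset)
  finally show "emeasure m (V <#> F) = of_nat (card F) * emeasure m V"
    by (simp add: eq)
qed

lemma emeasure_translates_le:
  assumes V: "V \<in> sets m" and F: "finite F" "F \<subseteq> carrier G"
  shows "emeasure m (V <#> F) \<le> of_nat (card F) * emeasure m V"
proof -
  have eq: "V <#> F = (\<Union>z\<in>F. V #> z)"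
    by (auto simp: set_mult_def r_coset_def)
  have "emeasure m (\<Union>z\<in>F. V #> z) \<le> (\<Sum>z\<in>F. emeasure m (V #> z))"
    using V F by (intro emeasure_subadditive_finite) (auto intro: sets_r_coset)
  also have "\<dots> = (\<Sum>z\<in>F. emeasure m V)"
    using V F by (intro sum.cong) (auto intro: emeasure_r_coset)
  finally show ?thesis
    by (simp add: eq)
qed

lemma measure_thickening_close:
  assumes A: "compactin T A" and \<Lambda>: "\<Lambda> \<subseteq> carrier G" and C: "C <#> \<Lambda> = carrier G"
    and M: "compactin T M" "\<one> \<in> M" "C \<subseteq> M"
    and B: "C <#> (A \<inter> \<Lambda>) \<in> sets m"
  shows "\<bar>measure m (C <#> (A \<inter> \<Lambda>)) - measure m A\<bar> \<le> measure m (boundary M A)"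
proof -
  define B' where "B' = C <#> (A \<inter> \<Lambda>)"
  note tc = thickening_close[OF A \<Lambda> C M, folded B'_def]
  have fA: "A \<in> fmeasurable m" and fb: "boundary M A \<in> fmeasurable m"
    using A M compactin_K_boundary compactin_fmeasurable by auto
  have fB: "B' \<in> fmeasurable m"
    using compactin_fmeasurable[OF compactin_set_mult[OF M(1) A]] tc(1) B
    by (auto simp: B'_def intro: fmeasurableI2)
  have "measure m A \<le> measure m (B' \<union> boundary M A)"
    using tc(2) fA fB fb by (intro measure_mono_fmeasurable) auto
  also have "\<dots> \<le> measure m B' + measure m (boundary M A)"
    using fB fb by (intro measure_Un_le) auto
  finally have 1: "measure m A \<le> measure m B' + measure m (boundary M A)" .
  have "measure m B' \<le> measure m (A \<union> boundary M A)"
    using tc(3) fA fB fb by (intro measure_mono_fmeasurable) auto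
  also have "\<dots> \<le> measure m A + measure m (boundary M A)"
    using fA fb by (intro measure_Un_le) auto
  finally show ?thesis
    using 1 by (simp add: B'_def)
qed

text \<open>The translates \<open>V l\<close> with \<open>l \<in> B \<inter> \<Lambda>\<close> are disjoint, have the same measure and fit
  into \<open>V' B\<close>.\<close>

lemma packing_bound:
  assumes V: "openin T V" "V \<noteq> {}" "compactin T V'" "V \<subseteq> V'"
    and sep: "separated V \<Lambda>"
    and B: "compactin T B"
  shows "finite (B \<inter> \<Lambda>)" "real (card (B \<inter> \<Lambda>)) * measure m V \<le> measure m (V' <#> B)"
proof -
  have fV: "V \<in> fmeasurable m"
    using V compactin_fmeasurable openin_sets by (meson fmeasurableI2)
  have fVB: "V' <#> B \<in> fmeasurable m"
    using V B compactin_fmeasurable compactin_set_mult by blast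
  have bd: "real (card F) * measure m V \<le> measure m (V' <#> B)" if F: "finite F" "F \<subseteq> B \<inter> \<Lambda>" for F
  proof -
    have Fc: "F \<subseteq> carrier G"
      using F compactin_subset_carrier[OF B] by blast
    have "separated V F"
      using separated_subset[OF sep subset_refl] F(2) by simp
    note e = emeasure_disjoint_translates[OF openin_sets[OF V(1)] F(1) Fc this]
    have s: "V <#> F \<in> sets m" and em: "emeasure m (V <#> F) = of_nat (card F) * emeasure m V"
      by (rule e)+
    have "real (card F) * measure m V = measure m (V <#> F)"
      using em by (simp add: measure_def enn2real_mult)
    also have "\<dots> \<le> measure m (V' <#> B)"
      using V F s fVB by (intro measure_mono_fmeasurable set_mult_mono_both) auto
    finally show ?thesis .
  qed
  have pos: "0 < measure m V"
    using emeasure_openin_pos[OF V(1,2)] fV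
    by (simp add: measure_def enn2real_positive_iff fmeasurable_def)
  have "card F \<le> nat \<lfloor>measure m (V' <#> B) / measure m V\<rfloor>" if "F \<subseteq> B \<inter> \<Lambda>" "finite F" for F
    using bd[OF that(2,1)] pos by (simp add: le_nat_floor pos_le_divide_eq)
  then show fin: "finite (B \<inter> \<Lambda>)"
    using finite_if_finite_subsets_card_bdd by blast
  show "real (card (B \<inter> \<Lambda>)) * measure m V \<le> measure m (V' <#> B)"
    using bd[OF fin] by simp
qed

end

section \<open>Covering numbers of fibres\<close>

lemma ecard_finite: "finite F \<Longrightarrow> ecard F = of_nat (card F)"
  by (simp add: ecard_def)

lemma ecard_infinite: "infinite F \<Longrightarrow> ecard F = \<infinity>"
  by (simp add: ecard_def)

lemma ecard_image_le: "ecard (f ` F) \<le> ecard F"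
proof (cases "finite F")
  case True
  then show ?thesis
    by (simp add: ecard_finite card_image_le)
qed (simp add: ecard_infinite)

lemma one_le_ecard: "F \<noteq> {} \<Longrightarrow> 1 \<le> ecard F"
proof (cases "finite F")
  case True
  assume "F \<noteq> {}"
  then have "1 \<le> card F"
    using True by (simp add: Suc_le_eq card_gt_0_iff)
  then have "(of_nat 1 :: ennreal) \<le> of_nat (card F)"
    by (rule of_nat_mono)
  then show ?thesis
    using True by (simp add: ecard_finite)
qed (simp add: ecard_infinite)

text \<open>In HOL \<open>ln 0 = 0\<close>, so that the logarithm is monotone on \<open>{0} \<union> [1, \<infinity>]\<close> only; covering
  numbers are cardinalities and stay in this range.\<close>

lemma elog_mono:
  assumes "a \<le> b" "a = 0 \<or> 1 \<le> a"
  shows "elog a \<le> elog b"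
proof (cases "b = \<infinity> \<or> a = 0")
  case True
  then show ?thesis
    by (auto simp: elog_def)
next
  case False
  then have "a \<noteq> \<infinity>" "b < \<infinity>" "1 \<le> a"
    using assms by (auto simp: top_unique less_top)
  then have "1 \<le> enn2real a" "enn2real a \<le> enn2real b"
    using assms(1) enn2real_mono[of 1 a] enn2real_mono[of a b] by (auto simp: less_top)
  then show ?thesis
    using \<open>a \<noteq> \<infinity>\<close> False by (simp add: elog_def ennreal_leI)
qed

lemma elog_finite: "c < \<infinity> \<Longrightarrow> elog c < \<infinity>"
  by (simp add: elog_def)

lemma elog_mult_le:
  assumes "a = 0 \<or> 1 \<le> a" "b = 0 \<or> 1 \<le> b"
  shows "elog (a * b) \<le> elog a + elog b"
proof (cases "a = \<infinity> \<or> b = \<infinity> \<or> a = 0 \<or> b = 0")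
  case True
  then show ?thesis
    by (auto simp: elog_def)
next
  case False
  then have "1 \<le> enn2real a" "1 \<le> enn2real b" "a * b \<noteq> \<infinity>"
    using assms enn2real_mono[of 1 a] enn2real_mono[of 1 b]
    by (auto simp: less_top ennreal_mult_eq_top_iff)
  then have "elog (a * b) = ennreal (ln (enn2real a) + ln (enn2real b))"
    using assms by (simp add: elog_def enn2real_mult ln_mult)
  also have "\<dots> = ennreal (ln (enn2real a)) + ennreal (ln (enn2real b))"
    using \<open>1 \<le> enn2real a\<close> \<open>1 \<le> enn2real b\<close> by (intro ennreal_plus) auto
  finally show ?thesis
    using False by (simp add: elog_def)
qed

lemma dyn_dist_le_diameter:
  "x \<in> U \<Longrightarrow> y \<in> U \<Longrightarrow> dyn_dist d \<phi> A x y \<le> dyn_diameter d \<phi> A U"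
  unfolding dyn_diameter_def by (meson SUP_upper SUP_upper2)

lemma dyn_diameter_leI:
  assumes "\<And>x y g. x \<in> U \<Longrightarrow> y \<in> U \<Longrightarrow> g \<in> A \<Longrightarrow> ennreal (d (\<phi> g x) (\<phi> g y)) \<le> c"
  shows "dyn_diameter d \<phi> A U \<le> c"
  unfolding dyn_diameter_def dyn_dist_def by (intro SUP_least assms)

lemma dist_le_dyn_diameter:
  assumes "x \<in> U" "y \<in> U" "g \<in> A"
  shows "ennreal (d (\<phi> g x) (\<phi> g y)) \<le> dyn_diameter d \<phi> A U"
proof -
  have "ennreal (d (\<phi> g x) (\<phi> g y)) \<le> dyn_dist d \<phi> A x y"
    unfolding dyn_dist_def using assms(3) by (rule SUP_upper)
  also have "\<dots> \<le> dyn_diameter d \<phi> A U"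
    using assms(1,2) by (rule dyn_dist_le_diameter)
  finally show ?thesis .
qed

lemma dyn_diameter_mono: "A \<subseteq> B \<Longrightarrow> U \<subseteq> V \<Longrightarrow> dyn_diameter d \<phi> A U \<le> dyn_diameter d \<phi> B V"
  by (intro dyn_diameter_leI dist_le_dyn_diameter) auto

lemma dyn_diameter_Un_le:
  "dyn_diameter d \<phi> (A \<union> B) U \<le> max (dyn_diameter d \<phi> A U) (dyn_diameter d \<phi> B U)"
proof (rule dyn_diameter_leI)
  fix x y g assume "x \<in> U" "y \<in> U" "g \<in> A \<union> B"
  then show "ennreal (d (\<phi> g x) (\<phi> g y)) \<le> max (dyn_diameter d \<phi> A U) (dyn_diameter d \<phi> B U)"
    using dist_le_dyn_diameter[of x U y g A d \<phi>] dist_le_dyn_diameter[of x U y g B d \<phi>]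
    by (auto simp: le_max_iff_disj)
qed

definition small_cover ::
    "'x set \<Rightarrow> ('x \<Rightarrow> 'x \<Rightarrow> real) \<Rightarrow> ('g \<Rightarrow> 'x \<Rightarrow> 'x) \<Rightarrow> 'x set \<Rightarrow> 'g set \<Rightarrow> real \<Rightarrow> 'x set set \<Rightarrow> bool" where
  "small_cover X d \<phi> M A \<epsilon> \<U> \<longleftrightarrow>
     (\<forall>U\<in>\<U>. openin (Metric_space.mtopology X d) U \<and> dyn_diameter d \<phi> A U < ennreal \<epsilon>) \<and>
     M \<subseteq> \<Union>\<U>"

lemma cov_eq_INF_small_cover: "cov X d \<phi> M A \<epsilon> = (INF \<U>\<in>{\<U>. small_cover X d \<phi> M A \<epsilon> \<U>}. ecard \<U>)"
  by (simp add: cov_def small_cover_def)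

lemma cov_le: "small_cover X d \<phi> M A \<epsilon> \<U> \<Longrightarrow> cov X d \<phi> M A \<epsilon> \<le> ecard \<U>"
  unfolding cov_eq_INF_small_cover by (rule INF_lower) simp

lemma le_covI:
  "(\<And>\<U>. small_cover X d \<phi> M A \<epsilon> \<U> \<Longrightarrow> c \<le> ecard \<U>) \<Longrightarrow> c \<le> cov X d \<phi> M A \<epsilon>"
  unfolding cov_eq_INF_small_cover by (rule INF_greatest) simp

lemma one_le_cov: "M \<noteq> {} \<Longrightarrow> 1 \<le> cov X d \<phi> M A \<epsilon>"
  by (intro le_covI one_le_ecard) (auto simp: small_cover_def)

lemma small_cover_subset:
  "small_cover X d \<phi> M A \<epsilon> \<U> \<Longrightarrow> M' \<subseteq> M \<Longrightarrow> A' \<subseteq> A \<Longrightarrow> small_cover X d \<phi> M' A' \<epsilon> \<U>"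
  unfolding small_cover_def using dyn_diameter_mono[of A' A _ _ d \<phi>] le_less_trans by blast

text \<open>An infimum of cardinalities is attained. Products of covering numbers can then be compared
  through two optimal covers, with no case of infinite values to consider.\<close>

lemma cov_attained:
  assumes "small_cover X d \<phi> M A \<epsilon> \<U>" "finite \<U>"
  obtains \<V> where "small_cover X d \<phi> M A \<epsilon> \<V>" "finite \<V>" "cov X d \<phi> M A \<epsilon> = of_nat (card \<V>)"
proof -
  define P where "P n \<longleftrightarrow> (\<exists>\<V>. small_cover X d \<phi> M A \<epsilon> \<V> \<and> finite \<V> \<and> card \<V> = n)" for n
  have "P (card \<U>)"
    using assms by (auto simp: P_def)
  then have "P (LEAST n. P n)"
    by (rule LeastI)
  then obtain \<V> where \<V>: "small_cover X d \<phi> M A \<epsilon> \<V>" "finite \<V>" "card \<V> = (LEAST n. P n)"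
    by (auto simp: P_def)
  have "cov X d \<phi> M A \<epsilon> = of_nat (card \<V>)"
  proof (rule antisym)
    show "cov X d \<phi> M A \<epsilon> \<le> of_nat (card \<V>)"
      using cov_le[OF \<V>(1)] \<V>(2) by (simp add: ecard_finite)
    show "of_nat (card \<V>) \<le> cov X d \<phi> M A \<epsilon>"
    proof (rule le_covI)
      fix \<W> assume \<W>: "small_cover X d \<phi> M A \<epsilon> \<W>"
      show "of_nat (card \<V>) \<le> ecard \<W>"
      proof (cases "finite \<W>")
        case True
        then have "P (card \<W>)"
          using \<W> by (auto simp: P_def)
        then have "card \<V> \<le> card \<W>"
          unfolding \<V>(3) by (rule Least_le)
        then show ?thesis
          using True by (simp add: ecard_finite)
      qed (simp add: ecard_infinite)
    qed
  qed
  then show thesis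
    using that \<V> by blast
qed

text \<open>The intersections of the members of a cover that is small for \<open>A\<close> and one that is small for
  \<open>B\<close> are small for both.\<close>

lemma cov_Un_le:
  assumes "small_cover X d \<phi> M A \<epsilon> \<U>" "finite \<U>" "small_cover X d \<phi> M B \<epsilon> \<V>" "finite \<V>"
  shows "cov X d \<phi> M (A \<union> B) \<epsilon> \<le> cov X d \<phi> M A \<epsilon> * cov X d \<phi> M B \<epsilon>"
proof -
  obtain \<U>' where U: "small_cover X d \<phi> M A \<epsilon> \<U>'" "finite \<U>'" "cov X d \<phi> M A \<epsilon> = of_nat (card \<U>')"
    using cov_attained[OF assms(1,2)] .
  obtain \<V>' where V: "small_cover X d \<phi> M B \<epsilon> \<V>'" "finite \<V>'" "cov X d \<phi> M B \<epsilon> = of_nat (card \<V>')"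
    using cov_attained[OF assms(3,4)] .
  define \<W> where "\<W> = (\<lambda>(U, V). U \<inter> V) ` (\<U>' \<times> \<V>')"
  have "small_cover X d \<phi> M (A \<union> B) \<epsilon> \<W>"
    unfolding small_cover_def
  proof (intro conjI ballI)
    fix W assume "W \<in> \<W>"
    then obtain U V where UV: "U \<in> \<U>'" "V \<in> \<V>'" "W = U \<inter> V"
      by (auto simp: \<W>_def)
    show "openin (Metric_space.mtopology X d) W"
      using UV U(1) V(1) by (auto simp: small_cover_def)
    have "dyn_diameter d \<phi> (A \<union> B) W \<le> max (dyn_diameter d \<phi> A W) (dyn_diameter d \<phi> B W)"
      by (rule dyn_diameter_Un_le)
    also have "\<dots> \<le> max (dyn_diameter d \<phi> A U) (dyn_diameter d \<phi> B V)"
      unfolding UV(3) by (intro max.mono dyn_diameter_mono) auto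
    also have "\<dots> < ennreal \<epsilon>"
      using UV U(1) V(1) by (simp add: small_cover_def)
    finally show "dyn_diameter d \<phi> (A \<union> B) W < ennreal \<epsilon>" .
  next
    show "M \<subseteq> \<Union>\<W>"
      using U(1) V(1) unfolding small_cover_def \<W>_def by fastforce
  qed
  then have "cov X d \<phi> M (A \<union> B) \<epsilon> \<le> ecard \<W>"
    by (rule cov_le)
  also have "\<dots> \<le> ecard (\<U>' \<times> \<V>')"
    unfolding \<W>_def by (rule ecard_image_le)
  also have "\<dots> = cov X d \<phi> M A \<epsilon> * cov X d \<phi> M B \<epsilon>"
    using U V by (simp add: ecard_finite card_cartesian_product)
  finally show ?thesis .
qed

locale compact_factor_action = topological_group_on G T + Metric_space X d
  for G :: "('g, 'm) monoid_scheme" (structure) and T :: "'g topology" and X :: "'x set" and d +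
  fixes \<phi> :: "'g \<Rightarrow> 'x \<Rightarrow> 'x" and Y :: "'y topology" and \<psi> :: "'g \<Rightarrow> 'y \<Rightarrow> 'y" and p :: "'x \<Rightarrow> 'y"
  assumes compact_X: "compact_space mtopology"
    and action: "group_action_on G T mtopology \<phi>"
    and factor: "factor_map G mtopology \<phi> Y \<psi> p"
begin

lemma action_closed: "g \<in> carrier G \<Longrightarrow> x \<in> X \<Longrightarrow> \<phi> g x \<in> X"
proof -
  assume gx: "g \<in> carrier G" "x \<in> X"
  have "continuous_map (prod_topology T mtopology) mtopology (\<lambda>(g, x). \<phi> g x)"
    using action by (simp add: group_action_on_def)
  then have "(\<lambda>(g, x). \<phi> g x) ` (carrier G \<times> X) \<subseteq> X"
    using continuous_map_image_subset_topspace by (fastforce simp add: topspace_T)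
  moreover have "(\<lambda>(g, x). \<phi> g x) (g, x) \<in> (\<lambda>(g, x). \<phi> g x) ` (carrier G \<times> X)"
    using gx by (intro imageI) simp
  ultimately show ?thesis
    by (auto dest: subsetD)
qed

lemma action_mult: "g \<in> carrier G \<Longrightarrow> h \<in> carrier G \<Longrightarrow> x \<in> X \<Longrightarrow> \<phi> (g \<otimes> h) x = \<phi> g (\<phi> h x)"
  using action by (simp add: group_action_on_def)

lemma action_one: "x \<in> X \<Longrightarrow> \<phi> \<one> x = x"
  using action by (simp add: group_action_on_def)

lemma continuous_action_map:
  assumes "g \<in> carrier G"
  shows "continuous_map mtopology mtopology (\<phi> g)"
proof -
  have "continuous_map mtopology mtopology ((\<lambda>(g, x). \<phi> g x) \<circ> (\<lambda>x. (g, x)))"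
    by (rule continuous_map_compose[where X' = "prod_topology T mtopology"])
      (use assms action in \<open>auto simp: group_action_on_def continuous_map_pairwise topspace_T o_def\<close>)
  then show ?thesis
    by (simp add: o_def)
qed

text \<open>A Lebesgue number argument: \<open>K \<times> X\<close> is covered by finitely many sets \<open>W \<times> B(x, r)\<close> such
  that each \<open>\<phi>\<^sup>g\<close> with \<open>g \<in> W\<close> varies by less than \<open>\<epsilon>\<close> on the larger ball \<open>B(x, 2r)\<close>.\<close>

lemma equicontinuous_on_compact:
  assumes K: "compactin T K" and \<epsilon>: "0 < \<epsilon>"
  obtains \<epsilon>' where "0 < \<epsilon>'"
    "\<And>g x y. g \<in> K \<Longrightarrow> x \<in> X \<Longrightarrow> y \<in> X \<Longrightarrow> d x y < \<epsilon>' \<Longrightarrow> d (\<phi> g x) (\<phi> g y) < \<epsilon>"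
proof -
  define P where "P W x r \<longleftrightarrow> openin T W \<and> x \<in> X \<and> 0 < r \<and>
    (\<forall>g\<in>W. \<forall>y\<in>mball x (2 * r). \<forall>z\<in>mball x (2 * r). d (\<phi> g y) (\<phi> g z) < \<epsilon>)" for W x r
  define \<C> where "\<C> = {S. \<exists>W x r. P W x r \<and> S = W \<times> mball x r}"
  have "\<exists>S\<in>\<C>. gx \<in> S" if gx: "gx \<in> K \<times> X" for gx
  proof -
    obtain g x where g: "gx = (g, x)" "g \<in> carrier G" "x \<in> X"
      using gx compactin_subset_carrier[OF K] by (cases gx) auto
    define Q where "Q = {v \<in> topspace (prod_topology T mtopology). (\<lambda>(g, x). \<phi> g x) v \<in> mball (\<phi> g x) (\<epsilon> / 2)}"
    have "openin (prod_topology T mtopology) Q"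
      unfolding Q_def by (rule openin_continuous_map_preimage[where Y = mtopology])
        (use action in \<open>auto simp: group_action_on_def\<close>)
    moreover have "(g, x) \<in> Q"
      using g \<epsilon> action_closed by (simp add: Q_def topspace_T)
    ultimately have "\<exists>W B. openin T W \<and> openin mtopology B \<and> g \<in> W \<and> x \<in> B \<and> W \<times> B \<subseteq> Q"
      unfolding openin_prod_topology_alt by simp
    then obtain W B where W: "openin T W" "openin mtopology B" "g \<in> W" "x \<in> B" "W \<times> B \<subseteq> Q"
      by (elim exE conjE)
    obtain r where r: "0 < r" "mball x r \<subseteq> B"
      using W(2,4) unfolding openin_mtopology by blast
    have "d (\<phi> h y) (\<phi> h z) < \<epsilon>" if "h \<in> W" "y \<in> mball x (2 * (r / 2))" "z \<in> mball x (2 * (r / 2))" for h y z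
    proof -
      have "(h, y) \<in> Q" "(h, z) \<in> Q"
        using that r(2) W(5) by auto
      then have "\<phi> h y \<in> mball (\<phi> g x) (\<epsilon> / 2)" "\<phi> h z \<in> mball (\<phi> g x) (\<epsilon> / 2)"
        by (simp_all add: Q_def)
      then have "\<phi> h y \<in> X" "\<phi> h z \<in> X" "\<phi> g x \<in> X" "d (\<phi> g x) (\<phi> h y) < \<epsilon> / 2" "d (\<phi> g x) (\<phi> h z) < \<epsilon> / 2"
        by auto
      then show ?thesis
        using triangle''[of "\<phi> h y" "\<phi> g x" "\<phi> h z"] by linarith
    qed
    then have "P W x (r / 2)"
      using W(1) g(3) r(1) by (simp add: P_def)
    moreover have "gx \<in> W \<times> mball x (r / 2)"
      using g W(3) r(1) by simp
    ultimately show ?thesis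
      unfolding \<C>_def by auto
  qed
  then have "K \<times> X \<subseteq> \<Union>\<C>"
    by blast
  moreover have "\<forall>S\<in>\<C>. openin (prod_topology T mtopology) S"
    by (auto simp: \<C>_def P_def openin_prod_Times_iff)
  moreover have "compactin (prod_topology T mtopology) (K \<times> X)"
    using K compact_X by (simp add: compactin_Times compact_space_def)
  ultimately obtain \<F> where F: "finite \<F>" "\<F> \<subseteq> \<C>" "K \<times> X \<subseteq> \<Union>\<F>"
    unfolding compactin_def by meson
  have "\<forall>S\<in>\<F>. \<exists>W x r. P W x r \<and> S = W \<times> mball x r"
    using F(2) by (auto simp: \<C>_def)
  then obtain W c r where Wcr: "\<And>S. S \<in> \<F> \<Longrightarrow> P (W S) (c S) (r S)"
    "\<And>S. S \<in> \<F> \<Longrightarrow> S = W S \<times> mball (c S) (r S)"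
    by metis
  define \<epsilon>' where "\<epsilon>' = Min (insert 1 (r ` \<F>))"
  have "0 < \<epsilon>'"
    using F(1) Wcr(1) by (auto simp: \<epsilon>'_def P_def)
  moreover have "d (\<phi> g x) (\<phi> g y) < \<epsilon>" if g: "g \<in> K" "x \<in> X" "y \<in> X" "d x y < \<epsilon>'" for g x y
  proof -
    have "(g, x) \<in> \<Union>\<F>"
      using F(3) g by blast
    then obtain S where S: "S \<in> \<F>" "(g, x) \<in> S"
      by blast
    have "\<epsilon>' \<le> r S"
      using F(1) S(1) by (simp add: \<epsilon>'_def)
    have "(g, x) \<in> W S \<times> mball (c S) (r S)"
      using S(2) Wcr(2)[OF S(1)] by (rule back_subst)
    then have gx: "g \<in> W S" "x \<in> mball (c S) (r S)"
      by simp_all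
    have "0 < r S"
      using Wcr(1)[OF S(1)] by (simp add: P_def)
    with gx have "d (c S) y < 2 * r S" "d (c S) x < 2 * r S" "c S \<in> X"
      using triangle[of "c S" x y] g \<open>\<epsilon>' \<le> r S\<close> by auto
    then show ?thesis
      using Wcr(1)[OF S(1)] gx g by (simp add: P_def)
  qed
  ultimately show thesis
    by (rule that)
qed

text \<open>By equicontinuity over \<open>K\<close>, the scale \<open>\<epsilon>'\<close> depends on \<open>K\<close> and \<open>\<epsilon>\<close>, but not on \<open>F\<close>. The
  equicontinuity is used with \<open>\<epsilon> / 2\<close> because a supremum of distances below \<open>\<epsilon>\<close> may equal
  \<open>\<epsilon>\<close>.\<close>

lemma small_diameter_thickening:
  assumes K: "compactin T K" and \<epsilon>: "0 < \<epsilon>"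
  obtains \<epsilon>' where "0 < \<epsilon>'"
    "\<forall>F U. F \<subseteq> carrier G \<longrightarrow> U \<subseteq> X \<longrightarrow> dyn_diameter d \<phi> F U < ennreal \<epsilon>' \<longrightarrow>
       dyn_diameter d \<phi> (K <#> F) U < ennreal \<epsilon>"
proof -
  obtain \<epsilon>' where e: "0 < \<epsilon>'"
    "\<And>g x y. g \<in> K \<Longrightarrow> x \<in> X \<Longrightarrow> y \<in> X \<Longrightarrow> d x y < \<epsilon>' \<Longrightarrow> d (\<phi> g x) (\<phi> g y) < \<epsilon> / 2"
    using equicontinuous_on_compact[OF K, of "\<epsilon> / 2"] \<epsilon> by auto
  have Kc: "K \<subseteq> carrier G"
    by (rule compactin_subset_carrier[OF K])
  have "dyn_diameter d \<phi> (K <#> F) U < ennreal \<epsilon>"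
    if F: "F \<subseteq> carrier G" and U: "U \<subseteq> X" and dia: "dyn_diameter d \<phi> F U < ennreal \<epsilon>'" for F U
  proof -
    have "dyn_diameter d \<phi> (K <#> F) U \<le> ennreal (\<epsilon> / 2)"
    proof (rule dyn_diameter_leI)
      fix x y g assume xy: "x \<in> U" "y \<in> U" and "g \<in> K <#> F"
      then obtain k f where kf: "k \<in> K" "f \<in> F" "g = k \<otimes> f"
        by (rule_tac mem_set_multE)
      have c: "k \<in> carrier G" "f \<in> carrier G" "x \<in> X" "y \<in> X"
        using kf xy Kc F U by auto
      have "ennreal (d (\<phi> f x) (\<phi> f y)) < ennreal \<epsilon>'"
        using dist_le_dyn_diameter[OF xy kf(2)] dia by (rule le_less_trans)
      then have "d (\<phi> f x) (\<phi> f y) < \<epsilon>'"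
        by (simp add: ennreal_less_iff)
      then have "d (\<phi> k (\<phi> f x)) (\<phi> k (\<phi> f y)) < \<epsilon> / 2"
        using e(2) kf(1) action_closed c by simp
      then show "ennreal (d (\<phi> g x) (\<phi> g y)) \<le> ennreal (\<epsilon> / 2)"
        unfolding kf(3) using c by (simp add: action_mult ennreal_leI)
    qed
    also have "\<dots> < ennreal \<epsilon>"
      using \<epsilon> by (simp add: ennreal_less_iff)
    finally show ?thesis .
  qed
  then show thesis
    by (intro that[OF e(1)]) simp
qed

text \<open>Balls of radius \<open>\<epsilon>' / 3\<close> are small for \<open>{\<one>}\<close>, hence small for \<open>A = A {\<one>}\<close> by the
  passage to thickened sets.\<close>

lemma finite_small_cover:
  assumes A: "compactin T A" and \<epsilon>: "0 < \<epsilon>"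
  obtains \<U> where "finite \<U>" "small_cover X d \<phi> X A \<epsilon> \<U>"
proof -
  obtain \<epsilon>' where e: "0 < \<epsilon>'"
    "\<forall>F U. F \<subseteq> carrier G \<longrightarrow> U \<subseteq> X \<longrightarrow> dyn_diameter d \<phi> F U < ennreal \<epsilon>' \<longrightarrow>
       dyn_diameter d \<phi> (A <#> F) U < ennreal \<epsilon>"
    using small_diameter_thickening[OF A \<epsilon>] .
  define \<C> where "\<C> = (\<lambda>x. mball x (\<epsilon>' / 3)) ` X"
  have "compactin mtopology X"
    using compact_X by (simp add: compact_space_def)
  moreover have "X \<subseteq> \<Union>\<C>" "\<forall>U\<in>\<C>. openin mtopology U"
    using e(1) by (auto simp: \<C>_def)
  ultimately obtain \<F> where F: "finite \<F>" "\<F> \<subseteq> \<C>" "X \<subseteq> \<Union>\<F>"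
    unfolding compactin_def by meson
  have Ac: "A <#> {\<one>} = A"
    using compactin_subset_carrier[OF A] by (simp add: set_mult_def subset_iff)
  have "dyn_diameter d \<phi> A U < ennreal \<epsilon>" if U: "U \<in> \<F>" for U
  proof -
    obtain c where c: "c \<in> X" "U = mball c (\<epsilon>' / 3)"
      using subsetD[OF F(2) U] unfolding \<C>_def by (rule imageE)
    have UX: "U \<subseteq> X"
      unfolding c(2) by (rule mball_subset_mspace)
    have "dyn_diameter d \<phi> {\<one>} U \<le> ennreal (2 * \<epsilon>' / 3)"
    proof (rule dyn_diameter_leI)
      fix x y g assume xyg: "x \<in> U" "y \<in> U" "g \<in> {\<one>}"
      then have xy: "x \<in> X" "y \<in> X" "d c x < \<epsilon>' / 3" "d c y < \<epsilon>' / 3"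
        using c by auto
      then have "d x y \<le> 2 * \<epsilon>' / 3"
        using triangle''[of x c y] c(1) by linarith
      then show "ennreal (d (\<phi> g x) (\<phi> g y)) \<le> ennreal (2 * \<epsilon>' / 3)"
        using xyg(3) xy by (simp add: action_one ennreal_leI)
    qed
    also have "\<dots> < ennreal \<epsilon>'"
      using e(1) by (simp add: ennreal_less_iff)
    finally show ?thesis
      using e(2)[rule_format, of "{\<one>}" U] UX Ac by simp
  qed
  moreover have "\<forall>U\<in>\<F>. openin mtopology U"
    using F(2) by (auto simp: \<C>_def)
  ultimately have "small_cover X d \<phi> X A \<epsilon> \<F>"
    using F(3) by (simp add: small_cover_def)
  with F(1) show thesis
    by (rule that)
qed

abbreviation fibre :: "'y \<Rightarrow> 'x set" where
  "fibre y \<equiv> {x \<in> X. p x = y}"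

abbreviation fibre_cov :: "'g set \<Rightarrow> real \<Rightarrow> ennreal" where
  "fibre_cov A \<epsilon> \<equiv> (SUP y\<in>topspace Y. cov X d \<phi> (fibre y) A \<epsilon>)"

abbreviation log_cov :: "'g set \<Rightarrow> real \<Rightarrow> ennreal" where
  "log_cov A \<epsilon> \<equiv> log_fibre_cov X d \<phi> Y p A \<epsilon>"

lemma fibre_nonempty:
  assumes "y \<in> topspace Y"
  shows "fibre y \<noteq> {}"
proof -
  have "y \<in> p ` X"
    using factor assms by (simp add: factor_map_def)
  then obtain x where "x \<in> X" "y = p x"
    by (rule imageE)
  then show ?thesis
    by auto
qed

lemma one_le_fibre_cov: "y \<in> topspace Y \<Longrightarrow> 1 \<le> fibre_cov A \<epsilon>"
  by (rule SUP_upper2, assumption, rule one_le_cov, rule fibre_nonempty)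

text \<open>The value \<open>0\<close> is the supremum over no fibres at all, for empty \<open>X\<close>.\<close>

lemma fibre_cov_range: "fibre_cov A \<epsilon> = 0 \<or> 1 \<le> fibre_cov A \<epsilon>"
proof (cases "topspace Y = {}")
  case True
  then show ?thesis
    by (simp add: bot_ennreal)
next
  case False
  then obtain y where "y \<in> topspace Y"
    by (meson equals0I)
  then show ?thesis
    using one_le_fibre_cov[of y A \<epsilon>] by simp
qed

lemma log_fibre_cov_le:
  assumes "\<And>y. y \<in> topspace Y \<Longrightarrow> \<exists>z\<in>topspace Y. cov X d \<phi> (fibre y) A \<epsilon> \<le> cov X d \<phi> (fibre z) B \<epsilon>'"
  shows "log_cov A \<epsilon> \<le> log_cov B \<epsilon>'"
  unfolding log_fibre_cov_def by (intro elog_mono fibre_cov_range SUP_mono assms)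

lemma log_fibre_cov_mono: "A \<subseteq> B \<Longrightarrow> log_cov A \<epsilon> \<le> log_cov B \<epsilon>"
  by (intro log_fibre_cov_le bexI le_covI cov_le) (auto intro: small_cover_subset)

lemma log_fibre_cov_empty:
  assumes "0 < \<epsilon>"
  shows "log_cov {} \<epsilon> = 0"
proof -
  have "small_cover X d \<phi> (fibre y) {} \<epsilon> {X}" for y
    using assms by (auto simp: small_cover_def dyn_diameter_def dyn_dist_def bot_ennreal SUP_constant)
  then have "cov X d \<phi> (fibre y) {} \<epsilon> \<le> ecard {X}" for y
    by (rule cov_le)
  then have "fibre_cov {} \<epsilon> \<le> ecard {X}"
    by (intro SUP_least)
  then have "log_cov {} \<epsilon> \<le> elog 1"
    unfolding log_fibre_cov_def by (intro elog_mono fibre_cov_range) (simp add: ecard_finite)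
  then show ?thesis
    by (simp add: elog_def)
qed

lemma log_fibre_cov_finite:
  assumes A: "compactin T A" and \<epsilon>: "0 < \<epsilon>"
  shows "log_cov A \<epsilon> < \<infinity>"
proof -
  obtain \<U> where \<U>: "finite \<U>" "small_cover X d \<phi> X A \<epsilon> \<U>"
    using finite_small_cover[OF A \<epsilon>] .
  have "cov X d \<phi> (fibre y) A \<epsilon> \<le> ecard \<U>" for y
    using \<U>(2) by (intro cov_le small_cover_subset[OF \<U>(2)]) auto
  then have "fibre_cov A \<epsilon> \<le> ecard \<U>"
    by (intro SUP_least)
  also have "\<dots> < \<infinity>"
    using \<U>(1) by (simp add: ecard_finite of_nat_less_top)
  finally show ?thesis
    unfolding log_fibre_cov_def by (rule elog_finite)
qed

lemma log_fibre_cov_Un_le: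
  assumes A: "compactin T A" and B: "compactin T B" and \<epsilon>: "0 < \<epsilon>"
  shows "log_cov (A \<union> B) \<epsilon> \<le> log_cov A \<epsilon> + log_cov B \<epsilon>"
proof -
  obtain \<U> where \<U>: "finite \<U>" "small_cover X d \<phi> X A \<epsilon> \<U>"
    using finite_small_cover[OF A \<epsilon>] .
  obtain \<V> where \<V>: "finite \<V>" "small_cover X d \<phi> X B \<epsilon> \<V>"
    using finite_small_cover[OF B \<epsilon>] .
  have "cov X d \<phi> (fibre y) (A \<union> B) \<epsilon> \<le> fibre_cov A \<epsilon> * fibre_cov B \<epsilon>" if y: "y \<in> topspace Y" for y
  proof -
    have "fibre y \<subseteq> X"
      by auto
    then have "cov X d \<phi> (fibre y) (A \<union> B) \<epsilon> \<le> cov X d \<phi> (fibre y) A \<epsilon> * cov X d \<phi> (fibre y) B \<epsilon>"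
      by (intro cov_Un_le[where \<U> = \<U> and \<V> = \<V>] small_cover_subset[OF \<U>(2)]
          small_cover_subset[OF \<V>(2)] \<U>(1) \<V>(1)) auto
    also have "\<dots> \<le> fibre_cov A \<epsilon> * fibre_cov B \<epsilon>"
      using y by (intro mult_mono SUP_upper) auto
    finally show ?thesis .
  qed
  then have "fibre_cov (A \<union> B) \<epsilon> \<le> fibre_cov A \<epsilon> * fibre_cov B \<epsilon>"
    by (rule SUP_least)
  then have "log_cov (A \<union> B) \<epsilon> \<le> elog (fibre_cov A \<epsilon> * fibre_cov B \<epsilon>)"
    unfolding log_fibre_cov_def by (intro elog_mono fibre_cov_range)
  also have "\<dots> \<le> log_cov A \<epsilon> + log_cov B \<epsilon>"
    unfolding log_fibre_cov_def by (intro elog_mult_le fibre_cov_range)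
  finally show ?thesis .
qed

text \<open>Since \<open>d(\<phi>\<^sup>a\<^sup>g x, \<phi>\<^sup>a\<^sup>g x')\<close> is the distance of \<open>\<phi>\<^sup>g x\<close> and \<open>\<phi>\<^sup>g x'\<close> at time \<open>a\<close>, preimages
  under \<open>\<phi>\<^sup>g\<close> turn a cover of the fibre over \<open>\<psi>\<^sup>g y\<close> that is small for \<open>A\<close> into a cover of the
  fibre over \<open>y\<close> that is small for \<open>A g\<close>. The supremum over all fibres absorbs the change of
  the base point.\<close>

lemma log_fibre_cov_r_coset_le:
  assumes A: "A \<subseteq> carrier G" and g: "g \<in> carrier G"
  shows "log_cov (A #> g) \<epsilon> \<le> log_cov A \<epsilon>"
proof (rule log_fibre_cov_le)
  fix y assume y: "y \<in> topspace Y"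
  then obtain x0 where x0: "x0 \<in> X" "p x0 = y"
    using fibre_nonempty[of y] by auto
  have px: "p (\<phi> g x) = \<psi> g (p x)" if "x \<in> X" for x
    using factor that g by (simp add: factor_map_def)
  have "\<phi> g x0 \<in> X"
    using action_closed g x0 by simp
  then have "p (\<phi> g x0) \<in> topspace Y"
    using factor unfolding factor_map_def by (metis imageI topspace_mtopology)
  then have z: "\<psi> g y \<in> topspace Y"
    using px x0 by simp
  have "cov X d \<phi> (fibre y) (A #> g) \<epsilon> \<le> cov X d \<phi> (fibre (\<psi> g y)) A \<epsilon>"
  proof (rule le_covI)
    fix \<U> assume \<U>: "small_cover X d \<phi> (fibre (\<psi> g y)) A \<epsilon> \<U>"
    define pre where "pre U = {x \<in> topspace mtopology. \<phi> g x \<in> U}" for U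
    have "small_cover X d \<phi> (fibre y) (A #> g) \<epsilon> (pre ` \<U>)"
      unfolding small_cover_def
    proof (intro conjI ballI)
      fix W assume "W \<in> pre ` \<U>"
      then obtain U where U: "U \<in> \<U>" "W = pre U"
        by (elim imageE) simp
      show "openin mtopology W"
        using \<U> U unfolding small_cover_def U(2) pre_def
        by (intro openin_continuous_map_preimage[OF continuous_action_map[OF g]]) simp
      have "dyn_diameter d \<phi> (A #> g) W \<le> dyn_diameter d \<phi> A U"
      proof (rule dyn_diameter_leI)
        fix x x' h assume x: "x \<in> W" "x' \<in> W" and "h \<in> A #> g"
        then obtain a where a: "a \<in> A" "h = a \<otimes> g"
          unfolding r_coset_def by (elim UN_E) simp
        have ac: "a \<in> carrier G"
          using A a(1) by (rule subsetD)
        have xX: "x \<in> X" "x' \<in> X" "\<phi> g x \<in> U" "\<phi> g x' \<in> U"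
          using x by (simp_all add: U(2) pre_def)
        have "ennreal (d (\<phi> a (\<phi> g x)) (\<phi> a (\<phi> g x'))) \<le> dyn_diameter d \<phi> A U"
          using xX a(1) by (intro dist_le_dyn_diameter)
        then show "ennreal (d (\<phi> h x) (\<phi> h x')) \<le> dyn_diameter d \<phi> A U"
          using xX ac g by (simp add: a(2) action_mult)
      qed
      also have "\<dots> < ennreal \<epsilon>"
        using \<U> U by (simp add: small_cover_def)
      finally show "dyn_diameter d \<phi> (A #> g) W < ennreal \<epsilon>" .
    next
      show "fibre y \<subseteq> \<Union> (pre ` \<U>)"
      proof
        fix x assume x: "x \<in> fibre y"
        then have "\<phi> g x \<in> fibre (\<psi> g y)"
          using action_closed[OF g] px by simp
        then have "\<phi> g x \<in> \<Union>\<U>"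
          using \<U> unfolding small_cover_def by (elim conjE) (rule subsetD)
        then obtain U where "U \<in> \<U>" "\<phi> g x \<in> U"
          by (rule UnionE)
        then have "x \<in> pre U"
          using x by (simp add: pre_def)
        then show "x \<in> \<Union> (pre ` \<U>)"
          using \<open>U \<in> \<U>\<close> by (rule_tac UN_I)
      qed
    qed
    then have "cov X d \<phi> (fibre y) (A #> g) \<epsilon> \<le> ecard (pre ` \<U>)"
      by (rule cov_le)
    also have "\<dots> \<le> ecard \<U>"
      by (rule ecard_image_le)
    finally show "cov X d \<phi> (fibre y) (A #> g) \<epsilon> \<le> ecard \<U>" .
  qed
  then show "\<exists>z\<in>topspace Y. cov X d \<phi> (fibre y) (A #> g) \<epsilon> \<le> cov X d \<phi> (fibre z) A \<epsilon>"
    using z by (rule bexI)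
qed

lemma log_fibre_cov_r_coset:
  assumes A: "A \<subseteq> carrier G" and g: "g \<in> carrier G"
  shows "log_cov (A #> g) \<epsilon> = log_cov A \<epsilon>"
proof (rule antisym)
  show "log_cov (A #> g) \<epsilon> \<le> log_cov A \<epsilon>"
    by (rule log_fibre_cov_r_coset_le[OF A g])
  have "A #> g #> inv g = A"
    using A g by (simp add: coset_mult_assoc coset_mult_one)
  then show "log_cov A \<epsilon> \<le> log_cov (A #> g) \<epsilon>"
    using log_fibre_cov_r_coset_le[OF r_coset_subset_G[OF A g], of "inv g" \<epsilon>] g by simp
qed

text \<open>The lower bound for the entropy of samples rests on this inequality: at the price of a finer
  scale, which is the same for all \<open>F\<close>, the thickening by \<open>K\<close> may be dropped.\<close>

lemma log_fibre_cov_thickening: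
  assumes K: "compactin T K" and \<epsilon>: "0 < \<epsilon>"
  obtains \<epsilon>' where "0 < \<epsilon>'" "\<forall>F. F \<subseteq> carrier G \<longrightarrow> log_cov (K <#> F) \<epsilon> \<le> log_cov F \<epsilon>'"
proof -
  obtain \<epsilon>' where e: "0 < \<epsilon>'"
    "\<forall>F U. F \<subseteq> carrier G \<longrightarrow> U \<subseteq> X \<longrightarrow> dyn_diameter d \<phi> F U < ennreal \<epsilon>' \<longrightarrow>
       dyn_diameter d \<phi> (K <#> F) U < ennreal \<epsilon>"
    using small_diameter_thickening[OF K \<epsilon>] .
  have "log_cov (K <#> F) \<epsilon> \<le> log_cov F \<epsilon>'" if F: "F \<subseteq> carrier G" for F
  proof (intro log_fibre_cov_le bexI le_covI cov_le)
    fix y \<U> assume \<U>: "small_cover X d \<phi> (fibre y) F \<epsilon>' \<U>"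
    then have "U \<subseteq> X" if "U \<in> \<U>" for U
      using that openin_subset[of mtopology U] by (simp add: small_cover_def)
    then show "small_cover X d \<phi> (fibre y) (K <#> F) \<epsilon> \<U>"
      using \<U> e(2)[rule_format, OF F] by (simp add: small_cover_def)
  qed
  then show thesis
    by (intro that[OF e(1)]) simp
qed

end

section \<open>Limits along Van Hove nets\<close>

lemma net_filter_nontrivial:
  assumes "directed_set I r"
  shows "net_filter I r \<noteq> bot"
proof -
  have "(j, j) \<in> r" if "j \<in> I" for j
    using assms that
    by (auto simp: directed_set_def partial_order_on_def preorder_on_def refl_on_def)
  then have "\<not> eventually (\<lambda>_. False) (net_filter I r)"
    unfolding eventually_net_filter[OF assms] by blast
  then show ?thesis
    by (simp add: trivial_limit_def)
qed

lemma eventually_mem_net: "directed_set I r \<Longrightarrow> eventually (\<lambda>i. i \<in> I) (net_filter I r)"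
  unfolding eventually_net_filter by (auto simp: directed_set_def)

lemma van_hove_net_nontrivial: "van_hove_net G T m I r A \<Longrightarrow> net_filter I r \<noteq> bot"
  by (intro net_filter_nontrivial) (simp add: van_hove_net_def)

lemma van_hove_limit_unique:
  fixes F :: "'g set \<Rightarrow> ennreal"
  assumes A: "van_hove_net G T m I r (A :: 'g set net_index \<Rightarrow> 'g set)"
    and lim: "\<And>I r (A :: 'g set net_index \<Rightarrow> 'g set). van_hove_net G T m I r A \<Longrightarrow>
      ((\<lambda>i. F (A i)) \<longlongrightarrow> L) (net_filter I r)"
  shows "(THE L. \<forall>I r (A :: 'g set net_index \<Rightarrow> 'g set). van_hove_net G T m I r A \<longrightarrow>
      ((\<lambda>i. F (A i)) \<longlongrightarrow> L) (net_filter I r)) = L"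
proof (rule the_equality)
  show "\<forall>I r (A :: 'g set net_index \<Rightarrow> 'g set). van_hove_net G T m I r A \<longrightarrow>
      ((\<lambda>i. F (A i)) \<longlongrightarrow> L) (net_filter I r)"
    using lim by simp
  fix L' assume L': "\<forall>I r (A :: 'g set net_index \<Rightarrow> 'g set). van_hove_net G T m I r A \<longrightarrow>
      ((\<lambda>i. F (A i)) \<longlongrightarrow> L') (net_filter I r)"
  have "net_filter I r \<noteq> bot"
    by (rule van_hove_net_nontrivial[OF A])
  then show "L' = L"
    using L'[rule_format, OF A] lim[OF A] by (rule tendsto_unique)
qed

text \<open>Statements about all nets over the fixed index type hold for nets over any index type.\<close>

lemma van_hove_limit_any_index:
  fixes F :: "'g set \<Rightarrow> 'b::topological_space" and A :: "'i \<Rightarrow> 'g set"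
  assumes A: "van_hove_net G T m I r A"
    and lim: "\<And>I r (A :: 'g set net_index \<Rightarrow> 'g set). van_hove_net G T m I r A \<Longrightarrow>
      ((\<lambda>i. F (A i)) \<longlongrightarrow> L) (net_filter I r)"
  shows "((\<lambda>i. F (A i)) \<longlongrightarrow> L) (net_filter I r)"
proof (rule van_hove_net_reindex[OF A])
  fix J s and B :: "'g set net_index \<Rightarrow> 'g set"
  assume B: "van_hove_net G T m J s B"
    and eq: "\<And>f (F :: 'b filter). filterlim (\<lambda>j. f (B j)) F (net_filter J s) \<longleftrightarrow>
            filterlim (\<lambda>i. f (A i)) F (net_filter I r)"
  show ?thesis
    using lim[OF B] eq by simp
qed

text \<open>Quotients in \<open>[0, \<infinity>]\<close> with finite entries and positive denominators are quotients of real
  numbers. This lemma and the next one move limits between the two, so that all estimates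
  can be done with real numbers.\<close>

lemma tendsto_ennreal_ratio:
  fixes b a :: "'i \<Rightarrow> real"
  assumes "((\<lambda>i. b i / a i) \<longlongrightarrow> L) F" "eventually (\<lambda>i. u i = ennreal (b i) \<and> v i = ennreal (a i) \<and> 0 \<le> b i \<and> 0 < a i) F"
  shows "((\<lambda>i. u i / v i) \<longlongrightarrow> ennreal L) F"
proof -
  have "((\<lambda>i. ennreal (b i / a i)) \<longlongrightarrow> ennreal L) F"
    using assms(1) by (rule tendsto_ennrealI)
  moreover have "eventually (\<lambda>i. ennreal (b i / a i) = u i / v i) F"
    using assms(2) by eventually_elim (simp add: divide_ennreal)
  ultimately show ?thesis
    by (rule Lim_transform_eventually)
qed

lemma tendsto_real_ratio:
  fixes b a :: "'i \<Rightarrow> real"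
  assumes "((\<lambda>i. u i / v i) \<longlongrightarrow> ennreal L) F" "0 \<le> L"
    "eventually (\<lambda>i. u i = ennreal (b i) \<and> v i = ennreal (a i) \<and> 0 \<le> b i \<and> 0 < a i) F"
  shows "((\<lambda>i. b i / a i) \<longlongrightarrow> L) F"
proof -
  have "eventually (\<lambda>i. u i / v i = ennreal (b i / a i)) F"
    using assms(3) by eventually_elim (simp add: divide_ennreal)
  then have "((\<lambda>i. ennreal (b i / a i)) \<longlongrightarrow> ennreal L) F"
    using assms(1) by (rule Lim_transform_eventually[rotated])
  moreover have "eventually (\<lambda>i. 0 \<le> b i / a i) F"
    using assms(3) by eventually_elim simp
  ultimately show ?thesis
    using assms(2) by (simp add: tendsto_ennreal_iff)
qed

context haar_group
begin

lemma van_hove_net_compactin: "van_hove_net G T m I r A \<Longrightarrow> i \<in> I \<Longrightarrow> compactin T (A i)"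
  by (simp add: van_hove_net_def)

lemma van_hove_eventually:
  assumes "van_hove_net G T m I r A"
  shows "eventually (\<lambda>i. compactin T (A i) \<and> 0 < measure m (A i)) (net_filter I r)"
proof -
  have dir: "directed_set I r"
    using assms by (simp add: van_hove_net_def)
  have "eventually (\<lambda>i. T interior_of (A i) \<noteq> {}) (net_filter I r)"
    using assms unfolding eventually_net_filter[OF dir] by (simp add: van_hove_net_def)
  with eventually_mem_net[OF dir] show ?thesis
    by eventually_elim (simp add: van_hove_net_compactin[OF assms] measure_interior_pos)
qed

lemma van_hove_boundary_tendsto:
  assumes A: "van_hove_net G T m I r A" and K: "compactin T K"
  shows "((\<lambda>i. measure m (boundary K (A i)) / measure m (A i)) \<longlongrightarrow> 0) (net_filter I r)"
proof (rule tendsto_real_ratio)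
  show "((\<lambda>i. emeasure m (boundary K (A i)) / emeasure m (A i)) \<longlongrightarrow> ennreal 0) (net_filter I r)"
    using A K by (simp add: van_hove_net_def)
qed (simp, use van_hove_eventually[OF A] in
    \<open>eventually_elim, simp add: emeasure_compactin compactin_K_boundary[OF K]\<close>)

lemma van_hove_netI:
  assumes dir: "directed_set I r" and comp: "\<And>i. i \<in> I \<Longrightarrow> compactin T (A i)"
    and int: "eventually (\<lambda>i. T interior_of (A i) \<noteq> {}) (net_filter I r)"
    and lim: "\<And>K. compactin T K \<Longrightarrow>
      ((\<lambda>i. measure m (boundary K (A i)) / measure m (A i)) \<longlongrightarrow> 0) (net_filter I r)"
  shows "van_hove_net G T m I r A"
  unfolding van_hove_net_def
proof (intro conjI ballI allI impI)
  show "directed_set I r" by (rule dir)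
  show "compactin T (A i)" if "i \<in> I" for i
    by (rule comp[OF that])
  show "\<exists>j\<in>I. \<forall>i\<in>I. (j, i) \<in> r \<longrightarrow> T interior_of A i \<noteq> {}"
    using int unfolding eventually_net_filter[OF dir] .
  fix K assume K: "compactin T K"
  have "((\<lambda>i. emeasure m (boundary K (A i)) / emeasure m (A i)) \<longlongrightarrow> ennreal 0) (net_filter I r)"
    by (rule tendsto_ennreal_ratio[OF lim[OF K]]) (use int eventually_mem_net[OF dir] in
      \<open>eventually_elim, simp add: emeasure_compactin compactin_K_boundary[OF K] comp measure_interior_pos\<close>)
  then show "((\<lambda>i. emeasure m (boundary K (A i)) / emeasure m (A i)) \<longlongrightarrow> 0) (net_filter I r)"
    by simp
qed

text \<open>By \<open>measure_thickening_close\<close>, the difference of the measures is at most that of a boundary.\<close>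

lemma thickening_measure_tendsto:
  assumes A: "van_hove_net G T m I r A"
    and \<Lambda>: "\<Lambda> \<subseteq> carrier G" and C: "C <#> \<Lambda> = carrier G"
    and M: "compactin T M" "\<one> \<in> M" "C \<subseteq> M"
    and sets: "eventually (\<lambda>i. C <#> (A i \<inter> \<Lambda>) \<in> sets m) (net_filter I r)"
  shows "((\<lambda>i. measure m (C <#> (A i \<inter> \<Lambda>)) / measure m (A i)) \<longlongrightarrow> 1) (net_filter I r)"
proof -
  let ?B = "\<lambda>i. C <#> (A i \<inter> \<Lambda>)"
  have "((\<lambda>i. measure m (?B i) / measure m (A i) - 1) \<longlongrightarrow> 0) (net_filter I r)"
  proof (rule Lim_null_comparison[OF _ van_hove_boundary_tendsto[OF A M(1)]])
    show "eventually (\<lambda>i. norm (measure m (?B i) / measure m (A i) - 1) \<le>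
        measure m (boundary M (A i)) / measure m (A i)) (net_filter I r)"
      using sets van_hove_eventually[OF A]
    proof eventually_elim
      case (elim i)
      then have "measure m (?B i) / measure m (A i) - 1 =
          (measure m (?B i) - measure m (A i)) / measure m (A i)"
        by (simp add: field_simps)
      moreover have "\<bar>measure m (?B i) - measure m (A i)\<bar> \<le> measure m (boundary M (A i))"
        using elim by (intro measure_thickening_close[OF _ \<Lambda> C M]) simp_all
      ultimately show ?case
        using elim by (simp add: divide_right_mono)
    qed
  qed
  then show ?thesis
    by (simp add: LIM_zero_iff)
qed

lemma compactin_thickening:
  assumes "compactin T K" "finite F" "F \<subseteq> carrier G"
  shows "compactin T (K <#> F)"
  by (rule compactin_set_mult[OF assms(1)], rule finite_imp_compactin)
    (use assms in \<open>simp_all add: topspace_T\<close>)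

text \<open>The default \<open>A i\<close> for infinite samples only serves to keep every member of the net compact; the
  samples are eventually finite. The interior of \<open>B i\<close> is not empty, as it contains a translate
  of \<open>U\<close> as soon as the sample is not empty, which the asymptotics of the measure ensure.\<close>

lemma van_hove_thickening:
  assumes A: "van_hove_net G T m I r A"
    and \<Lambda>: "\<Lambda> \<subseteq> carrier G" and KG: "K <#> \<Lambda> = carrier G"
    and K: "compactin T K" and U: "openin T U" "U \<noteq> {}" "U \<subseteq> K"
    and fin: "eventually (\<lambda>i. finite (A i \<inter> \<Lambda>)) (net_filter I r)"
  defines "B \<equiv> \<lambda>i. if finite (A i \<inter> \<Lambda>) then K <#> (A i \<inter> \<Lambda>) else A i"
  shows "van_hove_net G T m I r B"
    and "((\<lambda>i. measure m (B i) / measure m (A i)) \<longlongrightarrow> 1) (net_filter I r)"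
proof -
  define M where "M = insert \<one> K"
  have M: "compactin T M" "\<one> \<in> M" "K \<subseteq> M"
    using compactin_Un[OF finite_imp_compactin[of "{\<one>}" T] K] by (auto simp: M_def topspace_T)
  have Mc: "M \<subseteq> carrier G"
    by (rule compactin_subset_carrier[OF M(1)])
  have dir: "directed_set I r"
    using A by (simp add: van_hove_net_def)
  have Fc: "A i \<inter> \<Lambda> \<subseteq> carrier G" for i
    using \<Lambda> by (rule le_infI2)
  have compB: "compactin T (B i)" if "i \<in> I" for i
    using that by (simp add: B_def compactin_thickening[OF K _ Fc] van_hove_net_compactin[OF A])
  have "eventually (\<lambda>i. K <#> (A i \<inter> \<Lambda>) \<in> sets m) (net_filter I r)"
    using fin by eventually_elim (simp add: compactin_sets compactin_thickening[OF K _ Fc])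
  from thickening_measure_tendsto[OF A \<Lambda> KG M this]
  show ratio: "((\<lambda>i. measure m (B i) / measure m (A i)) \<longlongrightarrow> 1) (net_filter I r)"
    by (rule Lim_transform_eventually) (use fin in \<open>eventually_elim, simp add: B_def\<close>)
  have pos: "eventually (\<lambda>i. 0 < measure m (B i) / measure m (A i)) (net_filter I r)"
    using ratio by (rule order_tendstoD) simp
  show "van_hove_net G T m I r B"
  proof (rule van_hove_netI[OF dir compB])
    show "eventually (\<lambda>i. T interior_of (B i) \<noteq> {}) (net_filter I r)"
      using pos fin
    proof eventually_elim
      case (elim i)
      then have BF: "B i = K <#> (A i \<inter> \<Lambda>)"
        by (simp add: B_def)
      have "B i \<noteq> {}"
        using elim by auto
      then obtain l where l: "l \<in> A i \<inter> \<Lambda>"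
        unfolding BF set_mult_def by auto
      then have lc: "l \<in> carrier G"
        using subsetD[OF Fc] by simp
      have "U #> l \<subseteq> B i"
        unfolding BF r_coset_def set_mult_def using U(3) l by auto
      then have "U #> l \<subseteq> T interior_of (B i)"
        using openin_r_coset[OF lc U(1)] by (rule interior_of_maximal)
      moreover have "U #> l \<noteq> {}"
        using U(2) by (simp add: r_coset_def)
      ultimately show ?case
        by auto
    qed
    fix L assume L: "compactin T L"
    have LM: "compactin T (L <#> M)"
      using L M(1) by (rule compactin_set_mult)
    show "((\<lambda>i. measure m (boundary L (B i)) / measure m (B i)) \<longlongrightarrow> 0) (net_filter I r)"
    proof (rule Lim_null_comparison)
      have "((\<lambda>i. measure m (boundary (L <#> M) (A i)) / measure m (A i) /
          (measure m (B i) / measure m (A i))) \<longlongrightarrow> 0 / 1) (net_filter I r)"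
        by (intro tendsto_divide van_hove_boundary_tendsto[OF A LM] ratio) simp
      then show "((\<lambda>i. measure m (boundary (L <#> M) (A i)) / measure m (A i) /
          (measure m (B i) / measure m (A i))) \<longlongrightarrow> 0) (net_filter I r)"
        by simp
      show "eventually (\<lambda>i. norm (measure m (boundary L (B i)) / measure m (B i)) \<le>
          measure m (boundary (L <#> M) (A i)) / measure m (A i) /
          (measure m (B i) / measure m (A i))) (net_filter I r)"
        using pos fin van_hove_eventually[OF A] eventually_mem_net[OF dir]
      proof eventually_elim
        case (elim i)
        then have BF: "B i = K <#> (A i \<inter> \<Lambda>)" and Ai: "compactin T (A i)"
          by (simp_all add: B_def)
        note tc = thickening_close[OF Ai \<Lambda> KG M, folded BF]
        have "boundary L (B i) \<subseteq> boundary (L <#> M) (A i)"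
          by (rule K_boundary_perturbation[OF Ai compB compactin_subset_carrier[OF L] M(1,2) tc(1,2)])
            (use elim in simp)
        then have "measure m (boundary L (B i)) \<le> measure m (boundary (L <#> M) (A i))"
          using compB elim(4) Ai L LM
          by (intro measure_mono_fmeasurable compactin_fmeasurable compactin_sets compactin_K_boundary)
        moreover have "0 < measure m (B i)"
          using elim by (auto simp: zero_less_divide_iff)
        ultimately show ?case
          using elim by (simp add: divide_right_mono)
      qed
    qed
  qed
qed

end

section \<open>Relative entropy and samples of uniform density\<close>

locale amenable_factor_action =
  haar_group G T m + compact_factor_action G T X d \<phi> Y \<psi> p
  for G :: "('g, 'm) monoid_scheme" (structure) and T :: "'g topology" and m :: "'g measure"
    and X :: "'x set" and d and \<phi> and Y :: "'y topology" and \<psi> and p +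
  assumes amenable: "amenable_group G T m"
begin

abbreviation rlog_cov :: "'g set \<Rightarrow> real \<Rightarrow> real" where
  "rlog_cov A \<epsilon> \<equiv> enn2real (log_cov A \<epsilon>)"

lemma van_hove_net_exists:
  obtains I r and A :: "'g set net_index \<Rightarrow> 'g set" where "van_hove_net G T m I r A"
proof -
  have "\<exists>I r (A :: 'g set net_index \<Rightarrow> 'g set). van_hove_net G T m I r A"
    using amenable by (simp add: amenable_group_def)
  then show thesis
    using that by (elim exE)
qed

lemma log_cov_eq: "compactin T A \<Longrightarrow> 0 < \<epsilon> \<Longrightarrow> log_cov A \<epsilon> = ennreal (rlog_cov A \<epsilon>)"
  using log_fibre_cov_finite[of A \<epsilon>] by simp

text \<open>The logarithmic covering numbers at a fixed scale satisfy the hypotheses of the Ornstein-Weiss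
  lemma for \<open>G\<close>.\<close>

lemma entropy_limit:
  assumes ow: "ornstein_weiss G T m" and \<epsilon>: "0 < \<epsilon>"
  obtains L :: real where "\<And>I r (A :: 'g set net_index \<Rightarrow> 'g set). van_hove_net G T m I r A \<Longrightarrow>
    ((\<lambda>i. rlog_cov (A i) \<epsilon> / measure m (A i)) \<longlongrightarrow> L) (net_filter I r)"
proof -
  have "subadditive_on_compacts T (\<lambda>A. rlog_cov A \<epsilon>)"
    unfolding subadditive_on_compacts_def
  proof (intro allI impI)
    fix A B assume AB: "compactin T A \<and> compactin T B \<and> A \<inter> B = {}"
    then have "ennreal (rlog_cov (A \<union> B) \<epsilon>) \<le> ennreal (rlog_cov A \<epsilon>) + ennreal (rlog_cov B \<epsilon>)"
      using log_fibre_cov_Un_le[of A B \<epsilon>] \<epsilon> by (simp add: log_cov_eq[symmetric] compactin_Un)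
    then show "rlog_cov (A \<union> B) \<epsilon> \<le> rlog_cov A \<epsilon> + rlog_cov B \<epsilon>"
      by (simp flip: ennreal_plus)
  qed
  moreover have "right_invariant_on_compacts G T (\<lambda>A. rlog_cov A \<epsilon>)"
    unfolding right_invariant_on_compacts_def
    by (simp add: log_fibre_cov_r_coset compactin_subset_carrier)
  moreover have "monotone_on_compacts T (\<lambda>A. rlog_cov A \<epsilon>)"
    unfolding monotone_on_compacts_def
    using log_fibre_cov_finite[OF _ \<epsilon>] by (simp add: enn2real_mono log_fibre_cov_mono)
  ultimately have "\<exists>L::real. \<forall>I r (A :: 'g set net_index \<Rightarrow> 'g set). van_hove_net G T m I r A \<longrightarrow>
           ((\<lambda>i. rlog_cov (A i) \<epsilon> / measure m (A i)) \<longlongrightarrow> L) (net_filter I r)"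
    by (intro ow[unfolded ornstein_weiss_def, THEN spec[of _ "\<lambda>A. rlog_cov A \<epsilon>"], THEN mp] conjI)
  then obtain L where "\<forall>I r (A :: 'g set net_index \<Rightarrow> 'g set). van_hove_net G T m I r A \<longrightarrow>
      ((\<lambda>i. rlog_cov (A i) \<epsilon> / measure m (A i)) \<longlongrightarrow> L) (net_filter I r)"
    by (elim exE)
  then show thesis
    by (intro that[of L]) simp
qed

text \<open>The contribution of one scale: the relative entropy is the supremum of these numbers.\<close>

abbreviation entropy_at :: "real \<Rightarrow> ennreal" where
  "entropy_at \<epsilon> \<equiv> (THE L. \<forall>I r (A :: 'g set net_index \<Rightarrow> 'g set). van_hove_net G T m I r A \<longrightarrow>
        ((\<lambda>i. log_cov (A i) \<epsilon> / emeasure m (A i)) \<longlongrightarrow> L) (net_filter I r))"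

lemma entropy_at_limit:
  fixes A :: "'i \<Rightarrow> 'g set"
  assumes ow: "ornstein_weiss G T m" and \<epsilon>: "0 < \<epsilon>"
  obtains L where "entropy_at \<epsilon> = ennreal L" "0 \<le> L"
    "\<forall>I r (A :: 'i \<Rightarrow> 'g set). van_hove_net G T m I r A \<longrightarrow>
      ((\<lambda>i. rlog_cov (A i) \<epsilon> / measure m (A i)) \<longlongrightarrow> L) (net_filter I r)"
proof (rule entropy_limit[OF ow \<epsilon>])
  fix L :: real
  assume L: "\<And>I r (A :: 'g set net_index \<Rightarrow> 'g set). van_hove_net G T m I r A \<Longrightarrow>
    ((\<lambda>i. rlog_cov (A i) \<epsilon> / measure m (A i)) \<longlongrightarrow> L) (net_filter I r)"
  obtain I r and A :: "'g set net_index \<Rightarrow> 'g set" where A: "van_hove_net G T m I r A"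
    by (rule van_hove_net_exists)
  have nontriv: "net_filter I r \<noteq> bot"
    by (rule van_hove_net_nontrivial[OF A])
  have "eventually (\<lambda>i. 0 \<le> rlog_cov (A i) \<epsilon> / measure m (A i)) (net_filter I r)"
    by (intro always_eventually allI divide_nonneg_nonneg enn2real_nonneg measure_nonneg)
  from tendsto_lowerbound[OF L[OF A] this nontriv] have L0: "0 \<le> L" .
  have lim: "((\<lambda>i. log_cov (A i) \<epsilon> / emeasure m (A i)) \<longlongrightarrow> ennreal L) (net_filter I r)"
    if A: "van_hove_net G T m I r A" for I r and A :: "'g set net_index \<Rightarrow> 'g set"
    by (rule tendsto_ennreal_ratio[OF L[OF A]])
      (use van_hove_eventually[OF A] in \<open>eventually_elim, simp add: log_cov_eq[OF _ \<epsilon>, symmetric] emeasure_compactin\<close>)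
  have "entropy_at \<epsilon> = ennreal L"
    using A lim by (rule van_hove_limit_unique)
  then show thesis
    using L0
    by (rule that) (intro allI impI van_hove_limit_any_index[where F = "\<lambda>A. rlog_cov A \<epsilon> / measure m A", OF _ L])
qed

text \<open>A finite density forces the samples to be eventually finite, since the cardinality of an infinite
  set is \<open>\<infinity>\<close>.\<close>

lemma density_limit:
  fixes A :: "'i \<Rightarrow> 'g set"
  assumes dens: "has_uniform_density G T m \<Lambda> \<delta>" and A: "van_hove_net G T m I r A"
  obtains D where "\<delta> = ennreal D" "0 \<le> D"
    "eventually (\<lambda>i. finite (A i \<inter> \<Lambda>)) (net_filter I r)"
    "((\<lambda>i. real (card (A i \<inter> \<Lambda>)) / measure m (A i)) \<longlongrightarrow> D) (net_filter I r)"
proof -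
  have lim: "((\<lambda>i. ecard (\<Lambda> \<inter> A i) / emeasure m (A i)) \<longlongrightarrow> \<delta>) (net_filter I r)"
    by (rule van_hove_limit_any_index[where F = "\<lambda>A. ecard (\<Lambda> \<inter> A) / emeasure m A", OF A])
      (use dens in \<open>simp add: has_uniform_density_def\<close>)
  have "\<delta> < \<infinity>"
    using dens by (simp add: has_uniform_density_def)
  then obtain D where D: "\<delta> = ennreal D" "0 \<le> D"
    by (cases \<delta>) simp_all
  have "eventually (\<lambda>i. ecard (\<Lambda> \<inter> A i) / emeasure m (A i) < \<infinity>) (net_filter I r)"
    using lim \<open>\<delta> < \<infinity>\<close> by (rule order_tendstoD)
  then have fin: "eventually (\<lambda>i. finite (A i \<inter> \<Lambda>)) (net_filter I r)"
    using van_hove_eventually[OF A]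
  proof eventually_elim
    case (elim i)
    show ?case
    proof (rule ccontr)
      assume "infinite (A i \<inter> \<Lambda>)"
      then have "ecard (\<Lambda> \<inter> A i) = \<infinity>"
        by (simp add: ecard_infinite Int_commute)
      then show False
        using elim by (simp add: emeasure_compactin ennreal_top_divide)
    qed
  qed
  have "((\<lambda>i. real (card (A i \<inter> \<Lambda>)) / measure m (A i)) \<longlongrightarrow> D) (net_filter I r)"
    by (rule tendsto_real_ratio[OF lim[unfolded D(1)] D(2)]) (use fin van_hove_eventually[OF A] in
      \<open>eventually_elim, simp add: ecard_finite Int_commute emeasure_compactin ennreal_of_nat_eq_real_of_nat\<close>)
  with D fin show thesis
    by (rule that)
qed

lemma dens_eq:
  assumes dens: "has_uniform_density G T m \<Lambda> \<delta>"
  shows "dens G T m \<Lambda> = \<delta>"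
  unfolding dens_def
proof (rule the_equality, rule dens)
  fix \<delta>' assume dens': "has_uniform_density G T m \<Lambda> \<delta>'"
  obtain I r and A :: "'g set net_index \<Rightarrow> 'g set" where A: "van_hove_net G T m I r A"
    by (rule van_hove_net_exists)
  have "net_filter I r \<noteq> bot"
    by (rule van_hove_net_nontrivial[OF A])
  moreover have "((\<lambda>i. ecard (\<Lambda> \<inter> A i) / emeasure m (A i)) \<longlongrightarrow> \<delta>') (net_filter I r)"
    "((\<lambda>i. ecard (\<Lambda> \<inter> A i) / emeasure m (A i)) \<longlongrightarrow> \<delta>) (net_filter I r)"
    using A dens dens' by (simp_all add: has_uniform_density_def)
  ultimately show "\<delta>' = \<delta>"
    by (rule tendsto_unique)
qed

text \<open>Enlarging \<open>K\<close> by a compact neighbourhood of \<open>\<one>\<close> keeps \<open>K \<Lambda> = G\<close> and adds an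
  interior.\<close>

lemma relatively_dense_thick:
  assumes "relatively_dense G T \<Lambda>"
  obtains U K where "\<Lambda> \<subseteq> carrier G" "compactin T K" "K <#> \<Lambda> = carrier G"
    "openin T U" "U \<noteq> {}" "U \<subseteq> K"
proof -
  have \<Lambda>: "\<Lambda> \<subseteq> carrier G" and "\<exists>K. compactin T K \<and> K <#> \<Lambda> = carrier G"
    using assms by (simp_all add: relatively_dense_def)
  then obtain K1 where K1: "compactin T K1" "K1 <#> \<Lambda> = carrier G"
    by (elim exE conjE)
  obtain U K2 where K2: "openin T U" "compactin T K2" "\<one> \<in> U" "U \<subseteq> K2"
    by (rule compact_nbhd)
  have K: "compactin T (K1 \<union> K2)"
    using K1(1) K2(2) by (rule compactin_Un)
  have "(K1 \<union> K2) <#> \<Lambda> \<subseteq> carrier G"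
    using compactin_subset_carrier[OF K] \<Lambda> by (rule set_mult_closed)
  moreover have "K1 <#> \<Lambda> \<subseteq> (K1 \<union> K2) <#> \<Lambda>"
    by (intro set_mult_mono_both) simp_all
  ultimately have KG: "(K1 \<union> K2) <#> \<Lambda> = carrier G"
    using K1(2) by simp
  show thesis
    by (rule that[OF \<Lambda> K KG K2(1)]) (use K2 in auto)
qed

text \<open>The two inequalities compare the sample \<open>A i \<inter> \<Lambda>\<close> with the Van Hove nets \<open>A\<close> and
  \<open>B = K (A \<inter> \<Lambda>)\<close>, along both of which the averages converge to the same \<open>L\<close>. The sample
  is contained in \<open>A i\<close>, which bounds its covering numbers from above at the same scale; thickened
  by \<open>K\<close> it becomes \<open>B i\<close>, which bounds them from below at the finer scale \<open>\<epsilon>'\<close>. Both bounds,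
  divided by the cardinality \<open>n i\<close> of the sample, converge to \<open>L / D\<close>.\<close>

lemma entropy_at_bounds:
  fixes A :: "'i \<Rightarrow> 'g set"
  assumes ow: "ornstein_weiss G T m" and \<epsilon>: "0 < \<epsilon>"
    and rd: "relatively_dense G T \<Lambda>" and dens: "has_uniform_density G T m \<Lambda> \<delta>"
    and A: "van_hove_net G T m I r A"
  shows "\<delta> * Limsup (net_filter I r) (\<lambda>i. log_cov (A i \<inter> \<Lambda>) \<epsilon> / ecard (A i \<inter> \<Lambda>)) \<le> entropy_at \<epsilon>"
    and "\<exists>\<epsilon>'>0. entropy_at \<epsilon> \<le>
      \<delta> * Liminf (net_filter I r) (\<lambda>i. log_cov (A i \<inter> \<Lambda>) \<epsilon>' / ecard (A i \<inter> \<Lambda>))"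
proof -
  define N where "N = net_filter I r"
  define n where "n i = real (card (A i \<inter> \<Lambda>))" for i
  have N: "N \<noteq> bot"
    unfolding N_def by (rule van_hove_net_nontrivial[OF A])
  obtain D where D: "\<delta> = ennreal D" "0 \<le> D"
    and fin: "eventually (\<lambda>i. finite (A i \<inter> \<Lambda>)) N"
    and nA: "((\<lambda>i. n i / measure m (A i)) \<longlongrightarrow> D) N"
    unfolding N_def n_def by (rule density_limit[OF dens A])
  obtain L where L: "entropy_at \<epsilon> = ennreal L" "0 \<le> L"
    and "\<forall>I r (A :: 'i \<Rightarrow> 'g set). van_hove_net G T m I r A \<longrightarrow>
      ((\<lambda>i. rlog_cov (A i) \<epsilon> / measure m (A i)) \<longlongrightarrow> L) (net_filter I r)"
    by (rule entropy_at_limit[OF ow \<epsilon>, where ?'i = 'i])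
  then have Llim: "((\<lambda>i. rlog_cov (A i) \<epsilon> / measure m (A i)) \<longlongrightarrow> L) (net_filter I r)"
    if "van_hove_net G T m I r A" for I r and A :: "'i \<Rightarrow> 'g set"
    using that by simp
  obtain U K where K: "\<Lambda> \<subseteq> carrier G" "compactin T K" "K <#> \<Lambda> = carrier G"
    "openin T U" "U \<noteq> {}" "U \<subseteq> K"
    by (rule relatively_dense_thick[OF rd])
  have Fc: "A i \<inter> \<Lambda> \<subseteq> carrier G" for i
    using K(1) by (rule le_infI2)
  define B where "B i = (if finite (A i \<inter> \<Lambda>) then K <#> (A i \<inter> \<Lambda>) else A i)" for i
  have vB: "van_hove_net G T m I r B"
    and BA: "((\<lambda>i. measure m (B i) / measure m (A i)) \<longlongrightarrow> 1) N"
    unfolding B_def N_def by (rule van_hove_thickening[OF A K(1,3,2,4-6) fin[unfolded N_def]])+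
  have evA: "eventually (\<lambda>i. compactin T (A i) \<and> 0 < measure m (A i)) N"
    and evB: "eventually (\<lambda>i. compactin T (B i) \<and> 0 < measure m (B i)) N"
    unfolding N_def by (rule van_hove_eventually[OF A], rule van_hove_eventually[OF vB])
  let ?u = "\<lambda>i. rlog_cov (A i) \<epsilon> / measure m (A i) / (n i / measure m (A i))"
  let ?w = "\<lambda>i. rlog_cov (B i) \<epsilon> / measure m (B i) /
    (n i / measure m (A i) / (measure m (B i) / measure m (A i)))"
  \<comment> \<open>The density is positive: \<open>n i\<close> translates of \<open>K\<close> cover \<open>B i\<close>, which is almost as large as \<open>A i\<close>.\<close>
  have "1 \<le> D * measure m K"
  proof (rule tendsto_le[OF N tendsto_mult[OF nA tendsto_const] BA])
    show "eventually (\<lambda>i. measure m (B i) / measure m (A i) \<le> n i / measure m (A i) * measure m K) N"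
      using fin evA
    proof eventually_elim
      case (elim i)
      have "emeasure m (B i) \<le> of_nat (card (A i \<inter> \<Lambda>)) * emeasure m K"
        using emeasure_translates_le[OF compactin_sets[OF K(2)] _ Fc[of i]] elim by (simp add: B_def)
      also have "\<dots> = ennreal (n i * measure m K)"
        by (simp add: n_def emeasure_compactin[OF K(2)] ennreal_mult ennreal_of_nat_eq_real_of_nat)
      finally have "measure m (B i) \<le> n i * measure m K"
        unfolding measure_def by (rule enn2real_leI[rotated]) (simp add: n_def)
      then show ?case
        using elim by (simp add: divide_right_mono)
    qed
  qed
  then have Dpos: "0 < D"
    using D(2) by (cases "D = 0") auto
  have npos: "eventually (\<lambda>i. 0 < n i) N"
    using order_tendstoD(1)[OF nA Dpos] evA
    by eventually_elim (simp add: zero_less_divide_iff)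
  have \<delta>L: "\<delta> * ennreal (L / D) = entropy_at \<epsilon>"
    using D L Dpos by (simp flip: ennreal_mult)
  have frac: "log_cov S \<epsilon>0 / ecard F = ennreal (rlog_cov S \<epsilon>0 / real (card F))"
    if "compactin T S" "0 < \<epsilon>0" "finite F" "0 < real (card F)" for S \<epsilon>0 and F :: "'g set"
  proof -
    have "log_cov S \<epsilon>0 / ecard F = ennreal (rlog_cov S \<epsilon>0) / ennreal (real (card F))"
      by (simp only: log_cov_eq[OF that(1,2), symmetric] ecard_finite[OF that(3)]
          ennreal_of_nat_eq_real_of_nat)
    also have "\<dots> = ennreal (rlog_cov S \<epsilon>0 / real (card F))"
      using that(4) by (intro divide_ennreal) simp_all
    finally show ?thesis .
  qed
  have compF: "compactin T F" if "finite F" "F \<subseteq> carrier G" for F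
    using that by (intro finite_imp_compactin) (simp_all add: topspace_T)
  show "\<delta> * Limsup (net_filter I r) (\<lambda>i. log_cov (A i \<inter> \<Lambda>) \<epsilon> / ecard (A i \<inter> \<Lambda>)) \<le> entropy_at \<epsilon>"
  proof -
    have "((\<lambda>i. ?u i) \<longlongrightarrow> L / D) N"
      using Llim[OF A, folded N_def] nA Dpos by (intro tendsto_divide) simp_all
    then have "((\<lambda>i. ennreal (?u i)) \<longlongrightarrow> ennreal (L / D)) N"
      by (rule tendsto_ennrealI)
    then have lim: "Limsup N (\<lambda>i. ennreal (?u i)) = ennreal (L / D)"
      by (rule lim_imp_Limsup[OF N])
    have "Limsup N (\<lambda>i. log_cov (A i \<inter> \<Lambda>) \<epsilon> / ecard (A i \<inter> \<Lambda>)) \<le>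
        Limsup N (\<lambda>i. ennreal (?u i))"
    proof (rule Limsup_mono)
      show "eventually (\<lambda>i. log_cov (A i \<inter> \<Lambda>) \<epsilon> / ecard (A i \<inter> \<Lambda>) \<le>
          ennreal (?u i)) N"
        using fin evA npos
      proof eventually_elim
        case (elim i)
        have "log_cov (A i \<inter> \<Lambda>) \<epsilon> / ecard (A i \<inter> \<Lambda>) \<le> log_cov (A i) \<epsilon> / ecard (A i \<inter> \<Lambda>)"
          by (intro divide_right_mono_ennreal log_fibre_cov_mono) simp
        also have "\<dots> = ennreal (rlog_cov (A i) \<epsilon> / n i)"
          unfolding n_def using elim \<epsilon> by (intro frac) (simp_all add: n_def)
        finally show ?case
          using elim by simp
      qed
    qed
    then have "\<delta> * Limsup N (\<lambda>i. log_cov (A i \<inter> \<Lambda>) \<epsilon> / ecard (A i \<inter> \<Lambda>)) \<le> \<delta> * ennreal (L / D)"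
      unfolding lim by (rule mult_left_mono) simp
    then show ?thesis
      unfolding \<delta>L N_def .
  qed
  obtain \<epsilon>' where \<epsilon>': "0 < \<epsilon>'" "\<forall>F. F \<subseteq> carrier G \<longrightarrow> log_cov (K <#> F) \<epsilon> \<le> log_cov F \<epsilon>'"
    by (rule log_fibre_cov_thickening[OF K(2) \<epsilon>])
  have "entropy_at \<epsilon> \<le> \<delta> * Liminf N (\<lambda>i. log_cov (A i \<inter> \<Lambda>) \<epsilon>' / ecard (A i \<inter> \<Lambda>))"
  proof -
    have "((\<lambda>i. n i / measure m (A i) / (measure m (B i) / measure m (A i))) \<longlongrightarrow> D / 1) N"
      by (rule tendsto_divide[OF nA BA]) simp
    then have "((\<lambda>i. ?w i) \<longlongrightarrow> L / (D / 1)) N"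
      by (rule tendsto_divide[OF Llim[OF vB, folded N_def]]) (use Dpos in simp)
    then have "((\<lambda>i. ennreal (?w i)) \<longlongrightarrow> ennreal (L / (D / 1))) N"
      by (rule tendsto_ennrealI)
    then have "Liminf N (\<lambda>i. ennreal (?w i)) = ennreal (L / (D / 1))"
      by (rule lim_imp_Liminf[OF N])
    then have lim: "Liminf N (\<lambda>i. ennreal (?w i)) = ennreal (L / D)"
      by simp
    have "Liminf N (\<lambda>i. ennreal (?w i)) \<le>
        Liminf N (\<lambda>i. log_cov (A i \<inter> \<Lambda>) \<epsilon>' / ecard (A i \<inter> \<Lambda>))"
    proof (rule Liminf_mono)
      show "eventually (\<lambda>i. ennreal (?w i) \<le>
          log_cov (A i \<inter> \<Lambda>) \<epsilon>' / ecard (A i \<inter> \<Lambda>)) N"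
        using fin evA evB npos
      proof eventually_elim
        case (elim i)
        have "ennreal (rlog_cov (B i) \<epsilon> / n i) = log_cov (B i) \<epsilon> / ecard (A i \<inter> \<Lambda>)"
          unfolding n_def using elim \<epsilon> by (intro frac[symmetric]) (simp_all add: n_def)
        also have "\<dots> \<le> log_cov (A i \<inter> \<Lambda>) \<epsilon>' / ecard (A i \<inter> \<Lambda>)"
          using \<epsilon>'(2) Fc[of i] elim by (intro divide_right_mono_ennreal) (simp add: B_def)
        finally show ?case
          using elim by simp
      qed
    qed
    then have "\<delta> * ennreal (L / D) \<le> \<delta> * Liminf N (\<lambda>i. log_cov (A i \<inter> \<Lambda>) \<epsilon>' / ecard (A i \<inter> \<Lambda>))"
      unfolding lim by (rule mult_left_mono) simp
    then show ?thesis
      unfolding \<delta>L .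
  qed
  with \<epsilon>'(1) show "\<exists>\<epsilon>'>0. entropy_at \<epsilon> \<le>
      \<delta> * Liminf (net_filter I r) (\<lambda>i. log_cov (A i \<inter> \<Lambda>) \<epsilon>' / ecard (A i \<inter> \<Lambda>))"
    unfolding N_def by (intro exI conjI)
qed

text \<open>The lower limits are at most the upper limits, and by \<open>entropy_at_bounds\<close> the suprema over all
  scales squeeze the entropy between them.\<close>

theorem rel_entropy_uniform_density:
  fixes A :: "'i \<Rightarrow> 'g set"
  assumes ow: "ornstein_weiss G T m"
    and rd: "relatively_dense G T \<Lambda>" and dens: "has_uniform_density G T m \<Lambda> \<delta>"
    and A: "van_hove_net G T m I r A"
  shows "rel_entropy G T m X d \<phi> Y p = \<delta> * (SUP \<epsilon>\<in>{0<..}. Liminf (net_filter I r)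
        (\<lambda>i. log_cov (A i \<inter> \<Lambda>) \<epsilon> / ecard (A i \<inter> \<Lambda>))) \<and>
      rel_entropy G T m X d \<phi> Y p = \<delta> * (SUP \<epsilon>\<in>{0<..}. Limsup (net_filter I r)
        (\<lambda>i. log_cov (A i \<inter> \<Lambda>) \<epsilon> / ecard (A i \<inter> \<Lambda>)))"
proof -
  define E where "E = rel_entropy G T m X d \<phi> Y p"
  define li where "li \<epsilon> = Liminf (net_filter I r) (\<lambda>i. log_cov (A i \<inter> \<Lambda>) \<epsilon> / ecard (A i \<inter> \<Lambda>))" for \<epsilon>
  define ls where "ls \<epsilon> = Limsup (net_filter I r) (\<lambda>i. log_cov (A i \<inter> \<Lambda>) \<epsilon> / ecard (A i \<inter> \<Lambda>))" for \<epsilon>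
  have E: "E = (SUP \<epsilon>\<in>{0<..}. entropy_at \<epsilon>)"
    by (simp add: E_def rel_entropy_def)
  have N: "net_filter I r \<noteq> bot"
    by (rule van_hove_net_nontrivial[OF A])
  have 1: "E \<le> \<delta> * (SUP \<epsilon>\<in>{0<..}. li \<epsilon>)"
    unfolding E
  proof (rule SUP_least)
    fix \<epsilon> :: real assume "\<epsilon> \<in> {0<..}"
    then obtain \<epsilon>' where e': "0 < \<epsilon>'" "entropy_at \<epsilon> \<le> \<delta> * li \<epsilon>'"
      using entropy_at_bounds(2)[OF ow _ rd dens A, of \<epsilon>] unfolding li_def by auto
    have "\<delta> * li \<epsilon>' \<le> \<delta> * (SUP \<epsilon>\<in>{0<..}. li \<epsilon>)"
      using e'(1) by (intro mult_left_mono SUP_upper) simp_all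
    with e'(2) show "entropy_at \<epsilon> \<le> \<delta> * (SUP \<epsilon>\<in>{0<..}. li \<epsilon>)"
      by (rule order_trans)
  qed
  have 2: "\<delta> * (SUP \<epsilon>\<in>{0<..}. li \<epsilon>) \<le> \<delta> * (SUP \<epsilon>\<in>{0<..}. ls \<epsilon>)"
    unfolding li_def ls_def by (intro mult_left_mono SUP_mono' Liminf_le_Limsup[OF N]) simp
  have 3: "\<delta> * (SUP \<epsilon>\<in>{0<..}. ls \<epsilon>) \<le> E"
    unfolding SUP_mult_left_ennreal E ls_def
    by (intro SUP_mono' SUP_subset_mono order_refl entropy_at_bounds(1)[OF ow _ rd dens A]) simp_all
  have "E = \<delta> * (SUP \<epsilon>\<in>{0<..}. li \<epsilon>)" "E = \<delta> * (SUP \<epsilon>\<in>{0<..}. ls \<epsilon>)"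
    using 1 2 3 by (meson antisym order_trans)+
  then show ?thesis
    by (simp add: E_def li_def ls_def)
qed

end

section \<open>Uniform lattices\<close>

context haar_group
begin

lemma openin_set_mult_left:
  assumes "S \<subseteq> carrier G" "openin T V"
  shows "openin T (S <#> V)"
proof -
  have "S <#> V = (\<Union>s\<in>S. s <# V)"
    by (auto simp: set_mult_def l_coset_def)
  moreover have "openin T (\<Union>s\<in>S. s <# V)"
    by (rule openin_Union) (use assms in \<open>auto intro: openin_l_coset\<close>)
  ultimately show ?thesis
    by simp
qed

lemma openin_set_mult_right:
  assumes "openin T U" "L \<subseteq> carrier G"
  shows "openin T (U <#> L)"
proof -
  have "U <#> L = (\<Union>l\<in>L. U #> l)"
    by (auto simp: set_mult_def r_coset_def)
  moreover have "openin T (\<Union>l\<in>L. U #> l)"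
    by (rule openin_Union) (use assms in \<open>auto intro: openin_r_coset\<close>)
  ultimately show ?thesis
    by simp
qed

lemma set_mult_subgroup_closed:
  assumes "subgroup \<Lambda> G" "U \<subseteq> carrier G" "x \<in> U <#> \<Lambda>" "l \<in> \<Lambda>"
  shows "x \<otimes> l \<in> U <#> \<Lambda>"
proof -
  obtain u l' where u: "u \<in> U" "l' \<in> \<Lambda>" "x = u \<otimes> l'"
    using assms(3) by (rule mem_set_multE)
  have "x \<otimes> l = u \<otimes> (l' \<otimes> l)"
    unfolding u(3) using u assms subgroup.mem_carrier[OF assms(1)]
    by (intro m_assoc) (simp_all add: subset_iff)
  moreover have "l' \<otimes> l \<in> \<Lambda>"
    using assms(1) u(2) assms(4) by (rule subgroup.m_closed)
  ultimately show ?thesis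
    using u(1) by (simp add: mem_set_multI)
qed

text \<open>A disjointification that respects \<open>\<Lambda>\<close>: the next open piece \<open>g V\<close> contributes only what no
  \<open>\<Lambda>\<close>-translate of the previous pieces contains. The saturation \<open>W\<close> of the previous pieces is
  open, so that the result stays Borel.\<close>

lemma exhaust_translates:
  assumes \<Lambda>: "subgroup \<Lambda> G" and V: "openin T V" "separated V \<Lambda>"
    and S: "finite S" "S \<subseteq> carrier G"
  shows "\<exists>C\<in>sets m. C \<subseteq> S <#> V \<and> C <#> \<Lambda> = (S <#> V) <#> \<Lambda> \<and> separated C \<Lambda>"
  using S
proof (induction S)
  case empty
  show ?case
    by (intro bexI[of _ "{}"]) (simp_all add: set_mult_def separated_def)
next
  case (insert g S)
  then obtain C where C: "C \<in> sets m" "C \<subseteq> S <#> V" "C <#> \<Lambda> = (S <#> V) <#> \<Lambda>" "separated C \<Lambda>"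
    by auto
  have Sc: "S \<subseteq> carrier G" and g: "g \<in> carrier G"
    using insert.prems by simp_all
  note \<Lambda>c = subgroup.subset[OF \<Lambda>] and Vc = openin_subset_carrier[OF V(1)]
  have SV: "openin T (S <#> V)"
    using Sc V(1) by (rule openin_set_mult_left)
  define W where "W = (S <#> V) <#> \<Lambda>"
  have W: "openin T W"
    unfolding W_def using SV \<Lambda>c by (rule openin_set_mult_right)
  have gV: "openin T (g <# V)"
    using g V(1) by (rule openin_l_coset)
  define D where "D = (g <# V) - W"
  have ins: "insert g S <#> V = (g <# V) \<union> (S <#> V)"
    by (auto simp: set_mult_def l_coset_def)
  have dist: "(P \<union> Q) <#> \<Lambda> = (P <#> \<Lambda>) \<union> (Q <#> \<Lambda>)" for P Q
    by (auto simp: set_mult_def)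
  have Wl: "x \<otimes> l \<in> W" if "x \<in> W" "l \<in> \<Lambda>" for x l
    using set_mult_subgroup_closed[OF \<Lambda> openin_subset_carrier[OF SV]] that by (simp add: W_def)
  have "C \<union> D \<in> sets m"
    unfolding D_def by (intro sets.Un sets.Diff C(1) openin_sets gV W)
  moreover have "C \<union> D \<subseteq> insert g S <#> V"
    unfolding ins D_def using C(2) by auto
  moreover have "(C \<union> D) <#> \<Lambda> = (insert g S <#> V) <#> \<Lambda>"
  proof -
    have "(g <# V) <#> \<Lambda> \<subseteq> W \<union> (D <#> \<Lambda>)"
    proof
      fix x assume "x \<in> (g <# V) <#> \<Lambda>"
      then obtain y l where y: "y \<in> g <# V" "l \<in> \<Lambda>" "x = y \<otimes> l"
        by (rule mem_set_multE)
      show "x \<in> W \<union> (D <#> \<Lambda>)"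
      proof (cases "y \<in> W")
        case True
        then show ?thesis
          using Wl y by simp
      next
        case False
        then have "y \<in> D"
          using y(1) by (simp add: D_def)
        then show ?thesis
          unfolding y(3) using y(2) by (intro UnI2 mem_set_multI)
      qed
    qed
    moreover have "D <#> \<Lambda> \<subseteq> (g <# V) <#> \<Lambda>"
      unfolding D_def by (intro set_mult_mono_both) auto
    ultimately show ?thesis
      unfolding dist ins C(3) W_def[symmetric] by auto
  qed
  moreover have "separated (C \<union> D) \<Lambda>"
    unfolding separated_def
  proof (intro ballI impI)
    have D_sep: "l = l'" if d: "d \<in> D" "d' \<in> D" "l \<in> \<Lambda>" "l' \<in> \<Lambda>" "d \<otimes> l = d' \<otimes> l'" for d d' l l'
    proof -
      obtain v v' where v: "v \<in> V" "v' \<in> V" "d = g \<otimes> v" "d' = g \<otimes> v'"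
        using d(1,2) by (auto simp: D_def l_coset_def)
      have c: "v \<in> carrier G" "v' \<in> carrier G" "l \<in> carrier G" "l' \<in> carrier G"
        using v d \<Lambda>c Vc by (simp_all add: subset_iff)
      have "g \<otimes> (v \<otimes> l) = g \<otimes> (v' \<otimes> l')"
        using d(5) v(3,4) c g by (simp add: m_assoc)
      then have "v \<otimes> l = v' \<otimes> l'"
        using c g by simp
      then show ?thesis
        by (rule separatedD[OF V(2) v(1,2) d(3,4)])
    qed
    have mixed: False if c: "c \<in> C" "d \<in> D" "l \<in> \<Lambda>" "l' \<in> \<Lambda>" "c \<otimes> l = d \<otimes> l'" for c d l l'
    proof -
      have "c \<otimes> l \<in> W"
        using mem_set_multI[OF c(1,3)] C(3) by (simp add: W_def)
      then have "(c \<otimes> l) \<otimes> inv l' \<in> W"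
        by (rule Wl) (rule subgroup.m_inv_closed[OF \<Lambda> c(4)])
      moreover have "d \<in> carrier G" "l' \<in> carrier G"
        using c openin_subset_carrier[OF gV] \<Lambda>c by (simp_all add: D_def subset_iff)
      then have "(c \<otimes> l) \<otimes> inv l' = d"
        unfolding c(5) by (simp add: m_assoc)
      ultimately show False
        using c(2) by (simp add: D_def)
    qed
    fix c c' l l' assume c: "c \<in> C \<union> D" "c' \<in> C \<union> D" "l \<in> \<Lambda>" "l' \<in> \<Lambda>" "c \<otimes> l = c' \<otimes> l'"
    show "l = l'"
      using c(1,2)
    proof (elim UnE)
      assume "c \<in> C" "c' \<in> C"
      then show ?thesis
        by (rule separatedD[OF C(4) _ _ c(3-5)])
    next
      assume "c \<in> C" "c' \<in> D"
      then show ?thesis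
        using mixed[OF _ _ c(3-5)] by simp
    next
      assume "c \<in> D" "c' \<in> C"
      then show ?thesis
        using mixed[OF _ _ c(4,3) c(5)[symmetric]] by simp
    next
      assume "c \<in> D" "c' \<in> D"
      then show ?thesis
        by (rule D_sep[OF _ _ c(3-5)])
    qed
  qed
  ultimately show ?case
    by (intro bexI[of _ "C \<union> D"] conjI)
qed

lemma separating_precompact_nbhd:
  assumes \<Lambda>: "subgroup \<Lambda> G" "discrete_subset T \<Lambda>"
  obtains V V' where "openin T V" "\<one> \<in> V" "V \<subseteq> V'" "compactin T V'" "separated V \<Lambda>"
proof -
  obtain V where V: "openin T V" "\<one> \<in> V" "separated V \<Lambda>"
    by (rule discrete_subgroup_separating_nbhd[OF \<Lambda>])
  obtain U K where U: "openin T U" "compactin T K" "\<one> \<in> U" "U \<subseteq> K"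
    by (rule compact_nbhd)
  show thesis
  proof (rule that[of "V \<inter> U" K])
    show "openin T (V \<inter> U)"
      using V(1) U(1) by (rule openin_Int)
    show "separated (V \<inter> U) \<Lambda>"
      by (rule separated_subset[OF V(3)]) simp_all
  qed (use V U in auto)
qed

text \<open>Finitely many sets \<open>g V\<close> cover \<open>K\<close>, hence their saturation is the whole group, and
  exhausting them yields a Borel fundamental domain. It lies in a compact set since
  \<open>V\<close> does.\<close>

lemma lattice_fundamental_domain:
  assumes \<Lambda>: "subgroup \<Lambda> G" "discrete_subset T \<Lambda>"
    and K: "compactin T K" "K <#> \<Lambda> = carrier G"
  obtains C M where "C \<in> sets m" "C <#> \<Lambda> = carrier G" "separated C \<Lambda>"
    "compactin T M" "\<one> \<in> M" "C \<subseteq> M"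
proof -
  obtain V V' where V: "openin T V" "\<one> \<in> V" "V \<subseteq> V'" "compactin T V'" "separated V \<Lambda>"
    by (rule separating_precompact_nbhd[OF \<Lambda>])
  have "K \<subseteq> \<Union>((\<lambda>g. g <# V) ` carrier G)"
  proof
    fix x assume "x \<in> K"
    then have x: "x \<in> carrier G"
      using subsetD[OF compactin_subset_carrier[OF K(1)]] by simp
    have "x \<otimes> \<one> \<in> x <# V"
      using V(2) unfolding l_coset_def by (intro UN_I) simp_all
    then show "x \<in> \<Union>((\<lambda>g. g <# V) ` carrier G)"
      using x by (intro UnionI[OF imageI[OF x]]) simp
  qed
  moreover have "\<forall>W\<in>(\<lambda>g. g <# V) ` carrier G. openin T W"
    using openin_l_coset[OF _ V(1)] by simp
  ultimately have "\<exists>\<F>. finite \<F> \<and> \<F> \<subseteq> (\<lambda>g. g <# V) ` carrier G \<and> K \<subseteq> \<Union>\<F>"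
    using K(1) unfolding compactin_def by simp
  then obtain \<F> where F: "finite \<F>" "\<F> \<subseteq> (\<lambda>g. g <# V) ` carrier G" "K \<subseteq> \<Union>\<F>"
    by (elim exE conjE)
  then obtain S where S: "S \<subseteq> carrier G" "finite S" "\<F> = (\<lambda>g. g <# V) ` S"
    using finite_subset_image[OF F(1,2)] by (elim exE conjE)
  have KS: "K \<subseteq> S <#> V"
    using F(3) unfolding S(3) by (simp add: set_mult_def l_coset_def)
  have "\<exists>C\<in>sets m. C \<subseteq> S <#> V \<and> C <#> \<Lambda> = (S <#> V) <#> \<Lambda> \<and> separated C \<Lambda>"
    using \<Lambda>(1) V(1,5) S(2,1) by (rule exhaust_translates)
  then obtain C where C: "C \<in> sets m" "C \<subseteq> S <#> V" "C <#> \<Lambda> = (S <#> V) <#> \<Lambda>" "separated C \<Lambda>"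
    by (elim bexE conjE)
  have "K <#> \<Lambda> \<subseteq> (S <#> V) <#> \<Lambda>"
    using KS by (intro set_mult_mono_both) simp_all
  moreover have "(S <#> V) <#> \<Lambda> \<subseteq> carrier G"
    by (intro set_mult_closed S openin_subset_carrier[OF V(1)] subgroup.subset[OF \<Lambda>(1)])
  ultimately have CG: "C <#> \<Lambda> = carrier G"
    using C(3) K(2) by simp
  have SV': "compactin T (S <#> V')"
    by (rule compactin_set_mult[OF finite_imp_compactin V(4)]) (use S in \<open>simp_all add: topspace_T\<close>)
  have "compactin T ({\<one>} \<union> (S <#> V'))"
    by (rule compactin_Un[OF finite_imp_compactin SV']) (simp_all add: topspace_T)
  moreover have "C \<subseteq> {\<one>} \<union> (S <#> V')"
    using C(2) set_mult_mono_both[OF subset_refl V(3), of S] by auto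
  ultimately show thesis
    by (intro that[OF C(1) CG C(4)]) simp_all
qed

lemma lattice_finite_Int_compact:
  assumes \<Lambda>: "subgroup \<Lambda> G" "discrete_subset T \<Lambda>"
  obtains c M where "0 < c" "compactin T M"
    "\<forall>B. compactin T B \<longrightarrow> finite (B \<inter> \<Lambda>) \<and> real (card (B \<inter> \<Lambda>)) \<le> c * measure m (M <#> B)"
proof -
  obtain V V' where V: "openin T V" "\<one> \<in> V" "V \<subseteq> V'" "compactin T V'" "separated V \<Lambda>"
    by (rule separating_precompact_nbhd[OF \<Lambda>])
  have ne: "V \<noteq> {}"
    using V(2) by auto
  have "V \<in> fmeasurable m"
    using fmeasurableI2[OF compactin_fmeasurable[OF V(4)] V(3) openin_sets[OF V(1)]] .
  then have pos: "0 < measure m V"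
    using emeasure_openin_pos[OF V(1) ne]
    by (simp add: measure_def enn2real_positive_iff fmeasurable_def)
  note pb = packing_bound[OF V(1) ne V(4,3) V(5)]
  have "finite (B \<inter> \<Lambda>) \<and> real (card (B \<inter> \<Lambda>)) \<le> 1 / measure m V * measure m (V' <#> B)"
    if "compactin T B" for B
    using pb[OF that] pos by (simp add: pos_le_divide_eq)
  then show thesis
    using pos by (intro that[of "1 / measure m V" V'] V(4)) simp_all
qed

text \<open>The set \<open>C (A i \<inter> \<Lambda>)\<close> has measure \<open>|A i \<inter> \<Lambda>| \<mu>(C)\<close> and is \<open>A i\<close> up to a boundary. The
  quotient of the two measures thus tends to \<open>1\<close>; in particular \<open>\<mu>(C)\<close> cannot vanish.\<close>

lemma lattice_density_limit:
  assumes \<Lambda>: "subgroup \<Lambda> G" "discrete_subset T \<Lambda>"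
    and C: "C \<in> sets m" "C <#> \<Lambda> = carrier G" "separated C \<Lambda>"
    and M: "compactin T M" "\<one> \<in> M" "C \<subseteq> M"
    and A: "van_hove_net G T m I r A"
  shows "0 < measure m C"
    and "((\<lambda>i. real (card (A i \<inter> \<Lambda>)) / measure m (A i)) \<longlongrightarrow> 1 / measure m C) (net_filter I r)"
proof -
  have N: "net_filter I r \<noteq> bot"
    by (rule van_hove_net_nontrivial[OF A])
  have \<Lambda>c: "\<Lambda> \<subseteq> carrier G"
    by (rule subgroup.subset[OF \<Lambda>(1)])
  have Fc: "A i \<inter> \<Lambda> \<subseteq> carrier G" for i
    using \<Lambda>c by (rule le_infI2)
  obtain c M' where bd: "0 < c" "compactin T M'"
    "\<forall>B. compactin T B \<longrightarrow> finite (B \<inter> \<Lambda>) \<and> real (card (B \<inter> \<Lambda>)) \<le> c * measure m (M' <#> B)"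
    by (rule lattice_finite_Int_compact[OF \<Lambda>])
  have fin: "eventually (\<lambda>i. finite (A i \<inter> \<Lambda>)) (net_filter I r)"
    using van_hove_eventually[OF A] by eventually_elim (use bd(3) in simp)
  have CF: "C <#> (A i \<inter> \<Lambda>) \<in> sets m"
    "emeasure m (C <#> (A i \<inter> \<Lambda>)) = of_nat (card (A i \<inter> \<Lambda>)) * emeasure m C"
    if "finite (A i \<inter> \<Lambda>)" for i
    by (rule emeasure_disjoint_translates[OF C(1) that Fc separated_subset[OF C(3)]], simp_all)+
  have "eventually (\<lambda>i. C <#> (A i \<inter> \<Lambda>) \<in> sets m) (net_filter I r)"
    using fin by eventually_elim (rule CF(1))
  from thickening_measure_tendsto[OF A \<Lambda>c C(2) M this]
  have lim: "((\<lambda>i. real (card (A i \<inter> \<Lambda>)) / measure m (A i) * measure m C) \<longlongrightarrow> 1) (net_filter I r)"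
  proof (rule Lim_transform_eventually)
    show "eventually (\<lambda>i. measure m (C <#> (A i \<inter> \<Lambda>)) / measure m (A i) =
        real (card (A i \<inter> \<Lambda>)) / measure m (A i) * measure m C) (net_filter I r)"
      using fin by eventually_elim (simp add: measure_def CF(2) enn2real_mult)
  qed
  show pos: "0 < measure m C"
  proof (rule ccontr)
    assume "\<not> 0 < measure m C"
    then have "measure m C = 0"
      by (simp add: not_less measure_le_0_iff)
    then have "((\<lambda>i. 0 :: real) \<longlongrightarrow> 1) (net_filter I r)"
      using lim by simp
    then show False
      using tendsto_unique[OF N _ tendsto_const] by fastforce
  qed
  have "((\<lambda>i. real (card (A i \<inter> \<Lambda>)) / measure m (A i) * measure m C / measure m C)
      \<longlongrightarrow> 1 / measure m C) (net_filter I r)"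
    using pos by (intro tendsto_divide[OF lim tendsto_const]) simp
  then show "((\<lambda>i. real (card (A i \<inter> \<Lambda>)) / measure m (A i)) \<longlongrightarrow> 1 / measure m C) (net_filter I r)"
    using pos by simp
qed

lemma lattice_boundary_subset:
  assumes \<Lambda>: "subgroup \<Lambda> G" "discrete_subset T \<Lambda>" and A: "compactin T A" and K: "K \<subseteq> \<Lambda>"
  shows "K_boundary (G\<lparr>carrier := \<Lambda>\<rparr>) (subtopology T \<Lambda>) K (A \<inter> \<Lambda>) \<subseteq> boundary K A \<inter> \<Lambda>"
proof
  have disc: "subtopology T \<Lambda> = discrete_topology \<Lambda>"
    using \<Lambda>(2) by (simp add: discrete_subset_def)
  fix x assume "x \<in> K_boundary (G\<lparr>carrier := \<Lambda>\<rparr>) (subtopology T \<Lambda>) K (A \<inter> \<Lambda>)"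
  then have x: "x \<in> K <#> (\<Lambda> \<inter> (A \<inter> \<Lambda>))" "x \<in> K <#> (\<Lambda> \<inter> (\<Lambda> - A \<inter> \<Lambda>))"
    unfolding K_boundary_def disc discrete_topology_closure_of by (simp_all add: set_mult_def)
  have "K <#> (\<Lambda> \<inter> (A \<inter> \<Lambda>)) \<subseteq> K <#> A"
    by (intro set_mult_mono_both) auto
  moreover have "\<Lambda> \<inter> (\<Lambda> - A \<inter> \<Lambda>) \<subseteq> carrier G - A"
    using subgroup.subset[OF \<Lambda>(1)] by auto
  then have "\<Lambda> \<inter> (\<Lambda> - A \<inter> \<Lambda>) \<subseteq> co_closure A"
    using compl_subset_co_closure by (rule order_trans)
  then have "K <#> (\<Lambda> \<inter> (\<Lambda> - A \<inter> \<Lambda>)) \<subseteq> K <#> co_closure A"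
    by (intro set_mult_mono_both) simp
  moreover have "x \<in> \<Lambda>"
    using x(1) by (rule mem_set_multE) (use K subgroup.m_closed[OF \<Lambda>(1)] in auto)
  ultimately show "x \<in> boundary K A \<inter> \<Lambda>"
    using x unfolding K_boundary_compactin[OF A] by (intro IntI) (rule subsetD, assumption+)+
qed

text \<open>The boundary of the sample in \<open>\<Lambda>\<close> consists of lattice points in the boundary of \<open>A i\<close>. By the
  packing bound their number is controlled by the measure of a slightly larger boundary, which is
  small compared with the measure of \<open>A i\<close> and hence with the cardinality of the sample.\<close>

lemma lattice_van_hove_net:
  assumes \<Lambda>: "subgroup \<Lambda> G" "discrete_subset T \<Lambda>"
    and K: "compactin T K" "K <#> \<Lambda> = carrier G"
    and A: "van_hove_net G T m I r A"
  shows "van_hove_net (G\<lparr>carrier := \<Lambda>\<rparr>) (subtopology T \<Lambda>) (count_space \<Lambda>) I r (\<lambda>i. A i \<inter> \<Lambda>)"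
proof -
  have disc: "subtopology T \<Lambda> = discrete_topology \<Lambda>"
    using \<Lambda>(2) by (simp add: discrete_subset_def)
  have dir: "directed_set I r"
    using A by (simp add: van_hove_net_def)
  obtain C M where C: "C \<in> sets m" "C <#> \<Lambda> = carrier G" "separated C \<Lambda>"
    and M: "compactin T M" "\<one> \<in> M" "C \<subseteq> M"
    by (rule lattice_fundamental_domain[OF \<Lambda> K])
  note dl = lattice_density_limit[OF \<Lambda> C M A]
  obtain c M' where bd: "0 < c" "compactin T M'"
    "\<forall>B. compactin T B \<longrightarrow> finite (B \<inter> \<Lambda>) \<and> real (card (B \<inter> \<Lambda>)) \<le> c * measure m (M' <#> B)"
    by (rule lattice_finite_Int_compact[OF \<Lambda>])
  have fin: "finite (A i \<inter> \<Lambda>)" if "i \<in> I" for i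
    using bd(3) van_hove_net_compactin[OF A that] by simp
  have "0 < 1 / measure m C"
    using dl(1) by simp
  then have "eventually (\<lambda>i. 0 < real (card (A i \<inter> \<Lambda>)) / measure m (A i)) (net_filter I r)"
    by (rule order_tendstoD(1)[OF dl(2)])
  then have pos: "eventually (\<lambda>i. 0 < real (card (A i \<inter> \<Lambda>)) \<and> 0 < measure m (A i) \<and> compactin T (A i)) (net_filter I r)"
    using van_hove_eventually[OF A] by eventually_elim (simp add: zero_less_divide_iff)
  show ?thesis
    unfolding van_hove_net_def
  proof (intro conjI ballI allI impI)
    show "directed_set I r" by (rule dir)
    show "compactin (subtopology T \<Lambda>) (A i \<inter> \<Lambda>)" if "i \<in> I" for i
      unfolding disc by (simp add: compactin_discrete_topology fin[OF that])
    have "eventually (\<lambda>i. subtopology T \<Lambda> interior_of (A i \<inter> \<Lambda>) \<noteq> {}) (net_filter I r)"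
      using pos
    proof eventually_elim
      case (elim i)
      have "A i \<inter> \<Lambda> \<subseteq> subtopology T \<Lambda> interior_of (A i \<inter> \<Lambda>)"
        unfolding disc by (rule interior_of_maximal) simp_all
      moreover have "A i \<inter> \<Lambda> \<noteq> {}"
        using elim by auto
      ultimately show ?case
        by auto
    qed
    then show "\<exists>j\<in>I. \<forall>i\<in>I. (j, i) \<in> r \<longrightarrow> subtopology T \<Lambda> interior_of (A i \<inter> \<Lambda>) \<noteq> {}"
      unfolding eventually_net_filter[OF dir] .
    fix L assume "compactin (subtopology T \<Lambda>) L"
    then have L: "L \<subseteq> \<Lambda>" "finite L"
      unfolding disc by (simp_all add: compactin_discrete_topology)
    have Lc: "L \<subseteq> carrier G"
      using L(1) subgroup.subset[OF \<Lambda>(1)] by (rule order_trans)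
    have LT: "compactin T L"
      using L(2) Lc by (intro finite_imp_compactin) (simp_all add: topspace_T)
    let ?bd = "\<lambda>i. K_boundary (G\<lparr>carrier := \<Lambda>\<rparr>) (subtopology T \<Lambda>) L (A i \<inter> \<Lambda>)"
    let ?q = "\<lambda>i. c * (measure m (boundary (M' <#> L) (A i)) / measure m (A i)) /
      (real (card (A i \<inter> \<Lambda>)) / measure m (A i))"
    define b where "b i = real (card (?bd i))" for i
    have M'L: "compactin T (M' <#> L)"
      using bd(2) LT by (rule compactin_set_mult)
    have sub: "?bd i \<subseteq> boundary L (A i) \<inter> \<Lambda>"
      if "compactin T (A i)" for i
      using \<Lambda> that L(1) by (rule lattice_boundary_subset)
    have finb: "finite (boundary L (A i) \<inter> \<Lambda>)" if "compactin T (A i)" for i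
      using bd(3) compactin_K_boundary[OF LT that] by simp
    have b_le: "b i \<le> c * measure m (boundary (M' <#> L) (A i))" if Ai: "compactin T (A i)" for i
    proof -
      have "b i \<le> real (card (boundary L (A i) \<inter> \<Lambda>))"
        unfolding b_def using sub[OF Ai] finb[OF Ai] by (intro of_nat_mono card_mono)
      also have "\<dots> \<le> c * measure m (M' <#> boundary L (A i))"
        using bd(3) compactin_K_boundary[OF LT Ai] by simp
      also have "\<dots> \<le> c * measure m (boundary (M' <#> L) (A i))"
      proof (intro mult_left_mono measure_mono_fmeasurable)
        show "M' <#> boundary L (A i) \<subseteq> boundary (M' <#> L) (A i)"
          by (rule set_mult_K_boundary_subset[OF Ai compactin_subset_carrier[OF bd(2)] Lc])
        show "M' <#> boundary L (A i) \<in> sets m"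
          by (intro compactin_sets compactin_set_mult bd(2) compactin_K_boundary LT Ai)
        show "boundary (M' <#> L) (A i) \<in> fmeasurable m"
          by (intro compactin_fmeasurable compactin_K_boundary M'L Ai)
      qed (use bd(1) in simp)
      finally show ?thesis .
    qed
    have "((\<lambda>i. ?q i) \<longlongrightarrow> c * 0 / (1 / measure m C)) (net_filter I r)"
      by (intro tendsto_divide tendsto_mult tendsto_const van_hove_boundary_tendsto[OF A M'L] dl(2))
        (use dl(1) in simp)
    then have lim0: "((\<lambda>i. ?q i) \<longlongrightarrow> 0) (net_filter I r)"
      by (simp only: mult_zero_right div_0)
    have "((\<lambda>i. b i / real (card (A i \<inter> \<Lambda>))) \<longlongrightarrow> 0) (net_filter I r)"
    proof (rule Lim_null_comparison[OF _ lim0])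
      show "eventually (\<lambda>i. norm (b i / real (card (A i \<inter> \<Lambda>))) \<le>
          ?q i) (net_filter I r)"
        using pos
      proof eventually_elim
        case (elim i)
        have "b i / real (card (A i \<inter> \<Lambda>)) \<le>
            c * measure m (boundary (M' <#> L) (A i)) / real (card (A i \<inter> \<Lambda>))"
          using b_le elim by (intro divide_right_mono) simp_all
        moreover have "0 \<le> b i"
          by (simp add: b_def)
        ultimately show ?case
          using elim by simp
      qed
    qed
    then have "((\<lambda>i. emeasure (count_space \<Lambda>) (?bd i) /
        emeasure (count_space \<Lambda>) (A i \<inter> \<Lambda>)) \<longlongrightarrow> ennreal 0) (net_filter I r)"
    proof (rule tendsto_ennreal_ratio)
      show "eventually (\<lambda>i. emeasure (count_space \<Lambda>) (?bd i) = ennreal (b i) \<and>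
          emeasure (count_space \<Lambda>) (A i \<inter> \<Lambda>) = ennreal (real (card (A i \<inter> \<Lambda>))) \<and>
          0 \<le> b i \<and> 0 < real (card (A i \<inter> \<Lambda>))) (net_filter I r)"
        using pos eventually_mem_net[OF dir]
      proof eventually_elim
        case (elim i)
        then have Ai: "compactin T (A i)"
          by simp
        have "?bd i \<subseteq> \<Lambda>"
          using sub[OF Ai] by simp
        moreover have "finite (?bd i)"
          using sub[OF Ai] finb[OF Ai] by (rule finite_subset)
        ultimately show ?case
          using elim fin by (simp add: emeasure_count_space b_def ennreal_of_nat_eq_real_of_nat)
      qed
    qed
    then show "((\<lambda>i. emeasure (count_space \<Lambda>) (?bd i) /
        emeasure (count_space \<Lambda>) (A i \<inter> \<Lambda>)) \<longlongrightarrow> 0) (net_filter I r)"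
      by simp
  qed
qed

lemma lattice_has_uniform_density:
  assumes \<Lambda>: "subgroup \<Lambda> G" "discrete_subset T \<Lambda>"
    and K: "compactin T K" "K <#> \<Lambda> = carrier G"
  obtains \<delta> where "has_uniform_density G T m \<Lambda> \<delta>"
proof -
  obtain C M where C: "C \<in> sets m" "C <#> \<Lambda> = carrier G" "separated C \<Lambda>"
    and M: "compactin T M" "\<one> \<in> M" "C \<subseteq> M"
    by (rule lattice_fundamental_domain[OF \<Lambda> K])
  obtain c M' where bd: "0 < c" "compactin T M'"
    "\<forall>B. compactin T B \<longrightarrow> finite (B \<inter> \<Lambda>) \<and> real (card (B \<inter> \<Lambda>)) \<le> c * measure m (M' <#> B)"
    by (rule lattice_finite_Int_compact[OF \<Lambda>])
  have fin: "finite (\<Lambda> \<inter> B)" if "compactin T B" for B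
    using bd(3) that by (simp add: Int_commute)
  have "has_uniform_density G T m \<Lambda> (ennreal (1 / measure m C))"
    unfolding has_uniform_density_def
  proof (intro conjI allI impI)
    show "discrete_subset T \<Lambda>" by (rule \<Lambda>(2))
    show "ennreal (1 / measure m C) < \<infinity>" by simp
    fix I r and A :: "'a set net_index \<Rightarrow> 'a set"
    assume A: "van_hove_net G T m I r A"
    show "((\<lambda>i. ecard (\<Lambda> \<inter> A i) / emeasure m (A i)) \<longlongrightarrow> ennreal (1 / measure m C)) (net_filter I r)"
      by (rule tendsto_ennreal_ratio[OF lattice_density_limit(2)[OF \<Lambda> C M A]])
        (use van_hove_eventually[OF A] in \<open>eventually_elim, simp add: fin ecard_finite
          Int_commute emeasure_compactin ennreal_of_nat_eq_real_of_nat\<close>)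
  qed
  then show thesis
    by (rule that)
qed

end

text \<open>A point of \<open>k A i\<close> outside \<open>A i\<close> lies in the boundary of \<open>A i\<close> for \<open>K' = K \<union> {\<one>}\<close>. So Van Hove
  nets in a discrete group are eventually invariant in the sense needed for
  \<open>discrete_ornstein_weiss\<close>.\<close>

lemma discrete_van_hove_almost_invariant:
  assumes H: "group H" and A: "van_hove_net H (discrete_topology (carrier H)) (count_space (carrier H)) I r A"
    and K: "finite K" "K \<subseteq> carrier H" and \<eta>: "0 < \<eta>"
  shows "eventually (\<lambda>i. finite (A i) \<and> A i \<noteq> {} \<and> A i \<subseteq> carrier H \<and>
    group.almost_invariant H K \<eta> (A i)) (net_filter I r)"
proof -
  interpret H: group H by (rule H)
  have dir: "directed_set I r"
    using A by (simp add: van_hove_net_def)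
  define K' where "K' = insert \<one>\<^bsub>H\<^esub> K"
  define bd where "bd i = K_boundary H (discrete_topology (carrier H)) K' (A i)" for i
  have "compactin (discrete_topology (carrier H)) K'"
    using K by (simp add: K'_def compactin_discrete_topology)
  then have "((\<lambda>i. emeasure (count_space (carrier H)) (bd i) / emeasure (count_space (carrier H)) (A i))
      \<longlongrightarrow> 0) (net_filter I r)"
    using A by (simp add: van_hove_net_def bd_def)
  moreover have "0 < ennreal \<eta>"
    using \<eta> by simp
  ultimately have small: "eventually (\<lambda>i. emeasure (count_space (carrier H)) (bd i) /
      emeasure (count_space (carrier H)) (A i) < ennreal \<eta>) (net_filter I r)"
    by (rule order_tendstoD(2))
  have "eventually (\<lambda>i. discrete_topology (carrier H) interior_of (A i) \<noteq> {}) (net_filter I r)"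
    using A unfolding eventually_net_filter[OF dir] by (simp add: van_hove_net_def)
  then have ne: "eventually (\<lambda>i. A i \<noteq> {}) (net_filter I r)"
    by eventually_elim (use interior_of_subset in auto)
  show ?thesis
    using small ne eventually_mem_net[OF dir]
  proof eventually_elim
    case (elim i)
    have "compactin (discrete_topology (carrier H)) (A i)"
      using A elim(3) by (simp add: van_hove_net_def)
    then have Ai: "finite (A i)" "A i \<subseteq> carrier H"
      by (simp_all add: compactin_discrete_topology)
    have cpos: "0 < real (card (A i))"
      using Ai elim(2) by (simp add: card_gt_0_iff)
    have bdi: "bd i = (K' <#>\<^bsub>H\<^esub> A i) \<inter> (K' <#>\<^bsub>H\<^esub> (carrier H - A i))"
      using Ai by (simp add: bd_def K_boundary_def discrete_topology_closure_of Int_absorb1 Int_absorb2 Diff_subset)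
    have finK: "finite (K' <#>\<^bsub>H\<^esub> A i)"
      using K Ai by (intro H.finite_set_mult) (simp_all add: K'_def)
    then have finb: "finite (bd i)"
      unfolding bdi by simp
    have "K' <#>\<^bsub>H\<^esub> A i \<subseteq> carrier H"
      using K Ai by (intro H.set_mult_closed) (simp_all add: K'_def)
    then have "bd i \<subseteq> carrier H"
      unfolding bdi by auto
    then have "ennreal (real (card (bd i))) / ennreal (real (card (A i))) < ennreal \<eta>"
      using elim(1) finb Ai by (simp add: emeasure_count_space ennreal_of_nat_eq_real_of_nat)
    then have "ennreal (real (card (bd i)) / real (card (A i))) < ennreal \<eta>"
      using cpos by (simp add: divide_ennreal)
    then have "real (card (bd i)) / real (card (A i)) < \<eta>"
      by (simp add: ennreal_less_iff)
    then have card_bd: "real (card (bd i)) \<le> \<eta> * real (card (A i))"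
      using cpos by (simp add: pos_divide_less_eq)
    have "H.almost_invariant K \<eta> (A i)"
      unfolding H.almost_invariant_def
    proof
      fix k assume k: "k \<in> K"
      have "(k <#\<^bsub>H\<^esub> A i) - A i \<subseteq> bd i"
      proof
        fix x assume x: "x \<in> (k <#\<^bsub>H\<^esub> A i) - A i"
        have "k <#\<^bsub>H\<^esub> A i \<subseteq> K' <#>\<^bsub>H\<^esub> A i"
          using k by (auto simp: l_coset_def set_mult_def K'_def)
        then have xK: "x \<in> K' <#>\<^bsub>H\<^esub> A i"
          using x by auto
        then have xc: "x \<in> carrier H"
          using \<open>K' <#>\<^bsub>H\<^esub> A i \<subseteq> carrier H\<close> by (rule rev_subsetD)
        have "\<one>\<^bsub>H\<^esub> \<otimes>\<^bsub>H\<^esub> x \<in> K' <#>\<^bsub>H\<^esub> (carrier H - A i)"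
          using x xc by (intro H.mem_set_multI) (simp_all add: K'_def)
        then show "x \<in> bd i"
          unfolding bdi using xK xc by simp
      qed
      then have "card ((k <#\<^bsub>H\<^esub> A i) - A i) \<le> card (bd i)"
        using finb by (rule card_mono[rotated])
      then show "real (card ((k <#\<^bsub>H\<^esub> A i) - A i)) \<le> \<eta> * real (card (A i))"
        using card_bd by linarith
    qed
    then show ?case
      using Ai elim(2) by simp
  qed
qed

context amenable_factor_action
begin

lemma lattice_subadditive:
  assumes \<Lambda>: "subgroup \<Lambda> G" and \<epsilon>: "0 < \<epsilon>"
  shows "subadditive_set_function (G\<lparr>carrier := \<Lambda>\<rparr>) (\<lambda>F. rlog_cov F \<epsilon>)"
proof -
  interpret L: group "G\<lparr>carrier := \<Lambda>\<rparr>"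
    using \<Lambda> is_group by (rule subgroup.subgroup_is_group)
  have \<Lambda>c: "\<Lambda> \<subseteq> carrier G"
    by (rule subgroup.subset[OF \<Lambda>])
  have comp: "compactin T F" if "finite F" "F \<subseteq> \<Lambda>" for F
    using that(1) order_trans[OF that(2) \<Lambda>c]
    by (intro finite_imp_compactin) (simp_all add: topspace_T)
  show ?thesis
  proof
    show "rlog_cov {} \<epsilon> = 0"
      using log_fibre_cov_empty[OF \<epsilon>] by simp
    show "rlog_cov A \<epsilon> \<le> rlog_cov B \<epsilon>" if "finite B" "B \<subseteq> carrier (G\<lparr>carrier := \<Lambda>\<rparr>)" "A \<subseteq> B" for A B
      using log_fibre_cov_mono[OF that(3)] log_fibre_cov_finite[OF comp \<epsilon>] that
      by (intro enn2real_mono) simp_all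
    show "rlog_cov (A \<union> B) \<epsilon> \<le> rlog_cov A \<epsilon> + rlog_cov B \<epsilon>"
      if "finite A" "A \<subseteq> carrier (G\<lparr>carrier := \<Lambda>\<rparr>)" "finite B" "B \<subseteq> carrier (G\<lparr>carrier := \<Lambda>\<rparr>)"
        "A \<inter> B = {}" for A B
    proof -
      have c: "compactin T A" "compactin T B"
        using that by (simp_all add: comp)
      have "ennreal (rlog_cov (A \<union> B) \<epsilon>) \<le> ennreal (rlog_cov A \<epsilon>) + ennreal (rlog_cov B \<epsilon>)"
        using log_fibre_cov_Un_le[OF c \<epsilon>]
        by (simp add: log_cov_eq[OF _ \<epsilon>, symmetric] compactin_Un c)
      then show ?thesis
        by (simp flip: ennreal_plus)
    qed
    show "rlog_cov (A #>\<^bsub>G\<lparr>carrier := \<Lambda>\<rparr>\<^esub> g) \<epsilon> = rlog_cov A \<epsilon>"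
      if "finite A" "A \<subseteq> carrier (G\<lparr>carrier := \<Lambda>\<rparr>)" "g \<in> carrier (G\<lparr>carrier := \<Lambda>\<rparr>)" for A g
    proof -
      have "A #>\<^bsub>G\<lparr>carrier := \<Lambda>\<rparr>\<^esub> g = A #> g"
        by (simp add: r_coset_def)
      moreover have "A \<subseteq> carrier G" "g \<in> carrier G"
        using that \<Lambda>c by (simp_all add: subset_iff)
      ultimately show ?thesis
        by (simp add: log_fibre_cov_r_coset)
    qed
  qed
qed

text \<open>At each fixed scale the averages over \<open>\<Lambda>\<close> converge to one number \<open>l\<close> along all Van Hove nets in
  \<open>\<Lambda>\<close>, by the discrete Ornstein-Weiss lemma. As the samples \<open>A i \<inter> \<Lambda>\<close> form such a net,
  \<open>l\<close> is also the lower limit along them.\<close>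

lemma rel_entropy_lattice:
  fixes A :: "'i \<Rightarrow> 'g set"
  assumes \<Lambda>: "subgroup \<Lambda> G" "discrete_subset T \<Lambda>"
    and K: "compactin T K" "K <#> \<Lambda> = carrier G"
    and A: "van_hove_net G T m I r A"
  shows "rel_entropy (G\<lparr>carrier := \<Lambda>\<rparr>) (subtopology T \<Lambda>) (count_space \<Lambda>) X d \<phi> Y p =
    (SUP \<epsilon>\<in>{0<..}. Liminf (net_filter I r) (\<lambda>i. log_cov (A i \<inter> \<Lambda>) \<epsilon> / ecard (A i \<inter> \<Lambda>)))"
  unfolding rel_entropy_def
proof (rule SUP_cong[OF refl])
  fix \<epsilon> :: real assume "\<epsilon> \<in> {0<..}"
  then have \<epsilon>: "0 < \<epsilon>"
    by simp
  let ?H = "G\<lparr>carrier := \<Lambda>\<rparr>" and ?T = "subtopology T \<Lambda>" and ?m = "count_space \<Lambda>"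
  have disc: "?T = discrete_topology (carrier ?H)"
    using \<Lambda>(2) by (simp add: discrete_subset_def)
  have H: "group ?H"
    using \<Lambda>(1) is_group by (rule subgroup.subgroup_is_group)
  interpret S: subadditive_set_function ?H "\<lambda>F. rlog_cov F \<epsilon>"
    using \<Lambda>(1) \<epsilon> by (rule lattice_subadditive)
  have vh: "van_hove_net ?H ?T ?m I r (\<lambda>i. A i \<inter> \<Lambda>)"
    using \<Lambda> K A by (rule lattice_van_hove_net)
  have inv: "eventually (\<lambda>i. finite (B i) \<and> B i \<noteq> {} \<and> B i \<subseteq> carrier ?H \<and>
      S.almost_invariant L \<eta> (B i)) (net_filter J s)"
    if "van_hove_net ?H ?T ?m J s B" "finite L" "L \<subseteq> carrier ?H" "0 < \<eta>"
    for J and s :: "('j \<times> 'j) set" and B L \<eta>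
    using that(1) by (intro discrete_van_hove_almost_invariant[OF H _ that(2-4)]) (simp add: disc)
  have N: "net_filter I r \<noteq> bot"
    by (rule van_hove_net_nontrivial[OF A])
  \<comment> \<open>The samples themselves supply the invariant sets that the discrete lemma asks for.\<close>
  have ex: "\<exists>F. finite F \<and> F \<noteq> {} \<and> F \<subseteq> carrier ?H \<and> S.almost_invariant L \<eta> F"
    if "finite L" "L \<subseteq> carrier ?H" "0 < \<eta>" for L \<eta>
    using eventually_happens'[OF N inv[OF vh that]] by (elim exE) (rule exI)
  obtain l where l: "\<And>\<gamma>. 0 < \<gamma> \<Longrightarrow> \<exists>K \<eta>. finite K \<and> K \<subseteq> carrier ?H \<and> 0 < \<eta> \<and>
    (\<forall>F. finite F \<and> F \<noteq> {} \<and> F \<subseteq> carrier ?H \<and> S.almost_invariant K \<eta> F \<longrightarrow>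
      \<bar>rlog_cov F \<epsilon> / real (card F) - l\<bar> \<le> \<gamma>)"
    using S.discrete_ornstein_weiss[OF ex] by blast
  have lim: "((\<lambda>i. log_cov (B i) \<epsilon> / emeasure ?m (B i)) \<longlongrightarrow> ennreal l) (net_filter J s)"
    if B: "van_hove_net ?H ?T ?m J s B" for J s and B :: "'g set net_index \<Rightarrow> 'g set"
  proof (rule tendsto_ennreal_ratio)
    show "((\<lambda>i. rlog_cov (B i) \<epsilon> / real (card (B i))) \<longlongrightarrow> l) (net_filter J s)"
    proof (rule tendstoI)
      fix \<gamma> :: real assume "0 < \<gamma>"
      then have "0 < \<gamma> / 2"
        by simp
      from l[OF this] obtain L \<eta> where L: "finite L" "L \<subseteq> carrier ?H" "0 < \<eta>"
        "\<forall>F. finite F \<and> F \<noteq> {} \<and> F \<subseteq> carrier ?H \<and> S.almost_invariant L \<eta> F \<longrightarrow>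
          \<bar>rlog_cov F \<epsilon> / real (card F) - l\<bar> \<le> \<gamma> / 2"
        by (elim exE conjE)
      show "eventually (\<lambda>i. dist (rlog_cov (B i) \<epsilon> / real (card (B i))) l < \<gamma>) (net_filter J s)"
        using inv[OF B L(1-3)]
      proof eventually_elim
        case (elim i)
        then have "\<bar>rlog_cov (B i) \<epsilon> / real (card (B i)) - l\<bar> \<le> \<gamma> / 2"
          using L(4) by simp
        then show ?case
          using \<open>0 < \<gamma>\<close> by (simp add: dist_real_def)
      qed
    qed
    show "eventually (\<lambda>i. log_cov (B i) \<epsilon> = ennreal (rlog_cov (B i) \<epsilon>) \<and>
        emeasure ?m (B i) = ennreal (real (card (B i))) \<and> 0 \<le> rlog_cov (B i) \<epsilon> \<and>
        0 < real (card (B i))) (net_filter J s)"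
      using inv[OF B finite.emptyI empty_subsetI zero_less_one]
    proof eventually_elim
      case (elim i)
      then have Bi: "finite (B i)" "B i \<noteq> {}" "B i \<subseteq> \<Lambda>"
        by simp_all
      have "compactin T (B i)"
        using Bi(1) order_trans[OF Bi(3) subgroup.subset[OF \<Lambda>(1)]]
        by (intro finite_imp_compactin) (simp_all add: topspace_T)
      then show ?case
        using Bi by (simp add: log_cov_eq[OF _ \<epsilon>, symmetric] emeasure_count_space
            ennreal_of_nat_eq_real_of_nat card_gt_0_iff)
    qed
  qed
  obtain J s and B :: "'g set net_index \<Rightarrow> 'g set" where B: "van_hove_net ?H ?T ?m J s B"
    by (rule van_hove_net_reindex[OF vh])
  have the_lim: "(THE L. \<forall>I r (A :: 'g set net_index \<Rightarrow> 'g set). van_hove_net ?H ?T ?m I r A \<longrightarrow>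
      ((\<lambda>i. log_cov (A i) \<epsilon> / emeasure ?m (A i)) \<longlongrightarrow> L) (net_filter I r)) = ennreal l"
    using B lim by (rule van_hove_limit_unique)
  have "((\<lambda>i. log_cov (A i \<inter> \<Lambda>) \<epsilon> / emeasure ?m (A i \<inter> \<Lambda>)) \<longlongrightarrow> ennreal l) (net_filter I r)"
    by (rule van_hove_limit_any_index[where F = "\<lambda>A. log_cov A \<epsilon> / emeasure ?m A", OF vh lim])
  moreover have "emeasure ?m (A i \<inter> \<Lambda>) = ecard (A i \<inter> \<Lambda>)" for i
    by (simp add: ecard_def emeasure_count_space)
  ultimately have "Liminf (net_filter I r) (\<lambda>i. log_cov (A i \<inter> \<Lambda>) \<epsilon> / ecard (A i \<inter> \<Lambda>)) = ennreal l"
    by (intro lim_imp_Liminf[OF N]) simp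
  then show "(THE L. \<forall>I r (A :: 'g set net_index \<Rightarrow> 'g set). van_hove_net ?H ?T ?m I r A \<longrightarrow>
      ((\<lambda>i. log_cov (A i) \<epsilon> / emeasure ?m (A i)) \<longlongrightarrow> L) (net_filter I r)) =
      Liminf (net_filter I r) (\<lambda>i. log_cov (A i \<inter> \<Lambda>) \<epsilon> / ecard (A i \<inter> \<Lambda>))"
    using the_lim by simp
qed

end

section \<open>The entropy of a factor map through samples and lattices\<close>

theorem theorem1p4:
  fixes G :: "('g, 'm) monoid_scheme" and T :: "'g topology" and m :: "'g measure"
    and X :: "'x set" and d :: "'x \<Rightarrow> 'x \<Rightarrow> real" and Y :: "'y topology"
    and \<phi> :: "'g \<Rightarrow> 'x \<Rightarrow> 'x" and \<psi> :: "'g \<Rightarrow> 'y \<Rightarrow> 'y" and p :: "'x \<Rightarrow> 'y"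
    and \<Lambda> :: "'g set" and I :: "'i set" and r :: "('i \<times> 'i) set" and A :: "'i \<Rightarrow> 'g set"
  assumes "amenable_group G T m"
    and "ornstein_weiss G T m"
    and "Metric_space X d" and "compact_space (Metric_space.mtopology X d)"
    and "group_action_on G T (Metric_space.mtopology X d) \<phi>"
    and "group_action_on G T Y \<psi>"
    and "factor_map G (Metric_space.mtopology X d) \<phi> Y \<psi> p"
    and "relatively_dense G T \<Lambda>"
    and "van_hove_net G T m I r A"
  shows
    "(well_defined_density G T m \<Lambda> \<longrightarrow>
        rel_entropy G T m X d \<phi> Y p =
          dens G T m \<Lambda> *
            (SUP \<epsilon>\<in>{0<..}. Liminf (net_filter I r)
               (\<lambda>i. log_fibre_cov X d \<phi> Y p (A i \<inter> \<Lambda>) \<epsilon> / ecard (A i \<inter> \<Lambda>))) \<and>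
        rel_entropy G T m X d \<phi> Y p =
          dens G T m \<Lambda> *
            (SUP \<epsilon>\<in>{0<..}. Limsup (net_filter I r)
               (\<lambda>i. log_fibre_cov X d \<phi> Y p (A i \<inter> \<Lambda>) \<epsilon> / ecard (A i \<inter> \<Lambda>)))) \<and>
     (uniform_lattice G T \<Lambda> \<longrightarrow>
        rel_entropy G T m X d \<phi> Y p =
          dens G T m \<Lambda> *
            rel_entropy (G\<lparr>carrier := \<Lambda>\<rparr>) (subtopology T \<Lambda>) (count_space \<Lambda>) X d \<phi> Y p)"
proof -
  have tg: "topological_group G T" "locally_compact_space T" "haar_measure G T m"
    using assms(1) by (simp_all add: amenable_group_def)
  then have "group G"
    by (simp add: topological_group_def)
  then interpret amenable_factor_action G T m X d \<phi> Y \<psi> p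
    by (intro amenable_factor_action.intro haar_group.intro haar_group_axioms.intro
        compact_factor_action.intro compact_factor_action_axioms.intro
        topological_group_on.intro topological_group_on_axioms.intro
        amenable_factor_action_axioms.intro tg assms)
  note uniform = rel_entropy_uniform_density[OF assms(2,8) _ assms(9)]
  show ?thesis
  proof (rule conjI; rule impI)
    assume "well_defined_density G T m \<Lambda>"
    then obtain \<delta> where \<delta>: "has_uniform_density G T m \<Lambda> \<delta>"
      unfolding well_defined_density_def by (elim exE)
    show "rel_entropy G T m X d \<phi> Y p = dens G T m \<Lambda> * (SUP \<epsilon>\<in>{0<..}. Liminf (net_filter I r)
          (\<lambda>i. log_cov (A i \<inter> \<Lambda>) \<epsilon> / ecard (A i \<inter> \<Lambda>))) \<and>
        rel_entropy G T m X d \<phi> Y p = dens G T m \<Lambda> * (SUP \<epsilon>\<in>{0<..}. Limsup (net_filter I r)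
          (\<lambda>i. log_cov (A i \<inter> \<Lambda>) \<epsilon> / ecard (A i \<inter> \<Lambda>)))"
      unfolding dens_eq[OF \<delta>] by (rule uniform[OF \<delta>])
  next
    assume "uniform_lattice G T \<Lambda>"
    then have \<Lambda>: "subgroup \<Lambda> G" "discrete_subset T \<Lambda>"
      by (simp_all add: uniform_lattice_def)
    have "\<exists>K. compactin T K \<and> K <#>\<^bsub>G\<^esub> \<Lambda> = carrier G"
      using assms(8) by (simp add: relatively_dense_def)
    then obtain K where K: "compactin T K" "K <#>\<^bsub>G\<^esub> \<Lambda> = carrier G"
      by (elim exE conjE)
    obtain \<delta> where \<delta>: "has_uniform_density G T m \<Lambda> \<delta>"
      by (rule lattice_has_uniform_density[OF \<Lambda> K])
    show "rel_entropy G T m X d \<phi> Y p = dens G T m \<Lambda> *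
        rel_entropy (G\<lparr>carrier := \<Lambda>\<rparr>) (subtopology T \<Lambda>) (count_space \<Lambda>) X d \<phi> Y p"
      unfolding dens_eq[OF \<delta>] rel_entropy_lattice[OF \<Lambda> K assms(9)] by (rule uniform[OF \<delta>, THEN conjunct1])
  qed
qed

end
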